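(* Let $k$ be an algebraically closed field of characteristic $p\neq 2,3$. A scheme $X\in\mathrm{Hilb}_6^{aG,0}(\mathbb P^4_k)$ can be obtained via the Anglo-American construction if and only if it can be obtained via the Scandinavian construction.
   Context: $\mathrm{Hilb}_6^{aG,0}(\mathbb P^4_k)$ is the locus in the Hilbert scheme $\mathrm{Hilb}_6(\mathbb P^4_k)$ (of subschemes of dimension $0$ and degree $6$) of the arithmetically Gorenstein subschemes (i.e. with Gorenstein homogeneous coordinate ring) not contained in a hyperplane. Scandinavian construction: let $M=(m_{i,j})_{0\le i,j\le 2}$ be a $3\times3$ matrix of linear forms in $k[x_0,\dots,x_4]$ such that the ideal $F_2(M)$ generated by the $2\times2$ minors of $M$ has depth $4$ (the maximal possible value). $X$ is obtained via the Scandinavian construction if its homogeneous ideal is $F_2(M)$ for some such $M$. Anglo-American construction: let $M=(m_{i,j,h})_{0\le i,j,h\le1}$ be a cubic array of linear forms in $k[x_0,\dots,x_4]$, and let $I$ be the ideal generated by the $12$ determinants of its faces, including the diagonal ones: the six $2\times2$ matrices obtained by fixing one of the three indices, and the six $2\times 2$ matrices obtained by choosing two of the three indices and requiring them to be either equal or different (e.g. $(m_{i,i,h})_{i,h}$ and $(m_{i,1-i,h})_{i,h}$). Assume that $I$ has depth $4$ (the maximal possible value). $X$ is obtained via the Anglo-American construction if its homogeneous ideal is $I$ for some such array. *)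

theory Defs
  imports
    "HOL-Algebra.Ring_Divisibility"
    "HOL-Algebra.QuotRing"
    "HOL-Algebra.Algebraic_Closure_Type"
    "HOL-Library.Extended_Nat"
    "HOL-Library.Numeral_Type"
    "HOL-Library.Poly_Mapping"
begin

section \<open>Depth, dimension and Gorenstein rings\<close>

definition regular_sequence :: "('a, 'b) ring_scheme \<Rightarrow> 'a list \<Rightarrow> bool" where
  "regular_sequence R fs \<longleftrightarrow>
     set fs \<subseteq> carrier R \<and>
     (\<forall>i<length fs. \<forall>r\<in>carrier R.
        r \<otimes>\<^bsub>R\<^esub> (fs ! i) \<in> Idl\<^bsub>R\<^esub> (set (take i fs)) \<longrightarrow> r \<in> Idl\<^bsub>R\<^esub> (set (take i fs))) \<and>
     Idl\<^bsub>R\<^esub> (set fs) \<noteq> carrier R"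

text \<open>The depth (also called grade) of an ideal: the maximal length of a regular sequence
  contained in it.\<close>

definition ideal_depth :: "('a, 'b) ring_scheme \<Rightarrow> 'a set \<Rightarrow> enat" where
  "ideal_depth R I = (SUP fs\<in>{fs. regular_sequence R fs \<and> set fs \<subseteq> I}. enat (length fs))"

definition maximal_regular_sequence :: "('a, 'b) ring_scheme \<Rightarrow> 'a set \<Rightarrow> 'a list \<Rightarrow> bool" where
  "maximal_regular_sequence R I fs \<longleftrightarrow>
     regular_sequence R fs \<and> set fs \<subseteq> I \<and> \<not> (\<exists>f\<in>I. regular_sequence R (fs @ [f]))"

definition krull_dim :: "('a, 'b) ring_scheme \<Rightarrow> enat" where
  "krull_dim R =
     (SUP n\<in>{n. \<exists>P. (\<forall>i\<le>n. primeideal (P i) R) \<and> (\<forall>i<n. P i \<subset> P (Suc i))}. enat n)"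

definition noetherian_local_ring :: "('a, 'b) ring_scheme \<Rightarrow> 'a set \<Rightarrow> bool" where
  "noetherian_local_ring R m \<longleftrightarrow> cring R \<and> noetherian_ring R \<and> {J. maximalideal J R} = {m}"

definition cohen_macaulay_local :: "('a, 'b) ring_scheme \<Rightarrow> 'a set \<Rightarrow> bool" where
  "cohen_macaulay_local R m \<longleftrightarrow> noetherian_local_ring R m \<and> ideal_depth R m = krull_dim R"

text \<open>For an ideal \<open>q\<close> of a local ring \<open>(R, m)\<close>, the socle of \<open>R/q\<close> is \<open>(q : m)/q\<close>, a vector
  space over \<open>R/m\<close>. It has dimension one iff it is nonzero and generated by one element.\<close>

definition colon_ideal :: "('a, 'b) ring_scheme \<Rightarrow> 'a set \<Rightarrow> 'a set \<Rightarrow> 'a set" where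
  "colon_ideal R q m = {x \<in> carrier R. \<forall>y\<in>m. x \<otimes>\<^bsub>R\<^esub> y \<in> q}"

definition socle_dim_one :: "('a, 'b) ring_scheme \<Rightarrow> 'a set \<Rightarrow> 'a set \<Rightarrow> bool" where
  "socle_dim_one R m q \<longleftrightarrow>
     (\<exists>s\<in>carrier R. s \<notin> q \<and> colon_ideal R q m = Idl\<^bsub>R\<^esub> (insert s q))"

text \<open>A Noetherian local ring is Gorenstein if it is Cohen--Macaulay of type one. The type is
  the dimension of the socle of the residue ring by a maximal regular sequence in the maximal
  ideal. It does not depend on the sequence, and such sequences exist because the ring is
  Noetherian.\<close>

definition gorenstein_local :: "('a, 'b) ring_scheme \<Rightarrow> 'a set \<Rightarrow> bool" where
  "gorenstein_local R m \<longleftrightarrow>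
     cohen_macaulay_local R m \<and>
     (\<forall>fs. maximal_regular_sequence R m fs \<longrightarrow> socle_dim_one R m (Idl\<^bsub>R\<^esub> (set fs)))"

text \<open>The fraction \<open>a/s\<close> in the localization at a prime ideal \<open>P\<close> is the class of all pairs
  equivalent to \<open>(a, s)\<close>.\<close>

definition fraction :: "('a, 'b) ring_scheme \<Rightarrow> 'a set \<Rightarrow> 'a \<Rightarrow> 'a \<Rightarrow> ('a \<times> 'a) set" where
  "fraction R P a s =
     {(b, t). b \<in> carrier R \<and> t \<in> carrier R - P \<and>
        (\<exists>u\<in>carrier R - P. u \<otimes>\<^bsub>R\<^esub> (a \<otimes>\<^bsub>R\<^esub> t) = u \<otimes>\<^bsub>R\<^esub> (b \<otimes>\<^bsub>R\<^esub> s))}"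

definition localization :: "('a, 'b) ring_scheme \<Rightarrow> 'a set \<Rightarrow> ('a \<times> 'a) set ring" where
  "localization R P =
     \<lparr>carrier = {fraction R P a s | a s. a \<in> carrier R \<and> s \<in> carrier R - P},
      monoid.mult = (\<lambda>A B. \<Union>(a, s)\<in>A. \<Union>(b, t)\<in>B. fraction R P (a \<otimes>\<^bsub>R\<^esub> b) (s \<otimes>\<^bsub>R\<^esub> t)),
      one = fraction R P \<one>\<^bsub>R\<^esub> \<one>\<^bsub>R\<^esub>,
      zero = fraction R P \<zero>\<^bsub>R\<^esub> \<one>\<^bsub>R\<^esub>,
      add = (\<lambda>A B. \<Union>(a, s)\<in>A. \<Union>(b, t)\<in>B.
               fraction R P (a \<otimes>\<^bsub>R\<^esub> t \<oplus>\<^bsub>R\<^esub> b \<otimes>\<^bsub>R\<^esub> s) (s \<otimes>\<^bsub>R\<^esub> t))\<rparr>"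

text \<open>The extension of \<open>P\<close> to the localization at \<open>P\<close>.\<close>

definition local_maximal_ideal :: "('a, 'b) ring_scheme \<Rightarrow> 'a set \<Rightarrow> ('a \<times> 'a) set set" where
  "local_maximal_ideal R P = {fraction R P a s | a s. a \<in> P \<and> s \<in> carrier R - P}"

definition gorenstein_ring :: "('a, 'b) ring_scheme \<Rightarrow> bool" where
  "gorenstein_ring R \<longleftrightarrow>
     cring R \<and> noetherian_ring R \<and>
     (\<forall>P. maximalideal P R \<longrightarrow> gorenstein_local (localization R P) (local_maximal_ideal R P))"


section \<open>The homogeneous coordinate ring of projective four-space\<close>

text \<open>Polynomials in \<open>x\<^sub>0, \<dots>, x\<^sub>4\<close>: the five-element type \<open>5\<close> indexes the variables, and a
  monomial is its exponent vector.\<close>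

type_synonym monomial5 = "5 \<Rightarrow>\<^sub>0 nat"
type_synonym 'k poly5 = "monomial5 \<Rightarrow>\<^sub>0 'k"

abbreviation S5 :: "'k::field poly5 ring" where
  "S5 \<equiv> ring_of_type_algebra"

definition variable :: "5 \<Rightarrow> 'k::field poly5" where
  "variable i = Poly_Mapping.single (Poly_Mapping.single i 1) 1"

definition mon_degree :: "monomial5 \<Rightarrow> nat" where
  "mon_degree m = (\<Sum>i\<in>UNIV. Poly_Mapping.lookup m i)"

definition forms :: "nat \<Rightarrow> 'k::field poly5 set" where
  "forms d = {f. \<forall>m\<in>Poly_Mapping.keys f. mon_degree m = d}"

abbreviation linear_form :: "'k::field poly5 \<Rightarrow> bool" where
  "linear_form f \<equiv> f \<in> forms 1"

definition hom_component :: "nat \<Rightarrow> 'k::field poly5 \<Rightarrow> 'k poly5" where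
  "hom_component d f =
     (\<Sum>m | m \<in> Poly_Mapping.keys f \<and> mon_degree m = d.
        Poly_Mapping.single m (Poly_Mapping.lookup f m))"

definition homogeneous_ideal :: "'k::field poly5 set \<Rightarrow> bool" where
  "homogeneous_ideal I \<longleftrightarrow> ideal I S5 \<and> (\<forall>f\<in>I. \<forall>d. hom_component d f \<in> I)"

definition saturated :: "'k::field poly5 set \<Rightarrow> bool" where
  "saturated I \<longleftrightarrow> (\<forall>f. (\<forall>i. \<exists>n. variable i ^ n * f \<in> I) \<longrightarrow> f \<in> I)"

text \<open>Closed subschemes of projective four-space correspond bijectively to saturated homogeneous
  ideals (including the unit ideal, for the empty scheme). A subscheme \<open>Z\<close> is represented by its
  saturated homogeneous ideal, so \<open>Z\<close> itself is also the homogeneous ideal of the subscheme.\<close>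

definition closed_subscheme :: "'k::field poly5 set \<Rightarrow> bool" where
  "closed_subscheme Z \<longleftrightarrow> homogeneous_ideal Z \<and> saturated Z"

definition scale5 :: "'k::field \<Rightarrow> 'k poly5 \<Rightarrow> 'k poly5" where
  "scale5 c f = Poly_Mapping.single 0 c * f"

lemma vector_space_scale5: "vector_space (scale5 :: 'k::field \<Rightarrow> 'k poly5 \<Rightarrow> 'k poly5)"
  by unfold_locales
    (simp_all add: scale5_def distrib_left distrib_right single_add mult_single
      flip: mult.assoc)

text \<open>The dimension over \<open>k\<close> of the degree \<open>d\<close> part of the homogeneous coordinate ring, namely
  \<open>dim S\<^sub>d - dim I\<^sub>d\<close>. Both spaces are finite-dimensional and the second lies in the first, so the
  subtraction does not truncate.\<close>

definition hilbert_function :: "'k::field poly5 set \<Rightarrow> nat \<Rightarrow> nat" where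
  "hilbert_function Z d =
     vector_space.dim scale5 (forms d :: 'k poly5 set) - vector_space.dim scale5 (Z \<inter> forms d)"

text \<open>Dimension zero and degree \<open>n\<close> means that the Hilbert polynomial is the constant \<open>n\<close>.\<close>

definition Hilb :: "nat \<Rightarrow> 'k::field poly5 set set" where
  "Hilb n = {Z. closed_subscheme Z \<and> (\<forall>\<^sub>F d in sequentially. hilbert_function Z d = n)}"

definition arithmetically_gorenstein :: "'k::field poly5 set \<Rightarrow> bool" where
  "arithmetically_gorenstein Z \<longleftrightarrow> gorenstein_ring (S5 Quot Z)"

definition in_hyperplane :: "'k::field poly5 set \<Rightarrow> bool" where
  "in_hyperplane Z \<longleftrightarrow> (\<exists>l. linear_form l \<and> l \<noteq> 0 \<and> l \<in> Z)"

definition Hilb_aG_0 :: "nat \<Rightarrow> 'k::field poly5 set set" where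
  "Hilb_aG_0 n = {Z \<in> Hilb n. arithmetically_gorenstein Z \<and> \<not> in_hyperplane Z}"


section \<open>The two constructions\<close>

definition minors2 :: "(3 \<Rightarrow> 3 \<Rightarrow> 'k::field poly5) \<Rightarrow> 'k poly5 set" where
  "minors2 M = {M i j * M i' j' - M i j' * M i' j | i i' j j'. i < i' \<and> j < j'}"

definition scandinavian :: "'k::field poly5 set \<Rightarrow> bool" where
  "scandinavian Z \<longleftrightarrow>
     (\<exists>M. (\<forall>i j. linear_form (M i j)) \<and>
        ideal_depth S5 (Idl\<^bsub>S5\<^esub> (minors2 M)) = 4 \<and>
        Z = Idl\<^bsub>S5\<^esub> (minors2 M))"

definition det2 :: "(2 \<Rightarrow> 2 \<Rightarrow> 'k::field poly5) \<Rightarrow> 'k poly5" where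
  "det2 A = A 0 0 * A 1 1 - A 0 1 * A 1 0"

text \<open>The index type \<open>2\<close> is the integers modulo two, with elements \<open>0\<close> and \<open>1\<close>, so \<open>1 - i\<close> is
  the other index.\<close>

definition cube_faces :: "(2 \<Rightarrow> 2 \<Rightarrow> 2 \<Rightarrow> 'k::field poly5) \<Rightarrow> (2 \<Rightarrow> 2 \<Rightarrow> 'k poly5) set" where
  "cube_faces M =
     {\<lambda>j h. M 0 j h, \<lambda>j h. M 1 j h,
      \<lambda>i h. M i 0 h, \<lambda>i h. M i 1 h,
      \<lambda>i j. M i j 0, \<lambda>i j. M i j 1,
      \<lambda>i h. M i i h, \<lambda>i h. M i (1 - i) h,
      \<lambda>i j. M i j i, \<lambda>i j. M i j (1 - i),
      \<lambda>i j. M i j j, \<lambda>i j. M i j (1 - j)}"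

definition anglo_american :: "'k::field poly5 set \<Rightarrow> bool" where
  "anglo_american Z \<longleftrightarrow>
     (\<exists>M. (\<forall>i j h. linear_form (M i j h)) \<and>
        ideal_depth S5 (Idl\<^bsub>S5\<^esub> (det2 ` cube_faces M)) = 4 \<and>
        Z = Idl\<^bsub>S5\<^esub> (det2 ` cube_faces M))"

end

theory Submission
  imports Defs "HOL-Analysis.Cartesian_Space"
begin

text \<open>The nine \<open>2 \<times> 2\<close> minors of a \<open>3 \<times> 3\<close> matrix with three equal diagonal entries are, up to sign and
  repetition, the twelve face determinants of a cube with two equal opposite corners. So it suffices to
  bring a given matrix or cube of linear forms into this shape by invertible row, column and slice
  operations, which do not change the ideal. This is a condition on the space \<open>W\<close> of linear relations
  between the entries: a cube can be normalised if \<open>W\<close> contains a tensor with nonzero hyperdeterminant, and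
  a matrix if \<open>W\<close> contains a pencil equivalent to diagonal matrices with distinct eigenvalues.

  If \<open>W\<close> contains no such tensor, then the hyperdeterminant vanishes identically on \<open>W\<close>, so its gradient at
  each point of \<open>W\<close> is orthogonal to \<open>W\<close>. This gradient has rank at most one, hence gives a point of the
  scheme. But the scheme has finitely many points because its Hilbert polynomial is constant, so the gradient
  has constant direction or vanishes, and in either case \<open>W\<close> is so degenerate that the scheme contains a
  line. For matrices one may assume that \<open>W\<close> contains the identity. If all traceless elements have a double
  eigenvalue, then this eigenvalue is a linear function on them, and subtracting it gives a space of singular
  matrices to which the same argument applies, with the determinant in place of the hyperdeterminant.\<close>

section \<open>Ideals and forms in the polynomial ring\<close>

text \<open>Evaluated at the points of affine five-space, the entries of the array sweep out exactly
  the annihilator of \<open>W\<close>, so the scheme is the section of a Segre variety by that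
  linear space. The hyperdeterminant and the determinant are the equations of the dual varieties of
  the two Segre varieties. By biduality a gradient on the dual variety is a point of contact on the
  Segre variety; hence its rank is at most one, and hence exactly these invariants obstruct the
  normal form. A nonzero hyperdeterminant makes a relation a sum of two pure tensors whose factors
  form bases; in these bases the relation equates two opposite corners of the cube. In the same way
  a diagonal pencil equates the three diagonal entries of the matrix. Every contradiction ends with
  a line on the Segre section, so no dimension of \<open>W\<close> is ever computed. Ideals are
  compared through the ideals that contain their generators, and the depth condition is carried
  along because the ideal itself does not change.\<close>

lemma ideal_S5_iff:
  fixes J :: "'k::field poly5 set"
  shows "ideal J S5 \<longleftrightarrow> 0 \<in> J \<and> (\<forall>a\<in>J. \<forall>b\<in>J. a + b \<in> J) \<and> (\<forall>a\<in>J. \<forall>r. r * a \<in> J)"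
    (is "?L \<longleftrightarrow> ?R")
proof
  assume ?L
  then interpret ideal J "S5 :: 'k poly5 ring" .
  show ?R
    using additive_subgroup.zero_closed[OF is_additive_subgroup]
      additive_subgroup.a_closed[OF is_additive_subgroup] I_l_closed
    by (auto simp: ring_of_type_algebra_def)
next
  assume R: ?R
  have m: "- a \<in> J" if "a \<in> J" for a
    using R that by (metis mult_minus1)
  have inv: "inv\<^bsub>add_monoid S5\<^esub> a = - a" for a :: "'k poly5"
  proof (rule monoid.inv_unique'[symmetric])
    have "ring (S5 :: 'k poly5 ring)"
      by (rule ring_from_type_algebra)
    then show "monoid (add_monoid (S5 :: 'k poly5 ring))"
      by (meson abelian_group.a_group group.is_monoid ring.is_abelian_group)
  qed (auto simp: ring_of_type_algebra_def)
  have "subgroup J (add_monoid (S5 :: 'k poly5 ring))"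
    proof (rule subgroup.intro)
    show "inv\<^bsub>add_monoid S5\<^esub> a \<in> J" if "a \<in> J" for a
      unfolding inv by (rule m[OF that])
  qed (use R in \<open>auto simp: ring_of_type_algebra_def\<close>)
  then show ?L
    using R by (intro idealI ring_from_type_algebra)
      (auto simp: ring_of_type_algebra_def mult.commute)
qed

lemma
  fixes J :: "'k::field poly5 set"
  assumes "ideal J S5"
  shows S5_ideal_zero: "0 \<in> J"
    and S5_ideal_add: "\<And>a b. a \<in> J \<Longrightarrow> b \<in> J \<Longrightarrow> a + b \<in> J"
    and S5_ideal_mult: "\<And>a r. a \<in> J \<Longrightarrow> r * a \<in> J"
    and S5_ideal_minus: "\<And>a. a \<in> J \<Longrightarrow> - a \<in> J"
    and S5_ideal_sum: "\<And>f A. (\<And>x. x \<in> A \<Longrightarrow> f x \<in> J) \<Longrightarrow> sum f A \<in> J"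
proof -
  have R: "0 \<in> J" "\<And>a b. a \<in> J \<Longrightarrow> b \<in> J \<Longrightarrow> a + b \<in> J" "\<And>a r. a \<in> J \<Longrightarrow> r * a \<in> J"
    using assms by (auto simp: ideal_S5_iff)
  show "0 \<in> J" "\<And>a b. a \<in> J \<Longrightarrow> b \<in> J \<Longrightarrow> a + b \<in> J" "\<And>a r. a \<in> J \<Longrightarrow> r * a \<in> J"
    by (fact R)+
  show m: "- a \<in> J" if "a \<in> J" for a
    using R(3)[OF that, of "-1"] by simp
  show "sum f A \<in> J" if "\<And>x. x \<in> A \<Longrightarrow> f x \<in> J" for f and A :: "'z set"
    using that by (induction A rule: infinite_finite_induct) (auto intro: R)
qed

lemma genideal_S5_subset_iff:
  fixes J :: "'k::field poly5 set"
  assumes "ideal J S5"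
  shows "Idl\<^bsub>S5\<^esub> A \<subseteq> J \<longleftrightarrow> A \<subseteq> J"
  by (rule ring.Idl_subset_ideal[OF ring_from_type_algebra assms])
    (simp add: ring_of_type_algebra_def)

lemma ideal_genideal_S5: "ideal (Idl\<^bsub>S5\<^esub> A) (S5 :: 'k::field poly5 ring)"
  by (rule ring.genideal_ideal[OF ring_from_type_algebra]) (simp add: ring_of_type_algebra_def)

text \<open>Changes of coordinates are tracked only through the question whether a fixed ideal
  \<open>J\<close> contains all minors of an array; this lemma turns the answers into equality of
  ideals.\<close>

lemma genideal_S5_eqI:
  fixes A B :: "'k::field poly5 set"
  assumes "\<And>J. ideal J S5 \<Longrightarrow> A \<subseteq> J \<longleftrightarrow> B \<subseteq> J"
  shows "Idl\<^bsub>S5\<^esub> A = Idl\<^bsub>S5\<^esub> B"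
  using assms genideal_S5_subset_iff ideal_genideal_S5 by (metis subset_antisym subset_refl)

lemma sum_in_forms: "(\<And>x. x \<in> A \<Longrightarrow> f x \<in> forms d) \<Longrightarrow> sum f A \<in> forms d"
  using keys_sum[of f A] unfolding forms_def by fastforce

lemma mon_degree_add: "mon_degree (m + n) = mon_degree m + mon_degree n"
  by (simp add: mon_degree_def lookup_add sum.distrib)

lemma forms_mult: "f \<in> forms a \<Longrightarrow> g \<in> forms b \<Longrightarrow> f * g \<in> forms (a + b)"
  using keys_mult[of f g] by (fastforce simp: forms_def mon_degree_add)

lemma one_in_forms: "1 \<in> forms 0"
  by (simp add: forms_def mon_degree_def)

lemma forms_power: "f \<in> forms a \<Longrightarrow> f ^ n \<in> forms (n * a)"
  by (induction n) (auto simp: one_in_forms forms_mult)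

lemma forms_prod: "(\<And>x. x \<in> A \<Longrightarrow> f x \<in> forms 1) \<Longrightarrow> prod f A \<in> forms (card A)"
proof (induction A rule: infinite_finite_induct)
  case (insert x A)
  then show ?case
    using forms_mult[of "f x" 1 "prod f A" "card A"] by simp
qed (auto simp: one_in_forms)

abbreviation const5 :: "'k::field \<Rightarrow> 'k poly5" where
  "const5 c \<equiv> Poly_Mapping.single 0 c"

lemma const5_in_forms: "const5 c \<in> forms 0"
  by (simp add: forms_def mon_degree_def)

lemma forms_const_mult: "f \<in> forms d \<Longrightarrow> const5 c * f \<in> forms d"
  using forms_mult[OF const5_in_forms, of f d] by simp

lemma forms_add: "f \<in> forms d \<Longrightarrow> g \<in> forms d \<Longrightarrow> f + g \<in> forms d"
  using keys_add[of f g] by (auto simp: forms_def)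

lemma forms_diff: "f \<in> forms d \<Longrightarrow> g \<in> forms d \<Longrightarrow> f - g \<in> forms d"
  using forms_add[of f d "const5 (-1) * g"] forms_const_mult[of g d "-1"]
  by (simp add: single_uminus)

lemma variable_in_forms: "variable i \<in> forms 1"
  by (simp add: variable_def forms_def mon_degree_def lookup_single when_def)

lemma poly5_expand:
  fixes f :: "'k::field poly5"
  shows "f = (\<Sum>m\<in>Poly_Mapping.keys f. Poly_Mapping.single m (Poly_Mapping.lookup f m))"
  by (rule poly_mapping_eqI)
    (auto simp: lookup_sum lookup_single when_def sum.delta not_in_keys_iff_lookup_eq_zero)

section \<open>Evaluation at points of affine five-space\<close>

definition eval5 :: "(5 \<Rightarrow> 'k::field) \<Rightarrow> 'k poly5 \<Rightarrow> 'k" where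
  "eval5 x f = (\<Sum>m\<in>Poly_Mapping.keys f. Poly_Mapping.lookup f m * (\<Prod>i\<in>UNIV. x i ^ Poly_Mapping.lookup m i))"

lemma eval5_superset:
  "finite K \<Longrightarrow> Poly_Mapping.keys f \<subseteq> K \<Longrightarrow> eval5 x f = (\<Sum>m\<in>K. Poly_Mapping.lookup f m * (\<Prod>i\<in>UNIV. x i ^ Poly_Mapping.lookup m i))"
  unfolding eval5_def by (rule sum.mono_neutral_left) (auto simp: in_keys_iff)

lemma eval5_add: "eval5 x (f + g) = eval5 x f + eval5 x g"
  using eval5_superset[of "Poly_Mapping.keys f \<union> Poly_Mapping.keys g" f x] eval5_superset[of "Poly_Mapping.keys f \<union> Poly_Mapping.keys g" g x]
    eval5_superset[of "Poly_Mapping.keys f \<union> Poly_Mapping.keys g" "f + g" x] keys_add[of f g]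
  by (simp add: lookup_add distrib_right sum.distrib)

lemma eval5_0 [simp]: "eval5 x 0 = 0"
  by (simp add: eval5_def)

lemma eval5_sum: "eval5 x (sum f A) = (\<Sum>a\<in>A. eval5 x (f a))"
  by (induction A rule: infinite_finite_induct) (auto simp: eval5_add)

lemma eval5_single: "eval5 x (Poly_Mapping.single m c) = c * (\<Prod>i\<in>UNIV. x i ^ Poly_Mapping.lookup m i)"
  by (cases "c = 0") (auto simp: eval5_def)

lemma eval5_mult: "eval5 x (f * g) = eval5 x f * eval5 x g"
proof -
  have *: "eval5 x (Poly_Mapping.single m c * Poly_Mapping.single n d)
      = eval5 x (Poly_Mapping.single m c) * eval5 x (Poly_Mapping.single n d)" for m n c d
    by (simp add: mult_single eval5_single lookup_add power_add prod.distrib)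
  have "eval5 x (f * g) = eval5 x ((\<Sum>m\<in>Poly_Mapping.keys f. Poly_Mapping.single m (Poly_Mapping.lookup f m))
      * (\<Sum>m\<in>Poly_Mapping.keys g. Poly_Mapping.single m (Poly_Mapping.lookup g m)))"
    by (simp flip: poly5_expand)
  also have "\<dots> = eval5 x (\<Sum>m\<in>Poly_Mapping.keys f. Poly_Mapping.single m (Poly_Mapping.lookup f m))
      * eval5 x (\<Sum>m\<in>Poly_Mapping.keys g. Poly_Mapping.single m (Poly_Mapping.lookup g m))"
    by (simp add: sum_product eval5_sum *)
  finally show ?thesis
    by (simp flip: poly5_expand)
qed

lemma eval5_const [simp]: "eval5 x (const5 c) = c"
  by (simp add: eval5_single)

lemma eval5_1 [simp]: "eval5 x 1 = 1"
  by (simp add: eval5_const flip: single_one)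

lemma eval5_uminus: "eval5 x (- f) = - eval5 x f"
  using eval5_add[of x f "- f"] by (simp add: eq_neg_iff_add_eq_0 add.commute)

lemma eval5_diff: "eval5 x (f - g) = eval5 x f - eval5 x g"
  using eval5_add[of x f "- g"] by (simp add: eval5_uminus)

lemma eval5_power: "eval5 x (f ^ n) = eval5 x f ^ n"
  by (induction n) (auto simp: eval5_mult)

lemma eval5_prod: "eval5 x (prod f A) = (\<Prod>a\<in>A. eval5 x (f a))"
  by (induction A rule: infinite_finite_induct) (auto simp: eval5_mult)

lemma eval5_variable [simp]: "eval5 x (variable i) = x i"
proof -
  have "(\<Prod>j\<in>UNIV. x j ^ Poly_Mapping.lookup (Poly_Mapping.single i (Suc 0)) j) = (\<Prod>j\<in>UNIV. if j = i then x i else 1)"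
    by (rule prod.cong) (auto simp: lookup_single when_def)
  then show ?thesis
    by (simp add: variable_def eval5_single)
qed

text \<open>Together with \<open>genideal_S5_subset_iff\<close> it reduces vanishing of a whole
  ideal at \<open>x\<close> to vanishing of its generators.\<close>

lemma ideal_vanishing: "ideal {f. eval5 x f = 0} S5"
  by (simp add: ideal_S5_iff eval5_add eval5_mult)

section \<open>Linear forms and their coefficient vectors\<close>

definition coeff1 :: "'k::field poly5 \<Rightarrow> 5 \<Rightarrow> 'k" where
  "coeff1 f l = Poly_Mapping.lookup f (Poly_Mapping.single l 1)"

lemma mon_degree_eq_1:
  assumes "mon_degree m = 1"
  obtains l where "m = Poly_Mapping.single l 1"
proof -
  obtain l where l: "Poly_Mapping.lookup m l \<noteq> 0"
    using assms unfolding mon_degree_def by (metis One_nat_def sum.neutral zero_neq_one)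
  have "mon_degree m = Poly_Mapping.lookup m l + (\<Sum>i\<in>UNIV - {l}. Poly_Mapping.lookup m i)"
    unfolding mon_degree_def by (simp add: sum.remove)
  then have "Poly_Mapping.lookup m l = 1" "sum (Poly_Mapping.lookup m) (UNIV - {l}) = 0"
    using l assms by linarith+
  then have "Poly_Mapping.lookup m l = 1" "\<forall>i\<in>UNIV - {l}. Poly_Mapping.lookup m i = 0"
    by auto
  then have "m = Poly_Mapping.single l 1"
    by (intro poly_mapping_eqI) (auto simp: lookup_single when_def)
  then show thesis
    by (rule that)
qed

lemma linear_form_expand:
  assumes "linear_form f"
  shows "f = (\<Sum>l\<in>UNIV. const5 (coeff1 f l) * variable l)"
proof (rule poly_mapping_eqI)
  fix m
  have r: "Poly_Mapping.lookup (\<Sum>l\<in>UNIV. const5 (coeff1 f l) * variable l) m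
     = (\<Sum>l\<in>UNIV. coeff1 f l when Poly_Mapping.single l 1 = m)"
    by (simp add: variable_def mult_single lookup_sum lookup_single)
  show "Poly_Mapping.lookup f m = Poly_Mapping.lookup (\<Sum>l\<in>UNIV. const5 (coeff1 f l) * variable l) m"
  proof (cases "mon_degree m = 1")
    case True
    then obtain l0 where "m = Poly_Mapping.single l0 1"
      by (rule mon_degree_eq_1)
    moreover have "Poly_Mapping.single l (1::nat) = Poly_Mapping.single l0 1 \<longleftrightarrow> l = l0" for l :: 5
      by (metis lookup_single_eq lookup_single_not_eq zero_neq_one)
    ultimately show ?thesis
      unfolding r by (simp add: coeff1_def when_def)
  next
    case False
    then have "Poly_Mapping.lookup f m = 0"
      using assms by (auto simp: forms_def in_keys_iff)
    moreover have "mon_degree (Poly_Mapping.single l 1) = 1" for l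
      by (simp add: mon_degree_def lookup_single when_def)
    ultimately show ?thesis
      unfolding r using False by (auto simp: when_def intro!: sum.neutral)
  qed
qed

lemma eval5_linear_form:
  assumes "linear_form f"
  shows "eval5 x f = (\<Sum>l\<in>UNIV. coeff1 f l * x l)"
  by (subst linear_form_expand[OF assms]) (simp add: eval5_sum eval5_mult)

text \<open>The monomials of degree \<open>d\<close> span \<open>forms d\<close>, so finiteness
  makes the dimensions in \<open>hilbert_function\<close> genuine ones: an infinite basis would have
  \<open>card\<close> 0.\<close>

lemma finite_mon_degree: "finite {m. mon_degree m = d}"
proof (rule finite_subset)
  have "\<exists>h. m = Abs_poly_mapping h \<and> h \<in> {h. \<forall>i. h i \<in> {..d}}" if "mon_degree m = d" for m
  proof (intro exI[of _ "Poly_Mapping.lookup m"] conjI CollectI allI)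
    fix i
    have "Poly_Mapping.lookup m i \<le> (\<Sum>j\<in>UNIV. Poly_Mapping.lookup m j)"
      by (rule member_le_sum) auto
    then show "Poly_Mapping.lookup m i \<in> {..d}"
      using that by (simp add: mon_degree_def)
  qed (simp add: lookup_inverse)
  then show "{m. mon_degree m = d} \<subseteq> Abs_poly_mapping ` {h. \<forall>i. h i \<in> {..d}}"
    by auto
  have "{h. \<forall>i. h i \<in> {..d}} = PiE (UNIV :: 5 set) (\<lambda>_. {..d})"
    by (auto simp: PiE_def)
  then show "finite (Abs_poly_mapping ` {h :: 5 \<Rightarrow> nat. \<forall>i. h i \<in> {..d}})"
    by (simp add: finite_PiE)
qed

section \<open>Points on a scheme of finite degree\<close>

interpretation poly5: vector_space "scale5 :: 'k::field \<Rightarrow> 'k poly5 \<Rightarrow> 'k poly5"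
  by (rule vector_space_scale5)

lemma forms_subset_span:
  "(forms d :: 'k::field poly5 set) \<subseteq> poly5.span ((\<lambda>m. Poly_Mapping.single m 1) ` {m. mon_degree m = d})"
proof
  fix f :: "'k poly5"
  assume f: "f \<in> forms d"
  have "(\<Sum>m\<in>Poly_Mapping.keys f. scale5 (Poly_Mapping.lookup f m) (Poly_Mapping.single m 1))
      \<in> poly5.span ((\<lambda>m. Poly_Mapping.single m 1) ` {m. mon_degree m = d})"
    using f by (intro poly5.span_sum poly5.span_scale poly5.span_base) (auto simp: forms_def)
  also have "(\<Sum>m\<in>Poly_Mapping.keys f. scale5 (Poly_Mapping.lookup f m) (Poly_Mapping.single m 1)) = f"
    by (subst (3) poly5_expand) (simp add: scale5_def mult_single)
  finally show "f \<in> poly5.span ((\<lambda>m. Poly_Mapping.single m 1) ` {m. mon_degree m = d})" .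
qed

lemma finite_independent_forms:
  assumes "poly5.independent B" and "B \<subseteq> (forms d :: 'k::field poly5 set)"
  shows "finite B \<and> card B \<le> poly5.dim (forms d :: 'k poly5 set)"
proof -
  have fin: "finite B'" if "poly5.independent B'" "B' \<subseteq> forms d" for B' :: "'k poly5 set"
    using poly5.independent_span_bound[OF finite_imageI[OF finite_mon_degree] that(1)]
      that(2) forms_subset_span by blast
  obtain C where C: "C \<subseteq> forms d" "poly5.independent C" "(forms d :: 'k poly5 set) \<subseteq> poly5.span C"
    "card C = poly5.dim (forms d :: 'k poly5 set)"
    using poly5.basis_exists by blast
  then show ?thesis
    using poly5.independent_span_bound[OF fin[OF C(2,1)] assms(1)] assms(2) by auto
qed

lemma subspace_vanishing: "poly5.subspace {f. eval5 x f = 0}"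
  by (auto simp: poly5.subspace_def eval5_add eval5_mult scale5_def)

text \<open>Evaluation at \<open>p\<close> kills \<open>Z\<close> and every other
  \<open>f q\<close>, but not \<open>f p\<close>. So the forms \<open>f p\<close> can be added one
  at a time to a basis of the degree \<open>d\<close> part of \<open>Z\<close> without losing
  independence.\<close>

lemma card_le_hilbert_function:
  fixes Z :: "'k::field poly5 set"
  assumes fin: "finite Q" and sep: "\<And>p. p \<in> Q \<Longrightarrow> f p \<in> forms d \<and> eval5 p (f p) \<noteq> 0"
    and sep': "\<And>p q. p \<in> Q \<Longrightarrow> q \<in> Q \<Longrightarrow> p \<noteq> q \<Longrightarrow> eval5 q (f p) = 0"
    and Z: "\<And>p g. p \<in> Q \<Longrightarrow> g \<in> Z \<Longrightarrow> eval5 p g = 0"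
  shows "card Q \<le> hilbert_function Z d"
proof -
  obtain B where B: "B \<subseteq> Z \<inter> forms d" "poly5.independent B" "Z \<inter> forms d \<subseteq> poly5.span B"
    "card B = poly5.dim (Z \<inter> forms d)"
    using poly5.basis_exists by blast
  have finB: "finite B"
    using finite_independent_forms[OF B(2)] B(1) by blast
  have "poly5.independent (B \<union> f ` Q') \<and> card (B \<union> f ` Q') = card B + card Q'"
    if "finite Q'" "Q' \<subseteq> Q" for Q'
    using that
  proof (induction Q' rule: finite_induct)
    case empty
    then show ?case using B(2) by simp
  next
    case (insert p Q')
    have "eval5 p (f q) = 0" if "q \<in> Q'" for q
      using that insert.hyps insert.prems by (intro sep') auto
    then have "B \<union> f ` Q' \<subseteq> {g. eval5 p g = 0}"
      using B(1) Z[of p] insert.prems by auto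
    then have "poly5.span (B \<union> f ` Q') \<subseteq> {g. eval5 p g = 0}"
      using subspace_vanishing poly5.span_minimal by blast
    then have n: "f p \<notin> poly5.span (B \<union> f ` Q')"
      using sep[of p] insert.prems by auto
    then have "f p \<notin> B \<union> f ` Q'"
      by (metis poly5.span_base)
    then show ?case
      using insert n finB by (simp add: poly5.independent_insert)
  qed
  note ind = this[OF fin subset_refl]
  have "B \<union> f ` Q \<subseteq> forms d"
    using B(1) sep by auto
  then have "card B + card Q \<le> poly5.dim (forms d :: 'k poly5 set)"
    using finite_independent_forms ind by metis
  then show ?thesis
    unfolding hilbert_function_def using B(4) by simp
qed

text \<open>Not symmetric: the factor may be zero, so the zero vector is proportional to every
  vector, but only the zero vector is proportional to it. A finite list of points thus also covers
  vectors that happen to vanish.\<close>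

definition proportional :: "('a \<Rightarrow> 'k::field) \<Rightarrow> ('a \<Rightarrow> 'k) \<Rightarrow> bool" where
  "proportional u v \<longleftrightarrow> (\<exists>c. u = (\<lambda>i. c * v i))"

lemma separating_linear_form:
  fixes p q :: "5 \<Rightarrow> 'k::field"
  assumes "p \<noteq> (\<lambda>_. 0)" "\<not> proportional q p"
  shows "\<exists>l. linear_form l \<and> eval5 q l = 0 \<and> eval5 p l \<noteq> 0"
proof -
  obtain i where i: "p i \<noteq> 0"
    using assms(1) by auto
  obtain j where j: "q j \<noteq> q i / p i * p j"
    using assms(2) unfolding proportional_def by blast
  \<comment> \<open>The minor of \<open>q\<close> and the variables in the coordinates
    \<open>i\<close>, \<open>j\<close>: it vanishes at \<open>q\<close>, and its value at
    \<open>p\<close> is the minor of \<open>q\<close> and \<open>p\<close>, which is nonzero by the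
    choice of \<open>j\<close>.\<close>
  let ?l = "const5 (q j) * variable i - const5 (q i) * variable j"
  have "linear_form ?l"
    by (rule forms_diff[OF forms_const_mult[OF variable_in_forms] forms_const_mult[OF variable_in_forms]])
  moreover have "q j * p i \<noteq> q i * p j"
    using i j by (metis nonzero_eq_divide_eq times_divide_eq_left)
  then have "eval5 q ?l = 0" "eval5 p ?l \<noteq> 0"
    by (simp_all add: eval5_diff eval5_mult)
  ultimately show ?thesis by (intro exI[of _ ?l]) simp
qed

lemma card_points_le_degree:
  fixes Z :: "'k::field poly5 set"
  assumes Z: "Z \<in> Hilb n" and fin: "finite Q"
    and nz: "\<And>p. p \<in> Q \<Longrightarrow> p \<noteq> (\<lambda>_. 0)"
    and np: "\<And>p q. p \<in> Q \<Longrightarrow> q \<in> Q \<Longrightarrow> p \<noteq> q \<Longrightarrow> \<not> proportional q p"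
    and van: "\<And>p g. p \<in> Q \<Longrightarrow> g \<in> Z \<Longrightarrow> eval5 p g = 0"
  shows "card Q \<le> n"
proof -
  obtain D where D: "\<And>d. d \<ge> D \<Longrightarrow> hilbert_function Z d = n"
    using Z by (auto simp: Hilb_def eventually_sequentially)
  \<comment> \<open>At least \<open>D\<close>, so that the Hilbert function has its final value
    \<open>n\<close>, and large enough for a product of \<open>card Q - 1\<close> separating linear
    forms.\<close>
  define d where "d = card Q + D"
  have "\<exists>f. f \<in> forms d \<and> eval5 p f \<noteq> 0 \<and> (\<forall>q\<in>Q. q \<noteq> p \<longrightarrow> eval5 q f = 0)" if p: "p \<in> Q" for p
  proof -
    have "\<forall>q\<in>Q - {p}. \<exists>l. linear_form l \<and> eval5 q l = 0 \<and> eval5 p l \<noteq> 0"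
      using separating_linear_form nz np p by blast
    then obtain l where l: "\<And>q. q \<in> Q - {p} \<Longrightarrow> linear_form (l q) \<and> eval5 q (l q) = 0 \<and> eval5 p (l q) \<noteq> 0"
      by metis
    obtain i where i: "p i \<noteq> 0"
      using nz[OF p] by auto
    \<comment> \<open>A power of a coordinate that does not vanish at \<open>p\<close> pads the
      product of degree \<open>card Q - 1\<close> to degree \<open>d\<close>; this accounts for the
      exponent \<open>D + 1\<close>.\<close>
    let ?f = "(\<Prod>q\<in>Q - {p}. l q) * variable i ^ (D + 1)"
    have "?f \<in> forms (card (Q - {p}) + (D + 1) * 1)"
      using l by (intro forms_mult forms_prod forms_power variable_in_forms) auto
    moreover have "card (Q - {p}) + (D + 1) * 1 = d"
      using card_Suc_Diff1[OF fin p] by (simp add: d_def)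
    moreover have "eval5 p ?f \<noteq> 0"
      using l i fin by (auto simp: eval5_mult eval5_prod eval5_power)
    moreover have "eval5 q ?f = 0" if "q \<in> Q" "q \<noteq> p" for q
    proof -
      have "(\<Prod>r\<in>Q - {p}. eval5 q (l r)) = 0"
        using that l fin by (intro prod_zero) auto
      then show ?thesis by (simp add: eval5_mult eval5_prod)
    qed
    ultimately show ?thesis by metis
  qed
  then obtain f where "\<And>p. p \<in> Q \<Longrightarrow> f p \<in> forms d \<and> eval5 p (f p) \<noteq> 0 \<and> (\<forall>q\<in>Q. q \<noteq> p \<longrightarrow> eval5 q (f p) = 0)"
    by metis
  then have "card Q \<le> hilbert_function Z d"
    using fin van by (intro card_le_hilbert_function[of Q f]) auto
  then show ?thesis
    using D[of d] by (simp add: d_def)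
qed

text \<open>The sizes of sets of pairwise non-proportional points are bounded by \<open>n\<close>. A
  set of largest size meets every direction on the scheme, since a missed one could be
  added.\<close>

lemma finitely_many_points:
  fixes Z :: "'k::field poly5 set"
  assumes Z: "Z \<in> Hilb n"
  shows "\<exists>P. finite P \<and> (\<forall>x. (\<forall>g\<in>Z. eval5 x g = 0) \<longrightarrow> (\<exists>p\<in>P. proportional x p))"
proof -
  define good where "good = (\<lambda>Q :: (5 \<Rightarrow> 'k) set. finite Q \<and> (\<forall>p\<in>Q. p \<noteq> (\<lambda>_. 0) \<and> (\<forall>g\<in>Z. eval5 p g = 0))
    \<and> (\<forall>p\<in>Q. \<forall>q\<in>Q. p \<noteq> q \<longrightarrow> \<not> proportional q p))"
  have "card Q \<le> n" if "good Q" for Q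
    using that unfolding good_def by (intro card_points_le_degree[OF Z]) auto
  moreover have "good {}"
    by (simp add: good_def)
  ultimately obtain Q where Q: "good Q" "\<And>Q'. good Q' \<Longrightarrow> card Q' \<le> card Q"
    using ex_has_greatest_nat[of good "{}" card "Suc n"] by (auto simp: less_Suc_eq_le)
  \<comment> \<open>The zero vector is inserted because \<open>x\<close> may be zero while
    \<open>Q\<close> is empty.\<close>
  have "\<exists>p\<in>insert (\<lambda>_. 0) Q. proportional x p" if x: "\<forall>g\<in>Z. eval5 x g = 0" for x
  proof (rule ccontr)
    assume n: "\<not> ?thesis"
    then have n: "x \<noteq> (\<lambda>_. 0)" "\<And>p. p \<in> Q \<Longrightarrow> \<not> proportional x p"
      by (auto simp: proportional_def)
    have n': "\<not> proportional p x" if "p \<in> Q" for p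
    proof
      assume "proportional p x"
      then obtain c where c: "p = (\<lambda>i. c * x i)"
        by (auto simp: proportional_def)
      have "c \<noteq> 0"
        using c Q(1) that by (auto simp: good_def)
      then have "x = (\<lambda>i. inverse c * p i)"
        by (simp add: c mult.assoc[symmetric])
      then show False
        using n(2)[OF that] by (auto simp: proportional_def)
    qed
    have "x \<notin> Q"
      using n(2)[of x] unfolding proportional_def by (metis mult_1)
    moreover have "good (insert x Q)"
      using Q(1) n n' x by (auto simp: good_def)
    moreover have "finite Q"
      using Q(1) by (simp add: good_def)
    ultimately show False
      using Q(2)[of "insert x Q"] by simp
  qed
  moreover have "finite (insert (\<lambda>_. 0) Q)"
    using Q(1) by (simp add: good_def)
  ultimately show ?thesis by blast
qed

text \<open>The double annihilator of a span is the span. Induction on the family replaces a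
  dimension count: either the new member is already in the span of the others, or its coefficient
  can be read off.\<close>

lemma combination_if_vanishing_on_common_kernel:
  fixes c :: "'l \<Rightarrow> 'n::finite \<Rightarrow> 'k::field"
  assumes "finite L" and "\<And>t. (\<forall>l\<in>L. (\<Sum>n\<in>UNIV. t n * c l n) = 0) \<Longrightarrow> (\<Sum>n\<in>UNIV. t n * v n) = 0"
  shows "\<exists>x. \<forall>n. v n = (\<Sum>l\<in>L. c l n * x l)"
  using assms
proof (induction L arbitrary: v rule: finite_induct)
  case empty
  have "v n = 0" for n
    using empty[of "\<lambda>m. if m = n then 1 else 0"] by (simp add: mult_delta_left)
  then show ?case by simp
next
  case (insert m L)
  have upd: "(\<Sum>l\<in>insert m L. c l n * (x(m := y)) l) = c m n * y + (\<Sum>l\<in>L. c l n * x l)" for n x y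
    using insert.hyps by (auto intro!: sum.cong)
  show ?case
  proof (cases "\<forall>t. (\<forall>l\<in>L. (\<Sum>n\<in>UNIV. t n * c l n) = 0) \<longrightarrow> (\<Sum>n\<in>UNIV. t n * c m n) = 0")
    case True
    then have "\<exists>x. \<forall>n. v n = (\<Sum>l\<in>L. c l n * x l)"
      using insert by auto
    then obtain x where "\<forall>n. v n = (\<Sum>l\<in>L. c l n * x l)" by blast
    then show ?thesis
      using upd[of _ x 0] by (intro exI[of _ "x(m := 0)"]) simp
  next
    case False
    then obtain t0 where t0: "\<forall>l\<in>L. (\<Sum>n\<in>UNIV. t0 n * c l n) = 0" "(\<Sum>n\<in>UNIV. t0 n * c m n) \<noteq> 0"
      by blast
    \<comment> \<open>\<open>t0\<close> kills every member of the family except \<open>c m\<close>,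
      so pairing with it leaves only one possible coefficient for \<open>c m\<close>.\<close>
    define s where "s = (\<Sum>n\<in>UNIV. t0 n * v n) / (\<Sum>n\<in>UNIV. t0 n * c m n)"
    have "\<exists>x. \<forall>n. v n - s * c m n = (\<Sum>l\<in>L. c l n * x l)"
    proof (rule insert.IH)
      fix t assume t: "\<forall>l\<in>L. (\<Sum>n\<in>UNIV. t n * c l n) = 0"
      \<comment> \<open>Correcting \<open>t\<close> by a multiple of \<open>t0\<close> makes it kill
        \<open>c m\<close> too, so that the hypothesis for the enlarged family applies.\<close>
      define r where "r = (\<Sum>n\<in>UNIV. t n * c m n) / (\<Sum>n\<in>UNIV. t0 n * c m n)"
      have lin: "(\<Sum>n\<in>UNIV. (t n - r * t0 n) * w n) = (\<Sum>n\<in>UNIV. t n * w n) - r * (\<Sum>n\<in>UNIV. t0 n * w n)" for w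
        by (simp add: left_diff_distrib sum_subtractf sum_distrib_left mult.assoc)
      have "\<forall>l\<in>insert m L. (\<Sum>n\<in>UNIV. (t n - r * t0 n) * c l n) = 0"
        using t t0 unfolding lin by (auto simp: r_def)
      then have "(\<Sum>n\<in>UNIV. (t n - r * t0 n) * v n) = 0"
        by (rule insert.prems)
      then have "(\<Sum>n\<in>UNIV. t n * v n) = s * (\<Sum>n\<in>UNIV. t n * c m n)"
        unfolding lin using t0(2) by (simp add: r_def s_def field_simps)
      then show "(\<Sum>n\<in>UNIV. t n * (v n - s * c m n)) = 0"
        by (simp add: right_diff_distrib sum_subtractf sum_distrib_left mult.assoc mult.left_commute)
    qed
    then obtain x where "\<And>n. v n - s * c m n = (\<Sum>l\<in>L. c l n * x l)" by blast
    then show ?thesis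
      using upd[of _ x s] by (intro exI[of _ "x(m := s)"]) (metis add.commute diff_eq_eq mult.commute)
  qed
qed

section \<open>Rank-one conditions and polynomial curves\<close>

text \<open>Two uses: with \<open>J = {0}\<close> over a field it says rank at most one, with an
  ideal of \<open>S5\<close> it says that the ideal contains all 2 x 2 minors.\<close>

definition minors_in :: "'r::comm_ring_1 set \<Rightarrow> ('a \<Rightarrow> 'b \<Rightarrow> 'r) \<Rightarrow> bool" where
  "minors_in J F \<longleftrightarrow> (\<forall>i i' j j'. F i j * F i' j' - F i j' * F i' j \<in> J)"

text \<open>The three flattenings of the cube. For \<open>J = {0}\<close> the solutions are the pure
  tensors, the cone over P^1 x P^1 x P^1.\<close>

definition cube_minors_in :: "'r::comm_ring_1 set \<Rightarrow> (2 \<times> 2 \<times> 2 \<Rightarrow> 'r) \<Rightarrow> bool" where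
  "cube_minors_in J T \<longleftrightarrow> minors_in J (\<lambda>i (j, h). T (i, j, h)) \<and>
     minors_in J (\<lambda>j (i, h). T (i, j, h)) \<and> minors_in J (\<lambda>h (i, j). T (i, j, h))"

lemma all_2: "(\<forall>i::2. P i) \<longleftrightarrow> P 0 \<and> P 1"
  by (metis (full_types) exhaust_2 zero_neq_one)

lemma sum_UNIV_2: "sum f (UNIV :: 2 set) = f 0 + f 1"
proof -
  have "(UNIV :: 2 set) = {0, 1}"
    using all_2[of "\<lambda>i. i \<in> {0, 1}"] by auto
  then have "sum f (UNIV :: 2 set) = sum f {0, 1}" by (rule arg_cong)
  then show ?thesis by simp
qed

lemma sum_UNIV_prod: "sum f (UNIV :: ('a::finite \<times> 'b::finite) set) = (\<Sum>i\<in>UNIV. \<Sum>j\<in>UNIV. f (i, j))"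
  by (simp add: sum.cartesian_product flip: UNIV_Times_UNIV)

lemma all_prod: "(\<forall>x. P x) \<longleftrightarrow> (\<forall>i j. P (i, j))"
  by auto

section \<open>Polynomial functions of one parameter\<close>

definition polyfun :: "('k::field \<Rightarrow> 'k) \<Rightarrow> bool" where
  "polyfun f \<longleftrightarrow> (\<exists>p. \<forall>t. f t = poly p t)"

named_theorems polyfun_intros

lemma polyfun_const [polyfun_intros]: "polyfun (\<lambda>t. c)"
  unfolding polyfun_def by (rule exI[of _ "[:c:]"]) simp

lemma polyfun_id [polyfun_intros]: "polyfun (\<lambda>t. t)"
  unfolding polyfun_def by (rule exI[of _ "[:0, 1:]"]) simp

lemma polyfun_add [polyfun_intros]: "polyfun f \<Longrightarrow> polyfun g \<Longrightarrow> polyfun (\<lambda>t. f t + g t)"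
  unfolding polyfun_def by (metis poly_add)

lemma polyfun_diff [polyfun_intros]: "polyfun f \<Longrightarrow> polyfun g \<Longrightarrow> polyfun (\<lambda>t. f t - g t)"
  unfolding polyfun_def by (metis poly_diff)

lemma polyfun_mult [polyfun_intros]: "polyfun f \<Longrightarrow> polyfun g \<Longrightarrow> polyfun (\<lambda>t. f t * g t)"
  unfolding polyfun_def by (metis poly_mult)

lemma polyfun_power [polyfun_intros]: "polyfun f \<Longrightarrow> polyfun (\<lambda>t. f t ^ n)"
  unfolding polyfun_def by (metis poly_power)

lemma finite_polyfun_zeros:
  assumes "polyfun f" "f t \<noteq> 0"
  shows "finite {t. f t = 0}"
proof -
  obtain p where "\<And>t. f t = poly p t"
    using assms(1) by (auto simp: polyfun_def)
  moreover from this assms(2) have "p \<noteq> 0"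
    by auto
  ultimately show ?thesis
    using poly_roots_finite[of p] by simp
qed

lemma infinite_UNIV_alg_closed: "infinite (UNIV :: 'k::alg_closed_field set)"
proof
  assume fin: "finite (UNIV :: 'k set)"
  \<comment> \<open>The classical nonconstant polynomial without a root: it takes the value 1 at
    every element of a finite field.\<close>
  define p where "p = (\<Prod>a\<in>(UNIV :: 'k set). [:- a, 1:]) + 1"
  have "degree (\<Prod>a\<in>(UNIV :: 'k set). [:- a, 1:]) = card (UNIV :: 'k set)"
    by (subst degree_prod_eq_sum_degree) auto
  moreover have "card (UNIV :: 'k set) > 0"
    using fin by (simp add: card_gt_0_iff)
  ultimately have "degree p > 0"
    unfolding p_def by (subst degree_add_eq_left) auto
  then obtain x where "poly p x = 0"
    using alg_closed_imp_poly_has_root by blast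
  moreover have "poly p x = 1"
    using fin by (simp add: p_def poly_prod prod_zero_iff)
  ultimately show False by simp
qed

text \<open>By the pigeonhole principle infinitely many parameters share one of the finitely many
  directions. Proportionality to it is a polynomial condition on the parameter, so it holds
  everywhere.\<close>

lemma constant_direction:
  fixes v :: "'k::alg_closed_field \<Rightarrow> 'n \<Rightarrow> 'k"
  assumes poly: "\<And>n. polyfun (\<lambda>t. v t n)" and fin: "finite P"
    and cover: "\<And>t. \<exists>p\<in>P. proportional (v t) p" and nz: "v 0 \<noteq> (\<lambda>_. 0)"
  shows "proportional (v t) (v 0)"
proof -
  obtain n0 where n0: "v 0 n0 \<noteq> 0"
    using nz by auto
  \<comment> \<open>Restricting to parameters with nonzero coordinate \<open>n0\<close> excludes
    vanishing vectors, which match every direction and would say nothing about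
    \<open>p\<close>.\<close>
  define S where "S = {t. v t n0 \<noteq> 0}"
  have "S = UNIV - {t. v t n0 = 0}"
    by (auto simp: S_def)
  then have inf: "infinite S"
    using finite_polyfun_zeros[OF poly n0] infinite_UNIV_alg_closed by (metis Diff_infinite_finite)
  obtain q where q: "\<And>t. q t \<in> P" "\<And>t. proportional (v t) (q t)"
    using cover by metis
  have "q ` S \<subseteq> P"
    using q(1) by auto
  then have "finite (q ` S)"
    using fin finite_subset by blast
  then obtain s where s: "s \<in> S" "infinite {t \<in> S. q t = q s}"
    using pigeonhole_infinite[OF inf] by auto
  define p where "p = q s"
  have p: "infinite {t \<in> S. proportional (v t) p}"
    using s(2) by (rule infinite_super[rotated]) (use q(2) p_def in \<open>auto, metis\<close>)
  have "p n0 \<noteq> 0"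
    using s(1) q(2)[of s] by (auto simp: S_def p_def proportional_def)
  have eq: "v t n * p n0 - v t n0 * p n = 0" for t n
  proof (rule ccontr)
    assume "\<not> ?thesis"
    moreover have "polyfun (\<lambda>t. v t n * p n0 - v t n0 * p n)"
      by (intro polyfun_intros poly)
    ultimately have "finite {t. v t n * p n0 - v t n0 * p n = 0}"
      by (rule finite_polyfun_zeros[rotated])
    moreover have "{t \<in> S. proportional (v t) p} \<subseteq> {t. v t n * p n0 - v t n0 * p n = 0}"
      by (auto simp: proportional_def)
    ultimately show False
      using p finite_subset by blast
  qed
  have "v t = (\<lambda>n. v t n0 / v 0 n0 * v 0 n)"
  proof
    fix n
    have "v t n = v t n0 / p n0 * p n" "v 0 n = v 0 n0 / p n0 * p n"
      using eq[of t n] eq[of 0 n] \<open>p n0 \<noteq> 0\<close> by (simp_all add: field_simps)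
    then show "v t n = v t n0 / v 0 n0 * v 0 n"
      using n0 by simp
  qed
  then show ?thesis
    unfolding proportional_def by blast
qed

text \<open>Used to contradict finiteness: whenever a pencil \<open>u + t w\<close> of points of the
  section is found with \<open>w\<close> not a multiple of \<open>u\<close>, the section contains
  infinitely many directions.\<close>

lemma no_line:
  fixes u w :: "'n \<Rightarrow> 'k::alg_closed_field"
  assumes fin: "finite P" and cover: "\<And>t. \<exists>p\<in>P. proportional (\<lambda>n. u n + t * w n) p"
    and "u \<noteq> (\<lambda>_. 0)"
  shows "proportional w u"
proof -
  have "proportional (\<lambda>n. u n + 1 * w n) (\<lambda>n. u n + 0 * w n)"
    using assms by (intro constant_direction[of "\<lambda>t n. u n + t * w n" P]) (auto intro!: polyfun_intros)
  then obtain c where c: "(\<lambda>n. u n + w n) = (\<lambda>n. c * u n)"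
    by (auto simp: proportional_def)
  have "w = (\<lambda>n. (c - 1) * u n)"
    using fun_cong[OF c] by (auto simp: fun_eq_iff algebra_simps)
  then show ?thesis
    by (auto simp: proportional_def)
qed

section \<open>The hyperdeterminant\<close>

lemma cube_minors_in_0_iff:
  "cube_minors_in {0} T \<longleftrightarrow>
     T (0,0,0) * T (0,1,1) = T (0,0,1) * T (0,1,0) \<and> T (1,0,0) * T (1,1,1) = T (1,0,1) * T (1,1,0) \<and>
     T (0,0,0) * T (1,0,1) = T (0,0,1) * T (1,0,0) \<and> T (0,1,0) * T (1,1,1) = T (0,1,1) * T (1,1,0) \<and>
     T (0,0,0) * T (1,1,0) = T (0,1,0) * T (1,0,0) \<and> T (0,0,1) * T (1,1,1) = T (0,1,1) * T (1,0,1) \<and>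
     T (0,0,0) * T (1,1,1) = T (0,1,1) * T (1,0,0) \<and> T (0,0,0) * T (1,1,1) = T (1,0,1) * T (0,1,0) \<and>
     T (0,0,0) * T (1,1,1) = T (0,0,1) * T (1,1,0)"
  unfolding cube_minors_in_def minors_in_def all_prod all_2 
  by (auto simp: mult.commute)

text \<open>Cayley's hyperdeterminant, written as the discriminant of the binary quadratic form
  det(x T_0 + y T_1) in the two slices of the first index.\<close>

definition hyperdet :: "(2 \<times> 2 \<times> 2 \<Rightarrow> 'r::field) \<Rightarrow> 'r" where
  "hyperdet T = (T (0,0,0) * T (1,1,1) + T (0,1,1) * T (1,0,0) - T (0,0,1) * T (1,1,0) - T (0,1,0) * T (1,0,1))^2
     - 4 * ((T (0,0,0) * T (0,1,1) - T (0,0,1) * T (0,1,0)) * (T (1,0,0) * T (1,1,1) - T (1,0,1) * T (1,1,0)))"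

text \<open>Half of the partial derivative of \<open>hyperdet\<close> with respect to the entry
  \<open>(i, j, h)\<close>; all these derivatives are divisible by two. Flipping indices permutes
  the eight entries, so one formula covers all of them.\<close>

fun half_grad :: "(2 \<times> 2 \<times> 2 \<Rightarrow> 'r::field) \<Rightarrow> 2 \<times> 2 \<times> 2 \<Rightarrow> 'r" where
  "half_grad T (i, j, h) = T (i,j,h) * T (1-i,1-j,1-h)^2
     - T (1-i,1-j,1-h) * (T (1-i,j,h) * T (i,1-j,1-h) + T (i,1-j,h) * T (1-i,j,1-h) + T (i,j,1-h) * T (1-i,1-j,h))
     + 2 * (T (i,1-j,1-h) * T (1-i,j,1-h) * T (1-i,1-j,h))"

text \<open>Biduality for the Segre variety as a polynomial fact: a gradient on the dual
  hypersurface is a pure tensor.\<close>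

lemma half_grad_rank1:
  assumes "hyperdet T = 0"
  shows "cube_minors_in {0} (half_grad T)"
  using assms unfolding cube_minors_in_0_iff hyperdet_def half_grad.simps
  by (simp only: diff_0_right diff_self) (intro conjI; Groebner_Basis.algebra)

text \<open>The derivative when slice \<open>h'\<close> moves in the direction of slice
  \<open>h\<close>. For distinct slices this is a column operation and leaves
  \<open>hyperdet\<close> fixed; for equal ones it is Euler's formula, with degree two in each
  slice.\<close>

lemma half_grad_contraction:
  "T (0,0,h) * half_grad T (0,0,h') + T (0,1,h) * half_grad T (0,1,h')
     + T (1,0,h) * half_grad T (1,0,h') + T (1,1,h) * half_grad T (1,1,h') = (if h = h' then hyperdet T else 0)"
proof -
  have "\<forall>h h'. T (0,0,h) * half_grad T (0,0,h') + T (0,1,h) * half_grad T (0,1,h')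
     + T (1,0,h) * half_grad T (1,0,h') + T (1,1,h) * half_grad T (1,1,h') = (if h = h' then hyperdet T else 0)"
    unfolding hyperdet_def half_grad.simps all_2
    by (simp only: diff_0_right diff_self if_True refl zero_neq_one one_neq_zero if_False) (intro conjI; Groebner_Basis.algebra)
  then show ?thesis by blast
qed

text \<open>An edge paired with the gradient along the opposite edge gives twice the product of the
  determinants of the two faces that meet in the edge. A vanishing gradient therefore kills all
  products of determinants of non-parallel faces.\<close>

lemma half_grad_faces:
  fixes T :: "2 \<times> 2 \<times> 2 \<Rightarrow> 'r::field"
  shows "T (i,j,0) * half_grad T (1-i,1-j,0) + T (i,j,1) * half_grad T (1-i,1-j,1)
    = 2 * ((T (i,j,0) * T (i,1-j,1) - T (i,j,1) * T (i,1-j,0)) * (T (i,j,0) * T (1-i,j,1) - T (i,j,1) * T (1-i,j,0)))"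
    "T (i,0,h) * half_grad T (1-i,0,1-h) + T (i,1,h) * half_grad T (1-i,1,1-h)
    = 2 * ((T (i,0,h) * T (i,1,1-h) - T (i,1,h) * T (i,0,1-h)) * (T (i,0,h) * T (1-i,1,h) - T (i,1,h) * T (1-i,0,h)))"
    "T (0,j,h) * half_grad T (0,1-j,1-h) + T (1,j,h) * half_grad T (1,1-j,1-h)
    = 2 * ((T (0,j,h) * T (1,j,1-h) - T (1,j,h) * T (0,j,1-h)) * (T (0,j,h) * T (1,1-j,h) - T (1,j,h) * T (0,1-j,h)))"
proof -
  have "\<forall>i j. T (i,j,0) * half_grad T (1-i,1-j,0) + T (i,j,1) * half_grad T (1-i,1-j,1)
    = 2 * ((T (i,j,0) * T (i,1-j,1) - T (i,j,1) * T (i,1-j,0)) * (T (i,j,0) * T (1-i,j,1) - T (i,j,1) * T (1-i,j,0)))"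
    unfolding half_grad.simps all_2
    by (simp only: diff_0_right diff_self) (intro conjI; Groebner_Basis.algebra)
  then show "T (i,j,0) * half_grad T (1-i,1-j,0) + T (i,j,1) * half_grad T (1-i,1-j,1)
    = 2 * ((T (i,j,0) * T (i,1-j,1) - T (i,j,1) * T (i,1-j,0)) * (T (i,j,0) * T (1-i,j,1) - T (i,j,1) * T (1-i,j,0)))"
    by blast
  have "\<forall>i h. T (i,0,h) * half_grad T (1-i,0,1-h) + T (i,1,h) * half_grad T (1-i,1,1-h)
    = 2 * ((T (i,0,h) * T (i,1,1-h) - T (i,1,h) * T (i,0,1-h)) * (T (i,0,h) * T (1-i,1,h) - T (i,1,h) * T (1-i,0,h)))"
    unfolding half_grad.simps all_2
    by (simp only: diff_0_right diff_self) (intro conjI; Groebner_Basis.algebra)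
  then show "T (i,0,h) * half_grad T (1-i,0,1-h) + T (i,1,h) * half_grad T (1-i,1,1-h)
    = 2 * ((T (i,0,h) * T (i,1,1-h) - T (i,1,h) * T (i,0,1-h)) * (T (i,0,h) * T (1-i,1,h) - T (i,1,h) * T (1-i,0,h)))"
    by blast
  have "\<forall>j h. T (0,j,h) * half_grad T (0,1-j,1-h) + T (1,j,h) * half_grad T (1,1-j,1-h)
    = 2 * ((T (0,j,h) * T (1,j,1-h) - T (1,j,h) * T (0,j,1-h)) * (T (0,j,h) * T (1,1-j,h) - T (1,j,h) * T (0,1-j,h)))"
    unfolding half_grad.simps all_2
    by (simp only: diff_0_right diff_self) (intro conjI; Groebner_Basis.algebra)
  then show "T (0,j,h) * half_grad T (0,1-j,1-h) + T (1,j,h) * half_grad T (1,1-j,1-h)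
    = 2 * ((T (0,j,h) * T (1,j,1-h) - T (1,j,h) * T (0,j,1-h)) * (T (0,j,h) * T (1,1-j,h) - T (1,j,h) * T (0,1-j,h)))"
    by blast
qed

section \<open>Linear spaces of rank-one matrices\<close>

text \<open>The sum is half the linear coefficient of the quartic \<open>s\<close> to
  \<open>hyperdet\<close> of \<open>T + s U\<close>. The definitions below are the coefficients of
  its building blocks in powers of \<open>s\<close>.\<close>

lemma hyperdet_zero_on_line:
  fixes T U :: "2 \<times> 2 \<times> 2 \<Rightarrow> 'k::field"
  assumes zero: "\<And>s. hyperdet (\<lambda>n. T n + s * U n) = 0" and "(2::'k) \<noteq> 0" "(3::'k) \<noteq> 0"
  shows "(\<Sum>n\<in>UNIV. U n * half_grad T n) = 0"
proof -
  define d where "d = (\<lambda>i. T (i,0,0) * T (i,1,1) - T (i,0,1) * T (i,1,0))"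
  define d1 where "d1 = (\<lambda>i. T (i,0,0) * U (i,1,1) + U (i,0,0) * T (i,1,1) - T (i,0,1) * U (i,1,0) - U (i,0,1) * T (i,1,0))"
  define d2 where "d2 = (\<lambda>i. U (i,0,0) * U (i,1,1) - U (i,0,1) * U (i,1,0))"
  define m where "m = T (0,0,0) * T (1,1,1) + T (0,1,1) * T (1,0,0) - T (0,0,1) * T (1,1,0) - T (0,1,0) * T (1,0,1)"
  define m1 where "m1 = T (0,0,0) * U (1,1,1) + T (0,1,1) * U (1,0,0) - T (0,0,1) * U (1,1,0) - T (0,1,0) * U (1,0,1)
    + U (0,0,0) * T (1,1,1) + U (0,1,1) * T (1,0,0) - U (0,0,1) * T (1,1,0) - U (0,1,0) * T (1,0,1)"
  define m2 where "m2 = U (0,0,0) * U (1,1,1) + U (0,1,1) * U (1,0,0) - U (0,0,1) * U (1,1,0) - U (0,1,0) * U (1,0,1)"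
  have eq: "(m + s * m1 + s^2 * m2)^2 - 4 * ((d 0 + s * d1 0 + s^2 * d2 0) * (d 1 + s * d1 1 + s^2 * d2 1)) = 0" for s
    using zero[of s] unfolding hyperdet_def m_def m1_def m2_def d_def d1_def d2_def by Groebner_Basis.algebra
  \<comment> \<open>Interpolation with four values: 8 (f(1) - f(-1)) - (f(2) - f(-2)) cancels the
    cubic term and equals 12 times the linear coefficient.\<close>
  have "(m + m1 + m2)^2 = 4 * ((d 0 + d1 0 + d2 0) * (d 1 + d1 1 + d2 1))"
    "(m - m1 + m2)^2 = 4 * ((d 0 - d1 0 + d2 0) * (d 1 - d1 1 + d2 1))"
    "(m + 2 * m1 + 4 * m2)^2 = 4 * ((d 0 + 2 * d1 0 + 4 * d2 0) * (d 1 + 2 * d1 1 + 4 * d2 1))"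
    "(m - 2 * m1 + 4 * m2)^2 = 4 * ((d 0 - 2 * d1 0 + 4 * d2 0) * (d 1 - 2 * d1 1 + 4 * d2 1))"
    using eq[of 1] eq[of "-1"] eq[of 2] eq[of "-2"] by simp_all
  then have "12 * (2 * m * m1 - 4 * (d 0 * d1 1 + d1 0 * d 1)) = 0"
    by Groebner_Basis.algebra
  moreover have "(\<Sum>n\<in>UNIV. U n * half_grad T n) * 2 = 2 * m * m1 - 4 * (d 0 * d1 1 + d1 0 * d 1)"
    unfolding m_def m1_def d_def d1_def sum_UNIV_prod sum_UNIV_2 half_grad.simps
    by (simp only: diff_0_right diff_self) Groebner_Basis.algebra
  ultimately have "2 * 2 * 2 * 3 * (\<Sum>n\<in>UNIV. U n * half_grad T n) = 0"
    by Groebner_Basis.algebra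
  then show ?thesis
    using assms(2,3) by (simp only: mult_eq_0_iff simp_thms)
qed

section \<open>Linear spaces are irreducible\<close>

definition lin_closed :: "('n \<Rightarrow> 'k::field) set \<Rightarrow> bool" where
  "lin_closed W \<longleftrightarrow> (\<forall>x\<in>W. \<forall>y\<in>W. \<forall>t. (\<lambda>n. x n + t * y n) \<in> W)"

text \<open>The only consequence of Zariski closedness that is required here: a line with infinitely
  many points in \<open>C\<close> lies in \<open>C\<close>.\<close>

definition line_closed :: "('n \<Rightarrow> 'k::field) set \<Rightarrow> bool" where
  "line_closed C \<longleftrightarrow> (\<forall>x y. infinite {t. (\<lambda>n. x n + t * y n) \<in> C} \<longrightarrow> (\<forall>t. (\<lambda>n. x n + t * y n) \<in> C))"

lemma line_closedD:
  "line_closed C \<Longrightarrow> infinite {t. (\<lambda>n. x n + t * y n) \<in> C} \<Longrightarrow> (\<lambda>n. x n + t * y n) \<in> C"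
  unfolding line_closed_def by (elim allE[of _ x] allE[of _ y] impE) auto

lemma line_closed_Un:
  assumes "line_closed C" "line_closed D"
  shows "line_closed (C \<union> D)"
  unfolding line_closed_def
proof (intro allI impI)
  fix x y :: "'a \<Rightarrow> 'b" and t
  assume inf: "infinite {t. (\<lambda>n. x n + t * y n) \<in> C \<union> D}"
  have "{t. (\<lambda>n. x n + t * y n) \<in> C \<union> D} = {t. (\<lambda>n. x n + t * y n) \<in> C} \<union> {t. (\<lambda>n. x n + t * y n) \<in> D}"
    by auto
  then have "infinite {t. (\<lambda>n. x n + t * y n) \<in> C} \<or> infinite {t. (\<lambda>n. x n + t * y n) \<in> D}"
    using inf by auto
  then show "(\<lambda>n. x n + t * y n) \<in> C \<union> D"
    using line_closedD[OF assms(1), of x y t] line_closedD[OF assms(2), of x y t] by blast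
qed

text \<open>Join a point outside \<open>C\<close> to a point outside \<open>D\<close>. One of the
  two sets contains infinitely many points of this line, hence all of it, including the endpoint it
  was supposed to miss.\<close>

lemma lin_closed_cases:
  fixes W :: "('n \<Rightarrow> 'k::alg_closed_field) set"
  assumes W: "lin_closed W" and C: "line_closed C" "line_closed D" and sub: "W \<subseteq> C \<union> D"
  shows "W \<subseteq> C \<or> W \<subseteq> D"
proof (rule ccontr)
  assume "\<not> ?thesis"
  then obtain x y where xy: "x \<in> W" "x \<notin> C" "y \<in> W" "y \<notin> D"
    by blast
  let ?l = "\<lambda>t n. x n + t * (y n - x n)"
  have l: "?l t \<in> W" for t
  proof -
    have z: "(\<lambda>n. y n + (-1) * x n) \<in> W"
      using W xy unfolding lin_closed_def by blast
    show ?thesis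
      using W[unfolded lin_closed_def, rule_format, OF xy(1) z, of t] by simp
  qed
  have "{t. ?l t \<in> C} \<union> {t. ?l t \<in> D} = UNIV"
    using l sub by blast
  then have "infinite ({t. ?l t \<in> C} \<union> {t. ?l t \<in> D})"
    by (simp only: infinite_UNIV_alg_closed not_False_eq_True)
  then have "infinite {t. ?l t \<in> C} \<or> infinite {t. ?l t \<in> D}"
    by (simp only: finite_Un de_Morgan_conj)
  then have "?l 0 \<in> C \<or> ?l 1 \<in> D"
    using line_closedD[OF C(1), of x "\<lambda>n. y n - x n" 0] line_closedD[OF C(2), of x "\<lambda>n. y n - x n" 1] by blast
  then show False
    using xy by simp
qed

lemma line_closed_minors:
  "line_closed {x. minors_in {0} (\<lambda>i j. x (r i j :: 'n) :: 'k::field)}"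
  unfolding line_closed_def mem_Collect_eq
proof (intro allI impI)
  fix x y :: "'n \<Rightarrow> 'k" and t
  assume inf: "infinite {t. minors_in {0} (\<lambda>i j. x (r i j) + t * y (r i j))}"
  show "minors_in {0} (\<lambda>i j. x (r i j) + t * y (r i j))"
    unfolding minors_in_def
  proof (intro allI)
    fix i i' j j'
    let ?f = "\<lambda>t. (x (r i j) + t * y (r i j)) * (x (r i' j') + t * y (r i' j'))
      - (x (r i j') + t * y (r i j')) * (x (r i' j) + t * y (r i' j))"
    have "polyfun ?f"
      by (intro polyfun_intros)
    moreover have "{t. minors_in {0} (\<lambda>i j. x (r i j) + t * y (r i j))} \<subseteq> {t. ?f t = 0}"
      by (auto simp: minors_in_def)
    ultimately have "?f t = 0"
      using finite_polyfun_zeros inf finite_subset by blast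
    then show "?f t \<in> {0}" by simp
  qed
qed

lemma minors_in_0_factor:
  fixes F :: "'i \<Rightarrow> 'j \<Rightarrow> 'k::field"
  assumes "minors_in {0} F"
  shows "\<exists>u w. \<forall>i j. F i j = u i * w j"
proof (cases "\<exists>i j. F i j \<noteq> 0")
  case True
  then obtain i0 j0 where nz: "F i0 j0 \<noteq> 0" by blast
  have "F i j = F i j0 * (F i0 j / F i0 j0)" for i j
  proof -
    have "F i j * F i0 j0 - F i j0 * F i0 j = 0"
      using assms unfolding minors_in_def by blast
    then show ?thesis
      using nz by (simp add: field_simps)
  qed
  then show ?thesis
    by (intro exI[of _ "\<lambda>i. F i j0"] exI[of _ "\<lambda>j. F i0 j / F i0 j0"]) blast
qed auto

lemma parallel_factor:
  fixes u w :: "'i \<Rightarrow> 'k::field"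
  assumes "u i0 \<noteq> 0" "\<And>i i'. u i * w i' = u i' * w i"
  shows "w i = w i0 / u i0 * u i"
  using assms(1) assms(2)[of i0 i] by (simp add: field_simps)

text \<open>The classical fact that a linear space of matrices of rank at most one has a common
  column or a common row. The index map \<open>r\<close> makes it applicable to flattenings of
  tensors.\<close>

lemma rank1_space:
  fixes W :: "('n \<Rightarrow> 'k::field) set" and r :: "'i \<Rightarrow> 'j \<Rightarrow> 'n"
  assumes W: "lin_closed W" and rk: "\<And>x. x \<in> W \<Longrightarrow> minors_in {0} (\<lambda>i j. x (r i j))"
  shows "(\<exists>u. \<forall>x\<in>W. \<exists>w. \<forall>i j. x (r i j) = u i * w j) \<or> (\<exists>w. \<forall>x\<in>W. \<exists>u. \<forall>i j. x (r i j) = u i * w j)"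
proof (rule ccontr)
  assume "\<not> ?thesis"
  then have neg1: "\<And>u. \<not> (\<forall>x\<in>W. \<exists>w. \<forall>i j. x (r i j) = u i * w j)"
    and neg2: "\<And>w. \<not> (\<forall>x\<in>W. \<exists>u. \<forall>i j. x (r i j) = u i * w j)"
    by (simp_all only: de_Morgan_disj not_ex simp_thms)
  have dec: "\<exists>u w. \<forall>i j. x (r i j) = u i * w j" if "x \<in> W" for x
    using minors_in_0_factor[OF rk[OF that]] .
  \<comment> \<open>A minor of the sum of two rank-one matrices is the wedge of their columns times
    the wedge of their rows, so one of the two wedges vanishes.\<close>
  have wedge: "(u i * u' i' - u i' * u' i) * (w j * w' j' - w j' * w' j) = 0"
    if "x \<in> W" "x' \<in> W" "\<forall>i j. x (r i j) = u i * w j" "\<forall>i j. x' (r i j) = u' i * w' j" for x x' u u' w w' i i' j j'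
  proof -
    have "(\<lambda>n. x n + 1 * x' n) \<in> W"
      using W that unfolding lin_closed_def by blast
    from rk[OF this] have "minors_in {0} (\<lambda>i j. u i * w j + u' i * w' j)"
      using that by simp
    then have "(u i * w j + u' i * w' j) * (u i' * w j' + u' i' * w' j')
        - (u i * w j' + u' i * w' j') * (u i' * w j + u' i' * w' j) = 0"
      unfolding minors_in_def by blast
    then show ?thesis by Groebner_Basis.algebra
  qed
  have "\<exists>x\<in>W. \<exists>i j. x (r i j) \<noteq> 0"
  proof (rule ccontr)
    assume "\<not> ?thesis"
    then have "\<forall>x\<in>W. \<exists>w. \<forall>i j. x (r i j) = (\<lambda>_. 0) i * w j"
      by simp
    then show False
      using neg1[of "\<lambda>_. 0"] by simp
  qed
  then obtain x0 i0 j0 where x0: "x0 \<in> W" "x0 (r i0 j0) \<noteq> 0" by (elim bexE exE)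
  obtain u w where uw: "\<forall>i j. x0 (r i j) = u i * w j"
    using dec[OF x0(1)] by (elim exE)
  have nz: "u i0 \<noteq> 0" "w j0 \<noteq> 0"
    using x0(2) uw by auto
  obtain x1 where x1: "x1 \<in> W" "\<And>w. \<not> (\<forall>i j. x1 (r i j) = u i * w j)"
    using neg1[of u] by meson
  obtain u1 w1 where uw1: "\<forall>i j. x1 (r i j) = u1 i * w1 j"
    using dec[OF x1(1)] by (elim exE)
  obtain i1 i2 where ii: "u i1 * u1 i2 - u i2 * u1 i1 \<noteq> 0"
  proof (rule ccontr)
    assume "\<not> thesis"
    then have *: "u i * u1 i' = u i' * u1 i" for i i'
      using that by force
    have "x1 (r i j) = u i * (u1 i0 / u i0 * w1 j)" for i j
      using parallel_factor[of u, OF nz(1) *] uw1 by (metis mult.assoc mult.commute)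
    then show False
      using x1(2)[of "\<lambda>j. u1 i0 / u i0 * w1 j"] by simp
  qed
  \<comment> \<open>The columns of \<open>x0\<close> and \<open>x1\<close> are independent, so their
    rows must be parallel.\<close>
  have w1: "w1 j = w1 j0 / w j0 * w j" for j
  proof (rule parallel_factor[of w j0, OF nz(2)])
    show "w j * w1 j' = w j' * w1 j" for j j'
      using wedge[OF x0(1) x1(1) uw uw1, of i1 i2 j j'] ii by simp
  qed
  have w1nz: "w1 j0 \<noteq> 0"
  proof
    assume "w1 j0 = 0"
    then have "x1 (r i j) = u i * 0" for i j
      using uw1 w1[of j] by simp
    then show False
      using x1(2)[of "\<lambda>_. 0"] by simp
  qed
  have "\<exists>u2'. \<forall>i j. x2 (r i j) = u2' i * w j" if x2: "x2 \<in> W" for x2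
  proof -
    obtain u2 w2 where uw2: "\<forall>i j. x2 (r i j) = u2 i * w2 j"
      using dec[OF x2] by (elim exE)
    show ?thesis
    proof (cases "\<forall>j j'. w j * w2 j' = w j' * w2 j")
      case True
      have "x2 (r i j) = (u2 i * (w2 j0 / w j0)) * w j" for i j
        using parallel_factor[of w j0 w2 j, OF nz(2) True[rule_format]] uw2 by simp
      then show ?thesis
        by (intro exI[of _ "\<lambda>i. u2 i * (w2 j0 / w j0)"]) simp
    next
      case False
      then obtain j1 j2 where jj: "w j1 * w2 j2 - w j2 * w2 j1 \<noteq> 0"
        by (metis eq_iff_diff_eq_0)
      have "w1 j1 * w2 j2 - w1 j2 * w2 j1 = w1 j0 / w j0 * (w j1 * w2 j2 - w j2 * w2 j1)"
        unfolding w1[of j1] w1[of j2] by (simp add: algebra_simps)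
      then have jj1: "w1 j1 * w2 j2 - w1 j2 * w2 j1 \<noteq> 0"
        using jj w1nz nz by simp
      \<comment> \<open>If the row of \<open>x2\<close> is not parallel to \<open>w\<close>, its
        column is parallel to both of the independent columns \<open>u\<close> and
        \<open>u1\<close>, hence zero.\<close>
      have a: "u i * u2 i' = u i' * u2 i" for i i'
        using wedge[OF x0(1) x2 uw uw2, of i i' j1 j2] jj by simp
      have b: "u1 i * u2 i' = u1 i' * u2 i" for i i'
        using wedge[OF x1(1) x2 uw1 uw2, of i i' j1 j2] jj1 by simp
      have "u2 i = 0" for i
      proof -
        define c where "c = u2 i0 / u i0"
        have c: "u2 k = c * u k" for k
          using parallel_factor[of u i0 u2 k, OF nz(1) a] by (simp add: c_def)
        have "c * (u i1 * u1 i2 - u i2 * u1 i1) = 0"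
          using b[of i1 i2] unfolding c by Groebner_Basis.algebra
        then show ?thesis
          using ii c by simp
      qed
      then show ?thesis
        using uw2 by (intro exI[of _ "\<lambda>_. 0"]) simp
    qed
  qed
  then show False
    using neg2[of w] by simp
qed

lemma minors_in_0_flat_iff:
  fixes T :: "2 \<times> 2 \<times> 2 \<Rightarrow> 'k::field"
  shows "minors_in {0} (\<lambda>i p. T (i, p)) \<longleftrightarrow>
     T (0,0,0) * T (1,0,1) = T (0,0,1) * T (1,0,0) \<and> T (0,1,0) * T (1,1,1) = T (0,1,1) * T (1,1,0) \<and>
     T (0,0,0) * T (1,1,0) = T (0,1,0) * T (1,0,0) \<and> T (0,0,1) * T (1,1,1) = T (0,1,1) * T (1,0,1) \<and>
     T (0,0,0) * T (1,1,1) = T (0,1,1) * T (1,0,0) \<and> T (0,0,1) * T (1,1,0) = T (0,1,0) * T (1,0,1)"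
  unfolding minors_in_def all_prod all_2
  by (auto simp: mult.commute)

text \<open>\<open>swap12\<close> and \<open>swap13\<close> bring the second and the third index to
  the first place, so that statements about the first index serve all three directions.\<close>

definition swap12 :: "2 \<times> 2 \<times> 2 \<Rightarrow> 2 \<times> 2 \<times> 2" where
  "swap12 = (\<lambda>(i, j, h). (j, i, h))"

definition swap13 :: "2 \<times> 2 \<times> 2 \<Rightarrow> 2 \<times> 2 \<times> 2" where
  "swap13 = (\<lambda>(i, j, h). (h, j, i))"

lemma swap_simps [simp]: "swap12 (i, j, h) = (j, i, h)" "swap13 (i, j, h) = (h, j, i)"
  by (simp_all add: swap12_def swap13_def)

text \<open>By \<open>half_grad_faces\<close>, faces in two of the three directions have zero
  determinants. The discriminant formulas then make the corresponding middle coefficients vanish,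
  and together these are all minors of the flattening in the third direction.\<close>

lemma half_grad_zero_cases:
  fixes T :: "2 \<times> 2 \<times> 2 \<Rightarrow> 'k::field"
  assumes two: "(2::'k) \<noteq> 0" and g: "half_grad T = (\<lambda>_. 0)" and D: "hyperdet T = 0"
  shows "minors_in {0} (\<lambda>i p. T (i, p)) \<or> minors_in {0} (\<lambda>i p. T (swap12 (i, p))) \<or>
    minors_in {0} (\<lambda>i p. T (swap13 (i, p)))"
proof -
  define a where "a = (\<lambda>i. T (i,0,0) * T (i,1,1) - T (i,0,1) * T (i,1,0))"
  define b where "b = (\<lambda>j. T (0,j,0) * T (1,j,1) - T (0,j,1) * T (1,j,0))"
  define c where "c = (\<lambda>h. T (0,0,h) * T (1,1,h) - T (0,1,h) * T (1,0,h))"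
  define m1 where "m1 = T (0,0,0) * T (1,1,1) + T (0,1,1) * T (1,0,0) - T (0,0,1) * T (1,1,0) - T (0,1,0) * T (1,0,1)"
  define m2 where "m2 = T (0,0,0) * T (1,1,1) + T (0,1,0) * T (1,0,1) - T (0,1,1) * T (1,0,0) - T (0,0,1) * T (1,1,0)"
  define m3 where "m3 = T (0,0,0) * T (1,1,1) + T (0,0,1) * T (1,1,0) - T (0,1,1) * T (1,0,0) - T (0,1,0) * T (1,0,1)"
  \<comment> \<open>The hyperdeterminant is the discriminant of the slice pencil in each direction:
    \<open>a\<close>, \<open>b\<close>, \<open>c\<close> give the outer coefficients,
    \<open>m1\<close>, \<open>m2\<close>, \<open>m3\<close> the middle ones.\<close>
  have D1: "m1^2 = 4 * (a 0 * a 1)" and D2: "m2^2 = 4 * (b 0 * b 1)" and D3: "m3^2 = 4 * (c 0 * c 1)"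
    using D unfolding hyperdet_def m1_def m2_def m3_def a_def b_def c_def by Groebner_Basis.algebra+
  have "\<forall>i j. 2 * (a i * b j) = 0"
    using half_grad_faces(1)[of T 0 0] half_grad_faces(1)[of T 0 1] half_grad_faces(1)[of T 1 0] half_grad_faces(1)[of T 1 1]
    unfolding all_2 a_def b_def g mult_zero_right add_0_right diff_0_right diff_self
    by (intro conjI; Groebner_Basis.algebra)
  then have ab: "\<forall>i j. a i = 0 \<or> b j = 0"
    using two by simp
  have "\<forall>i j. 2 * (a i * c j) = 0"
    using half_grad_faces(2)[of T 0 0] half_grad_faces(2)[of T 0 1] half_grad_faces(2)[of T 1 0] half_grad_faces(2)[of T 1 1]
    unfolding all_2 a_def c_def g mult_zero_right add_0_right diff_0_right diff_self
    by (intro conjI; Groebner_Basis.algebra)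
  then have ac: "\<forall>i j. a i = 0 \<or> c j = 0"
    using two by simp
  have "\<forall>i j. 2 * (b i * c j) = 0"
    using half_grad_faces(3)[of T 0 0] half_grad_faces(3)[of T 0 1] half_grad_faces(3)[of T 1 0] half_grad_faces(3)[of T 1 1]
    unfolding all_2 b_def c_def g mult_zero_right add_0_right diff_0_right diff_self
    by (intro conjI; Groebner_Basis.algebra)
  then have bc: "\<forall>i j. b i = 0 \<or> c j = 0"
    using two by simp
  have can: "x = y" if "2 * x = 2 * y" for x y :: 'k
    using that two by simp
  have 1: "minors_in {0} (\<lambda>i p. T (i, p))" if "\<forall>j. b j = 0" "\<forall>h. c h = 0"
  proof -
    have "m2 = 0" "m3 = 0" "b 0 = 0" "b 1 = 0" "c 0 = 0" "c 1 = 0"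
      using that D2 D3 by auto
    note e = this[unfolded m2_def m3_def b_def c_def]
    have "T (0,0,0) * T (1,1,1) = T (0,1,1) * T (1,0,0)" "T (0,0,1) * T (1,1,0) = T (0,1,0) * T (1,0,1)"
      using e(1,2) by (rule_tac can; Groebner_Basis.algebra)+
    then show ?thesis
      using e(3-6) unfolding minors_in_0_flat_iff right_minus_eq by (simp add: mult.commute)
  qed
  have 2: "minors_in {0} (\<lambda>i p. T (swap12 (i, p)))" if "\<forall>j. a j = 0" "\<forall>h. c h = 0"
  proof -
    have "m1 = 0" "m3 = 0" "a 0 = 0" "a 1 = 0" "c 0 = 0" "c 1 = 0"
      using that D1 D3 by auto
    note e = this[unfolded m1_def m3_def a_def c_def]
    have "T (0,0,0) * T (1,1,1) = T (0,1,0) * T (1,0,1)" "T (0,0,1) * T (1,1,0) = T (0,1,1) * T (1,0,0)"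
      using e(1,2) by (rule_tac can; Groebner_Basis.algebra)+
    then show ?thesis
      using e(3-6) unfolding minors_in_0_flat_iff[of "\<lambda>n. T (swap12 n)"] swap_simps right_minus_eq by (simp add: mult.commute)
  qed
  have 3: "minors_in {0} (\<lambda>i p. T (swap13 (i, p)))" if "\<forall>j. a j = 0" "\<forall>h. b h = 0"
  proof -
    have "m1 = 0" "m2 = 0" "a 0 = 0" "a 1 = 0" "b 0 = 0" "b 1 = 0"
      using that D1 D2 by auto
    note e = this[unfolded m1_def m2_def a_def b_def]
    have "T (0,0,0) * T (1,1,1) = T (0,0,1) * T (1,1,0)" "T (0,1,1) * T (1,0,0) = T (0,1,0) * T (1,0,1)"
      using e(1,2) by (rule_tac can; Groebner_Basis.algebra)+
    then show ?thesis
      using e(3-6) unfolding minors_in_0_flat_iff[of "\<lambda>n. T (swap13 n)"] swap_simps right_minus_eq by (simp add: mult.commute)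
  qed
  show ?thesis
    using ab ac bc 1 2 3 by metis
qed

lemma orthogonal_vector2:
  fixes u :: "2 \<Rightarrow> 'k::field"
  shows "\<exists>a :: 2 \<Rightarrow> 'k. a \<noteq> (\<lambda>_. 0) \<and> u 0 * a 0 + u 1 * a 1 = 0"
proof (cases "u 0 = 0 \<and> u 1 = 0")
  case True
  then show ?thesis
    by (intro exI[of _ "\<lambda>_. 1"]) (auto simp: fun_eq_iff)
next
  case False
  define a where "a = (\<lambda>i :: 2. if i = 0 then u 1 else - u 0)"
  have a: "a 0 = u 1" "a 1 = - u 0"
    by (simp_all add: a_def)
  then have "a \<noteq> (\<lambda>_. 0)"
    using False by (metis neg_0_equal_iff_equal)
  then show ?thesis
    using a by (intro exI[of _ a]) (simp add: mult.commute)
qed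

text \<open>With a common factor \<open>u\<close> of the first index, a vector \<open>a\<close>
  orthogonal to \<open>u\<close> makes every tensor \<open>a b c\<close> orthogonal to
  \<open>W\<close>. With a common factor \<open>w\<close> of the other two indices, \<open>b\<close>
  is a unit vector and \<open>c\<close> orthogonal to a row of \<open>w\<close>, and
  \<open>a\<close> is free. Either way a line appears.\<close>

lemma flat_rank1_contradiction:
  fixes W :: "(2 \<times> 2 \<times> 2 \<Rightarrow> 'k::alg_closed_field) set"
  assumes W: "lin_closed W" and fin: "finite P"
    and cover: "\<And>v. cube_minors_in {0} v \<Longrightarrow> \<forall>T\<in>W. (\<Sum>n\<in>UNIV. T n * v n) = 0 \<Longrightarrow> \<exists>p\<in>P. proportional v p"
    and r: "\<And>n. r (r n) = n"
    and pure: "\<And>a b c. cube_minors_in {0} (\<lambda>n. (case r n of (i, j, h) \<Rightarrow> a i * b j * (c h :: 'k)))"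
    and rk: "\<And>T. T \<in> W \<Longrightarrow> minors_in {0} (\<lambda>i p. T (r (i, p)))"
  shows False
proof -
  have pair: "(\<Sum>n\<in>UNIV. T n * (case r n of (i, j, h) \<Rightarrow> a i * b j * c h))
      = (\<Sum>n\<in>UNIV. T (r n) * (case n of (i, j, h) \<Rightarrow> a i * b j * c h))" for T :: "2 \<times> 2 \<times> 2 \<Rightarrow> 'k" and a b c
    by (rule sum.reindex_bij_witness[of _ r r]) (auto simp: r)
  have rk': "minors_in {0} (\<lambda>i p. T (curry r i p))" if "T \<in> W" for T
    using rk[OF that] by simp
  have cover': "\<exists>p\<in>P. proportional (\<lambda>n. (case r n of (i, j, h) \<Rightarrow> a i * b j * c h)) p"
    if "\<And>T. T \<in> W \<Longrightarrow> (\<Sum>n\<in>UNIV. T (r n) * (case n of (i, j, h) \<Rightarrow> a i * b j * c h)) = 0" for a b c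
    using cover[OF pure] that pair by simp
  have "(\<exists>u. \<forall>T\<in>W. \<exists>w. \<forall>i j. T (curry r i j) = u i * w j) \<or>
      (\<exists>w. \<forall>T\<in>W. \<exists>u. \<forall>i j. T (curry r i j) = u i * w j)"
    by (rule rank1_space[OF W]) (rule rk')
  then show False
  proof (elim disjE exE)
    fix u assume u: "\<forall>T\<in>W. \<exists>w. \<forall>i j. T (curry r i j) = u i * w j"
    obtain a :: "2 \<Rightarrow> 'k" where a: "a \<noteq> (\<lambda>_. 0)" "u 0 * a 0 + u 1 * a 1 = 0"
      using orthogonal_vector2[of u] by blast
    define b :: "2 \<Rightarrow> 'k" where "b = (\<lambda>j. if j = 0 then 1 else 0)"
    have z: "(\<Sum>n\<in>UNIV. T (r n) * (case n of (i, j, h) \<Rightarrow> a i * b j * c h)) = 0" if T: "T \<in> W" for T c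
    proof -
      obtain w where "\<forall>i p. T (curry r i p) = u i * w p"
        using bspec[OF u T] by (elim exE)
      then have w: "T (r (i, p)) = u i * w p" for i p
        by (simp only: curry_conv)
      have "(\<Sum>n\<in>UNIV. T (r n) * (case n of (i, j, h) \<Rightarrow> a i * b j * c h))
        = (u 0 * a 0 + u 1 * a 1) * (w (0,0) * b 0 * c 0 + w (0,1) * b 0 * c 1 + w (1,0) * b 1 * c 0 + w (1,1) * b 1 * c 1)"
        unfolding sum_UNIV_prod sum_UNIV_2 w prod.case by Groebner_Basis.algebra
      then show ?thesis
        using a(2) by simp
    qed
    obtain i where i: "a i \<noteq> 0"
      using a(1) by auto
    let ?u = "\<lambda>n. (case r n of (i, j, h) \<Rightarrow> a i * b j * (if h = 0 then 1 else 0))"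
    let ?w = "\<lambda>n. (case r n of (i, j, h) \<Rightarrow> a i * b j * (if h = 0 then 0 else 1))"
    have "\<exists>p\<in>P. proportional (\<lambda>n. ?u n + t * ?w n) p" for t
    proof -
      have "(\<lambda>n. ?u n + t * ?w n) = (\<lambda>n. (case r n of (i, j, h) \<Rightarrow> a i * b j * (if h = 0 then 1 else t)))"
        by (auto simp: fun_eq_iff split: prod.split)
      then show ?thesis
        by (simp only: cover'[OF z])
    qed
    moreover have "?u (r (i, 0, 0)) \<noteq> 0"
      using i by (simp add: r b_def)
    then have "?u \<noteq> (\<lambda>_. 0)"
      using fun_cong[of ?u "\<lambda>_. 0" "r (i, 0, 0)"] by blast
    ultimately have "proportional ?w ?u"
      by (rule no_line[OF fin])
    then obtain d where d: "?w = (\<lambda>n. d * ?u n)"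
      unfolding proportional_def by (elim exE)
    from fun_cong[OF d, of "r (i, 0, 1)"] show False
      using i by (simp add: r b_def)
  next
    fix w assume w: "\<forall>T\<in>W. \<exists>u. \<forall>i j. T (curry r i j) = u i * w j"
    obtain c :: "2 \<Rightarrow> 'k" where c: "c \<noteq> (\<lambda>_. 0)" "w (0,0) * c 0 + w (0,1) * c 1 = 0"
      using orthogonal_vector2[of "\<lambda>h. w (0,h)"] by blast
    define b :: "2 \<Rightarrow> 'k" where "b = (\<lambda>j. if j = 0 then 1 else 0)"
    have z: "(\<Sum>n\<in>UNIV. T (r n) * (case n of (i, j, h) \<Rightarrow> a i * b j * c h)) = 0" if T: "T \<in> W" for T a
    proof -
      obtain u where "\<forall>i p. T (curry r i p) = u i * w p"
        using bspec[OF w T] by (elim exE)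
      then have u: "T (r (i, p)) = u i * w p" for i p
        by (simp only: curry_conv)
      have "(\<Sum>n\<in>UNIV. T (r n) * (case n of (i, j, h) \<Rightarrow> a i * b j * c h))
        = (u 0 * a 0 + u 1 * a 1) * (w (0,0) * c 0 + w (0,1) * c 1)"
        unfolding sum_UNIV_prod sum_UNIV_2 u prod.case b_def by (simp add: algebra_simps)
      then show ?thesis
        using c(2) by simp
    qed
    obtain h where h: "c h \<noteq> 0"
      using c(1) by auto
    let ?u = "\<lambda>n. (case r n of (i, j, h) \<Rightarrow> (if i = 0 then 1 else 0) * b j * c h)"
    let ?w = "\<lambda>n. (case r n of (i, j, h) \<Rightarrow> (if i = 0 then 0 else 1) * b j * c h)"
    have "\<exists>p\<in>P. proportional (\<lambda>n. ?u n + t * ?w n) p" for t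
    proof -
      have "(\<lambda>n. ?u n + t * ?w n) = (\<lambda>n. (case r n of (i, j, h) \<Rightarrow> (if i = 0 then 1 else t) * b j * c h))"
        by (auto simp: fun_eq_iff split: prod.split)
      then show ?thesis
        by (simp only: cover'[OF z])
    qed
    moreover have "?u (r (0, 0, h)) \<noteq> 0"
      using h by (simp add: r b_def)
    then have "?u \<noteq> (\<lambda>_. 0)"
      using fun_cong[of ?u "\<lambda>_. 0" "r (0, 0, h)"] by blast
    ultimately have "proportional ?w ?u"
      by (rule no_line[OF fin])
    then obtain d where d: "?w = (\<lambda>n. d * ?u n)"
      unfolding proportional_def by (elim exE)
    from fun_cong[OF d, of "r (1, 0, h)"] show False
      using h by (simp add: r b_def)
  qed
qed

section \<open>Tensors with nonzero hyperdeterminant\<close>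

text \<open>Nonzero \<open>t\<close>, since later arguments divide by it; nonzero
  \<open>v t\<close>, so that its factor relative to \<open>v 0\<close> is invertible.\<close>

lemma eventually_nonzero:
  fixes v :: "'k::alg_closed_field \<Rightarrow> 'n \<Rightarrow> 'k"
  assumes "\<And>n. polyfun (\<lambda>t. v t n)" "v 0 \<noteq> (\<lambda>_. 0)"
  shows "\<exists>t. t \<noteq> 0 \<and> v t \<noteq> (\<lambda>_. 0)"
proof -
  obtain n where n: "v 0 n \<noteq> 0"
    using assms(2) by auto
  have "finite ({t. v t n = 0} \<union> {0})"
    using finite_polyfun_zeros[of "\<lambda>t. v t n", OF assms(1) n] by simp
  then obtain t where "t \<notin> {t. v t n = 0} \<union> {0}"
    using infinite_UNIV_alg_closed ex_new_if_finite by blast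
  then show ?thesis
    by (intro exI[of _ t]) (auto simp: fun_eq_iff)
qed

lemma polyfun_half_grad:
  "polyfun (\<lambda>t. half_grad (\<lambda>n. T n + t * U n) n)"
  by (cases n rule: prod_cases3) (auto intro!: polyfun_intros)

lemma exists_hyperdet_nonzero:
  fixes W :: "(2 \<times> 2 \<times> 2 \<Rightarrow> 'k::alg_closed_field) set"
  assumes W: "lin_closed W" and fin: "finite P"
    and cover: "\<And>v. cube_minors_in {0} v \<Longrightarrow> \<forall>T\<in>W. (\<Sum>n\<in>UNIV. T n * v n) = 0 \<Longrightarrow> \<exists>p\<in>P. proportional v p"
    and two: "(2::'k) \<noteq> 0" and three: "(3::'k) \<noteq> 0"
  shows "\<exists>T\<in>W. hyperdet T \<noteq> 0"
proof (rule ccontr)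
  assume "\<not> ?thesis"
  then have D: "hyperdet T = 0" if "T \<in> W" for T
    using that by blast
  have line: "(\<lambda>n. T n + t * U n) \<in> W" if "T \<in> W" "U \<in> W" for T U t
    using W that unfolding lin_closed_def by blast
  have orth: "\<forall>U\<in>W. (\<Sum>n\<in>UNIV. U n * half_grad T n) = 0" if T: "T \<in> W" for T
    using hyperdet_zero_on_line[OF D[OF line[OF T]] two three] by blast
  have grad: "\<exists>p\<in>P. proportional (half_grad T) p" if T: "T \<in> W" for T
    using cover[OF half_grad_rank1[OF D[OF T]] orth[OF T]] .
  show False
  proof (cases "\<exists>T\<in>W. half_grad T \<noteq> (\<lambda>_. 0)")
    case True
    then obtain T0 where T0: "T0 \<in> W" "half_grad T0 \<noteq> (\<lambda>_. 0)"
      by (elim bexE)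
    define g where "g = half_grad T0"
    \<comment> \<open>The contraction of \<open>T\<close> with \<open>g\<close> over the first two
      indices. Its vanishing on \<open>W\<close> allows the third factor of the pure tensor
      \<open>g\<close> to be replaced by any vector.\<close>
    define ctr where "ctr = (\<lambda>(T :: 2 \<times> 2 \<times> 2 \<Rightarrow> 'k) h h'. T (0,0,h) * g (0,0,h') + T (0,1,h) * g (0,1,h')
       + T (1,0,h) * g (1,0,h') + T (1,1,h) * g (1,1,h'))"
    have ctr0: "ctr T0 h h' = 0" for h h'
      unfolding ctr_def g_def half_grad_contraction D[OF T0(1)] by simp
    have ctr: "ctr T1 h h' = 0" if T1: "T1 \<in> W" for T1 h h'
    proof -
      define v where "v = (\<lambda>t. half_grad (\<lambda>n. T0 n + t * T1 n))"
      have v0: "v 0 = g"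
        by (simp add: v_def g_def)
      have poly: "polyfun (\<lambda>t. v t n)" for n
        unfolding v_def by (rule polyfun_half_grad)
      have nz: "v 0 \<noteq> (\<lambda>_. 0)"
        using T0(2) unfolding v0 g_def .
      obtain t where t: "t \<noteq> 0" "v t \<noteq> (\<lambda>_. 0)"
        using eventually_nonzero[of v, OF poly nz] by (elim exE conjE)
      have "\<exists>p\<in>P. proportional (v t) p" for t
        unfolding v_def by (rule grad[OF line[OF T0(1) T1]])
      then have "proportional (v t) (v 0)"
        by (rule constant_direction[of v, OF poly fin _ nz])
      then obtain c where c: "v t = (\<lambda>n. c * g n)"
        unfolding proportional_def v0 by (elim exE)
      have "c \<noteq> 0"
        using t(2) unfolding c by auto
      define Tt where "Tt = (\<lambda>n. T0 n + t * T1 n)"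
      have g: "half_grad Tt n = c * g n" for n
        using fun_cong[OF c] by (simp add: v_def Tt_def)
      have "Tt \<in> W"
        unfolding Tt_def by (rule line[OF T0(1) T1])
      \<comment> \<open>The gradient at \<open>Tt\<close> is \<open>c g\<close> with the same fixed
        \<open>g\<close>, so \<open>half_grad_contraction\<close> is linear information about
        \<open>Tt\<close>; removing the part of \<open>T0\<close> leaves that of
        \<open>T1\<close>.\<close>
      then have "c * ctr Tt h h' = 0"
        using half_grad_contraction[of Tt h h'] D[of Tt] unfolding g ctr_def by (simp add: algebra_simps split: if_splits)
      then have "ctr Tt h h' = 0"
        using \<open>c \<noteq> 0\<close> by simp
      moreover have "ctr Tt h h' = ctr T0 h h' + t * ctr T1 h h'"
        unfolding ctr_def Tt_def by (simp add: algebra_simps)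
      ultimately show ?thesis
        using ctr0 t(1) by simp
    qed
    obtain i j h' where ijh: "g (i, j, h') \<noteq> 0"
      using T0(2) unfolding g_def by (metis prod_cases3 ext)
    have rk: "cube_minors_in {0} g"
      unfolding g_def by (rule half_grad_rank1[OF D[OF T0(1)]])
    then have gm: "g (0,0,h') * g (1,1,h') = g (0,1,h') * g (1,0,h')"
      using all_2[of "\<lambda>h'. g (0,0,h') * g (1,1,h') = g (0,1,h') * g (1,0,h')"]
      unfolding cube_minors_in_0_iff by blast
    have mem: "\<exists>p\<in>P. proportional (\<lambda>(i, j, h). g (i, j, h') * c h) p" for c
    proof (rule cover)
      show "cube_minors_in {0} (\<lambda>(i, j, h). g (i, j, h') * c h)"
        unfolding cube_minors_in_0_iff prod.case using gm
        by (intro conjI; (simp add: ac_simps; fail | Groebner_Basis.algebra))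
      have "(\<Sum>n\<in>UNIV. T n * (case n of (i, j, h) \<Rightarrow> g (i, j, h') * c h)) = c 0 * ctr T 0 h' + c 1 * ctr T 1 h'" for T
        unfolding ctr_def sum_UNIV_prod sum_UNIV_2 prod.case by (simp add: algebra_simps)
      then show "\<forall>T\<in>W. (\<Sum>n\<in>UNIV. T n * (case n of (i, j, h) \<Rightarrow> g (i, j, h') * c h)) = 0"
        using ctr by simp
    qed
    let ?u = "\<lambda>(i, j, h). g (i, j, h') * (if h = (0::2) then 1 else 0)"
    let ?w = "\<lambda>(i, j, h). g (i, j, h') * (if h = (0::2) then 0 else 1)"
    have "\<exists>p\<in>P. proportional (\<lambda>n. ?u n + t * ?w n) p" for t
    proof -
      have "(\<lambda>n. ?u n + t * ?w n) = (\<lambda>(i, j, h). g (i, j, h') * (if h = 0 then 1 else t))"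
        by (auto simp: fun_eq_iff)
      then show ?thesis
        by (simp only: mem)
    qed
    moreover have "?u \<noteq> (\<lambda>_. 0)"
    proof
      assume u0: "?u = (\<lambda>_. 0)"
      from fun_cong[OF u0, of "(i, j, 0)"] show False
        using ijh by simp
    qed
    ultimately have "proportional ?w ?u"
      by (rule no_line[OF fin])
    then obtain d where d: "?w = (\<lambda>n. d * ?u n)"
      unfolding proportional_def by (elim exE)
    from fun_cong[OF d, of "(i, j, 1)"] show False
      using ijh by simp
  next
    case False
    \<comment> \<open>Each tensor in \<open>W\<close> has some flattening of rank at most one.
      Irreducibility of \<open>W\<close> makes the direction of the flattening the same for all of
      them.\<close>
    let ?C1 = "{T :: 2 \<times> 2 \<times> 2 \<Rightarrow> 'k. minors_in {0} (\<lambda>i p. T (i, p))}"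
    let ?C2 = "{T :: 2 \<times> 2 \<times> 2 \<Rightarrow> 'k. minors_in {0} (\<lambda>i p. T (swap12 (i, p)))}"
    let ?C3 = "{T :: 2 \<times> 2 \<times> 2 \<Rightarrow> 'k. minors_in {0} (\<lambda>i p. T (swap13 (i, p)))}"
    have C: "line_closed ?C1" "line_closed ?C2" "line_closed ?C3"
      by (rule line_closed_minors)+
    have "T \<in> ?C1 \<union> (?C2 \<union> ?C3)" if T: "T \<in> W" for T
      using half_grad_zero_cases[OF two _ D[OF T]] False T by blast
    then have "W \<subseteq> ?C1 \<union> (?C2 \<union> ?C3)"
      by (rule subsetI)
    then have "W \<subseteq> ?C1 \<or> W \<subseteq> ?C2 \<union> ?C3"
      by (rule lin_closed_cases[OF W C(1) line_closed_Un[OF C(2,3)]])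
    then have cases: "W \<subseteq> ?C1 \<or> W \<subseteq> ?C2 \<or> W \<subseteq> ?C3"
      using lin_closed_cases[OF W C(2,3)] by blast
    have 1: False if "W \<subseteq> ?C1"
    proof (rule flat_rank1_contradiction[OF W fin cover, where r = "\<lambda>n. n"])
      show "minors_in {0} (\<lambda>i p. T (i, p))" if "T \<in> W" for T
        using that \<open>W \<subseteq> ?C1\<close> by blast
    qed (auto simp: cube_minors_in_0_iff)
    have 2: False if "W \<subseteq> ?C2"
    proof (rule flat_rank1_contradiction[OF W fin cover, where r = swap12])
      show "minors_in {0} (\<lambda>i p. T (swap12 (i, p)))" if "T \<in> W" for T
        using that \<open>W \<subseteq> ?C2\<close> by blast
    qed (auto simp: cube_minors_in_0_iff swap12_def)
    have 3: False if "W \<subseteq> ?C3"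
    proof (rule flat_rank1_contradiction[OF W fin cover, where r = swap13])
      show "minors_in {0} (\<lambda>i p. T (swap13 (i, p)))" if "T \<in> W" for T
        using that \<open>W \<subseteq> ?C3\<close> by blast
    qed (auto simp: cube_minors_in_0_iff swap13_def)
    show False
      using cases 1 2 3 by blast
  qed
qed

text \<open>For \<open>a = 0\<close> the form has the factor y, with zeros (1, 0) and (-c, b).
  Otherwise the quadratic formula is used in homogeneous form, with second coordinate
  \<open>2 * a\<close>.\<close>

lemma binary_quadratic_form_zeros:
  fixes a b c :: "'k::alg_closed_field"
  assumes "b^2 - 4 * (a * c) \<noteq> 0" "(2::'k) \<noteq> 0"
  shows "\<exists>x y x' y'. a * x^2 + b * x * y + c * y^2 = 0 \<and> a * x'^2 + b * x' * y' + c * y'^2 = 0 \<and> x * y' - x' * y \<noteq> 0"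
proof (cases "a = 0")
  case True
  then show ?thesis
    using assms by (intro exI[of _ 1] exI[of _ 0] exI[of _ "- c"] exI[of _ b]) (auto simp: power2_eq_square)
next
  case False
  obtain d where d: "d ^ 2 = b^2 - 4 * (a * c)"
    using nth_root_exists[of 2 "b^2 - 4 * (a * c)"] by auto
  have "d \<noteq> 0"
    using d assms by auto
  have "a * (- b + d)^2 + b * (- b + d) * (2 * a) + c * (2 * a)^2 = 0"
    "a * (- b - d)^2 + b * (- b - d) * (2 * a) + c * (2 * a)^2 = 0"
    using d by Groebner_Basis.algebra+
  moreover have "(- b + d) * (2 * a) - (- b - d) * (2 * a) \<noteq> 0"
  proof -
    have "(- b + d) * (2 * a) - (- b - d) * (2 * a) = 2 * (2 * (d * a))"
      by (simp add: algebra_simps)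
    then show ?thesis
      using False \<open>d \<noteq> 0\<close> assms(2) by (simp only: mult_eq_0_iff simp_thms)
  qed
  ultimately show ?thesis by blast
qed

text \<open>The two zeros of the quadratic form det(x T_0 + y T_1) are the rank-one members of the
  slice pencil; both slices are combinations of these two.\<close>

lemma tensor_rank2:
  fixes T :: "2 \<times> 2 \<times> 2 \<Rightarrow> 'k::alg_closed_field"
  assumes "hyperdet T \<noteq> 0" "(2::'k) \<noteq> 0"
  shows "\<exists>\<alpha> \<beta> \<gamma> \<alpha>' \<beta>' \<gamma>'. \<forall>i j h. T (i, j, h) = \<alpha> i * \<beta> j * \<gamma> h + \<alpha>' i * \<beta>' j * (\<gamma>' h :: 'k)"
proof -
  define a where "a = T (0,0,0) * T (0,1,1) - T (0,0,1) * T (0,1,0)"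
  define c where "c = T (1,0,0) * T (1,1,1) - T (1,0,1) * T (1,1,0)"
  define b where "b = T (0,0,0) * T (1,1,1) + T (0,1,1) * T (1,0,0) - T (0,0,1) * T (1,1,0) - T (0,1,0) * T (1,0,1)"
  have "b^2 - 4 * (a * c) \<noteq> 0"
    using assms(1) by (simp add: hyperdet_def a_def b_def c_def)
  then obtain x y x' y' where z: "a * x^2 + b * x * y + c * y^2 = 0" "a * x'^2 + b * x' * y' + c * y'^2 = 0"
    and nz: "x * y' - x' * y \<noteq> 0"
    using binary_quadratic_form_zeros[OF _ assms(2)] by metis
  have fac: "\<exists>\<beta> \<gamma>. \<forall>j h. x * T (0, j, h) + y * T (1, j, h) = \<beta> j * \<gamma> h"
    if "a * x^2 + b * x * y + c * y^2 = 0" for x y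
  proof (rule minors_in_0_factor)
    have "(x * T (0,0,0) + y * T (1,0,0)) * (x * T (0,1,1) + y * T (1,1,1))
        = (x * T (0,0,1) + y * T (1,0,1)) * (x * T (0,1,0) + y * T (1,1,0))"
      using that unfolding a_def b_def c_def by Groebner_Basis.algebra
    then show "minors_in {0} (\<lambda>j h. x * T (0, j, h) + y * T (1, j, h))"
      unfolding minors_in_def all_2 by (simp add: mult.commute)
  qed
  obtain \<beta> \<gamma> where bg: "\<forall>j h. x * T (0, j, h) + y * T (1, j, h) = \<beta> j * \<gamma> h"
    using fac[OF z(1)] by (elim exE)
  obtain \<beta>' \<gamma>' where bg': "\<forall>j h. x' * T (0, j, h) + y' * T (1, j, h) = \<beta>' j * \<gamma>' h"
    using fac[OF z(2)] by (elim exE)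
  define e where "e = x * y' - x' * y"
  \<comment> \<open>\<open>\<alpha>\<close> and \<open>\<alpha>'\<close> are the columns of the
    inverse of the matrix with rows (x, y) and (x', y').\<close>
  define \<alpha> where "\<alpha> = (\<lambda>i :: 2. if i = 0 then y' / e else - x' / e)"
  define \<alpha>' where "\<alpha>' = (\<lambda>i :: 2. if i = 0 then - y / e else x / e)"
  have "T (i, j, h) = \<alpha> i * \<beta> j * \<gamma> h + \<alpha>' i * \<beta>' j * \<gamma>' h" for i j h
  proof -
    have "e * T (0, j, h) = y' * (x * T (0, j, h) + y * T (1, j, h)) - y * (x' * T (0, j, h) + y' * T (1, j, h))"
      "e * T (1, j, h) = - x' * (x * T (0, j, h) + y * T (1, j, h)) + x * (x' * T (0, j, h) + y' * T (1, j, h))"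
      unfolding e_def by (simp_all add: algebra_simps)
    then have "e * T (0, j, h) = y' * (\<beta> j * \<gamma> h) - y * (\<beta>' j * \<gamma>' h)"
      "e * T (1, j, h) = - x' * (\<beta> j * \<gamma> h) + x * (\<beta>' j * \<gamma>' h)"
      using bg bg' by simp_all
    then have "\<forall>i. T (i, j, h) = \<alpha> i * \<beta> j * \<gamma> h + \<alpha>' i * \<beta>' j * \<gamma>' h"
      unfolding all_2 using nz unfolding \<alpha>_def \<alpha>'_def e_def[symmetric] by (simp add: field_simps)
    then show ?thesis by blast
  qed
  then show ?thesis by blast
qed

text \<open>Relative invariance, starting from the diagonal unit tensor, whose hyperdeterminant is
  1. It shows that in each direction the two factors form a basis.\<close>

lemma hyperdet_rank2:
  assumes "\<And>i j h. T (i, j, h) = \<alpha> i * \<beta> j * \<gamma> h + \<alpha>' i * \<beta>' j * (\<gamma>' h :: 'k::field)"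
  shows "hyperdet T = ((\<alpha> 0 * \<alpha>' 1 - \<alpha> 1 * \<alpha>' 0) * (\<beta> 0 * \<beta>' 1 - \<beta> 1 * \<beta>' 0) * (\<gamma> 0 * \<gamma>' 1 - \<gamma> 1 * \<gamma>' 0))^2"
  unfolding hyperdet_def assms by Groebner_Basis.algebra

section \<open>Spaces of singular three by three matrices\<close>

lemma all_3: "(\<forall>i::3. P i) \<longleftrightarrow> P 0 \<and> P 1 \<and> P 2"
proof -
  have "(3::3) = 0" by simp
  then show ?thesis
    by (metis (full_types) exhaust_3)
qed

lemma sum_UNIV_3: "sum f (UNIV :: 3 set) = f 0 + f 1 + f 2"
proof -
  have "(UNIV :: 3 set) = {0, 1, 2}"
    using all_3[of "\<lambda>i. i \<in> {0, 1, 2}"] by auto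
  then have "sum f (UNIV :: 3 set) = sum f {0, 1, 2}" by (rule arg_cong)
  then show ?thesis by (simp add: add.assoc)
qed

lemma arith_3: "(1::3) + 1 = 2" "(2::3) + 1 = 0" "(1::3) + 2 = 0" "(2::3) + 2 = 1"
  by simp_all

definition det3 :: "(3 \<times> 3 \<Rightarrow> 'k::field) \<Rightarrow> 'k" where
  "det3 A = A (0,0) * (A (1,1) * A (2,2) - A (1,2) * A (2,1))
     - A (0,1) * (A (1,0) * A (2,2) - A (1,2) * A (2,0))
     + A (0,2) * (A (1,0) * A (2,1) - A (1,1) * A (2,0))"

text \<open>Indices are taken modulo three, which produces the signs of the cofactors.\<close>

fun cofactor3 :: "(3 \<times> 3 \<Rightarrow> 'k::field) \<Rightarrow> 3 \<times> 3 \<Rightarrow> 'k" where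
  "cofactor3 A (i, j) = A (i+1,j+1) * A (i+2,j+2) - A (i+1,j+2) * A (i+2,j+1)"

declare cofactor3.simps [simp del]

definition mmult :: "(3 \<times> 3 \<Rightarrow> 'k::field) \<Rightarrow> (3 \<times> 3 \<Rightarrow> 'k) \<Rightarrow> 3 \<times> 3 \<Rightarrow> 'k" where
  "mmult A B = (\<lambda>(i, j). \<Sum>k\<in>UNIV. A (i, k) * B (k, j))"

definition ident3 :: "3 \<times> 3 \<Rightarrow> 'k::field" where
  "ident3 = (\<lambda>(i, j). if i = j then 1 else 0)"

lemma cofactor3_rows: "(\<Sum>j\<in>UNIV. A (i, j) * cofactor3 A (i', j)) = (if i = i' then det3 A else 0)"
proof -
  have "\<forall>i i'. (\<Sum>j\<in>UNIV. A (i, j) * cofactor3 A (i', j)) = (if i = i' then det3 A else 0)"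
    unfolding all_3 sum_UNIV_3 cofactor3.simps add_0_left arith_3 det3_def
    by (simp, (intro conjI; Groebner_Basis.algebra))
  then show ?thesis by blast
qed

lemma cofactor3_cols: "(\<Sum>i\<in>UNIV. A (i, j) * cofactor3 A (i, j')) = (if j = j' then det3 A else 0)"
proof -
  have "\<forall>j j'. (\<Sum>i\<in>UNIV. A (i, j) * cofactor3 A (i, j')) = (if j = j' then det3 A else 0)"
    unfolding all_3 sum_UNIV_3 cofactor3.simps add_0_left arith_3 det3_def
    by (simp, (intro conjI; Groebner_Basis.algebra))
  then show ?thesis by blast
qed

lemma inverse3_exists:
  assumes "det3 A \<noteq> 0"
  shows "\<exists>B. mmult A B = ident3 \<and> mmult B A = ident3"
proof (intro exI conjI)
  let ?B = "\<lambda>(i, j). cofactor3 A (j, i) / det3 A"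
  show "mmult A ?B = ident3"
    using assms by (auto simp: mmult_def ident3_def fun_eq_iff cofactor3_rows simp flip: sum_divide_distrib)
  show "mmult ?B A = ident3"
    using assms cofactor3_cols[of A]
    by (auto simp: mmult_def ident3_def fun_eq_iff mult.commute[of _ "A _"] simp flip: sum_divide_distrib)
qed

text \<open>The cofactor matrix of the cofactor matrix is \<open>det3 A\<close> times
  \<open>A\<close>.\<close>

lemma cofactor3_rank1:
  assumes "det3 A = 0"
  shows "minors_in {0} (\<lambda>i j. cofactor3 A (i, j))"
proof -
  have "\<forall>i j. cofactor3 (cofactor3 A) (i, j) = 0"
    using assms unfolding all_3 cofactor3.simps add_0_left arith_3 det3_def
    by (intro conjI; Groebner_Basis.algebra)
  then have "\<forall>i j. cofactor3 A (i+1,j+1) * cofactor3 A (i+2,j+2) = cofactor3 A (i+1,j+2) * cofactor3 A (i+2,j+1)"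
    by (simp add: cofactor3.simps[of "cofactor3 A"])
  then show ?thesis
    unfolding minors_in_def all_3 add_0_left arith_3 by (simp add: mult.commute)
qed

text \<open>Along the line the determinant is a cubic without constant and cubic terms; the values
  at 1 and -1 separate the two remaining coefficients.\<close>

lemma cofactor3_orthogonal:
  fixes A B :: "3 \<times> 3 \<Rightarrow> 'k::field"
  assumes "\<And>s. det3 (\<lambda>n. A n + s * B n) = 0" "det3 B = 0" "(2::'k) \<noteq> 0"
  shows "(\<Sum>n\<in>UNIV. B n * cofactor3 A n) = 0"
proof -
  have z: "det3 A = 0"
    using assms(1)[of 0] by simp
  have e: "det3 (\<lambda>n. A n + s * B n) = det3 A + s * (\<Sum>n\<in>UNIV. B n * cofactor3 A n)
      + s^2 * (\<Sum>n\<in>UNIV. A n * cofactor3 B n) + s^3 * det3 B" for s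
    unfolding sum_UNIV_prod sum_UNIV_3 cofactor3.simps add_0_left arith_3 det3_def by Groebner_Basis.algebra
  define b where "b = (\<Sum>n\<in>UNIV. B n * cofactor3 A n)"
  define c where "c = (\<Sum>n\<in>UNIV. A n * cofactor3 B n)"
  have "b + c = 0" "c - b = 0"
    using e[of 1] e[of "-1"] assms(1)[of 1] assms(1)[of "-1"] assms(2) z by (simp_all add: b_def c_def)
  then have "2 * b = 0"
    by Groebner_Basis.algebra
  then show ?thesis
    using assms(3) by (simp add: b_def)
qed

lemma polyfun_cofactor3: "polyfun (\<lambda>t. cofactor3 (\<lambda>n. A n + t * B n) n)"
  by (cases n) (auto simp: cofactor3.simps intro!: polyfun_intros)

lemma two_orthogonal_vectors3:
  fixes c :: "3 \<Rightarrow> 'k::field"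
  shows "\<exists>a a' :: 3 \<Rightarrow> 'k. a \<noteq> (\<lambda>_. 0) \<and> \<not> proportional a' a \<and>
    (\<Sum>i\<in>UNIV. a i * c i) = 0 \<and> (\<Sum>i\<in>UNIV. a' i * c i) = 0"
proof -
  define vec where "vec = (\<lambda>x y z (i::3). if i = 0 then x else if i = 1 then y else (z :: 'k))"
  have vec: "vec x y z 0 = x" "vec x y z 1 = y" "vec x y z 2 = z" for x y z
    by (simp_all add: vec_def)
  have ind: "a \<noteq> (\<lambda>_. 0) \<and> \<not> proportional a' a"
    if "a i \<noteq> 0" "a' i = 0" "a' j \<noteq> 0" for a a' :: "3 \<Rightarrow> 'k" and i j
  proof
    show "a \<noteq> (\<lambda>_. 0)"
      using that(1) by auto
    show "\<not> proportional a' a"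
    proof
      assume "proportional a' a"
      then obtain d where d: "a' = (\<lambda>i. d * a i)"
        unfolding proportional_def by (elim exE)
      show False
        using that fun_cong[OF d, of i] fun_cong[OF d, of j] by simp
    qed
  qed
  show ?thesis
  proof (cases "c 0 = 0")
    case False
    have "vec (- c 1) (c 0) 0 \<noteq> (\<lambda>_. 0) \<and> \<not> proportional (vec (- c 2) 0 (c 0)) (vec (- c 1) (c 0) 0)"
      by (rule ind[of _ 1 _ 2]) (simp_all add: vec False)
    then show ?thesis
      by (intro exI[of _ "vec (- c 1) (c 0) 0"] exI[of _ "vec (- c 2) 0 (c 0)"]) (simp add: vec sum_UNIV_3)
  next
    case c0: True
    show ?thesis
    proof (cases "c 1 = 0")
      case False
      have "vec 1 0 0 \<noteq> (\<lambda>_. 0) \<and> \<not> proportional (vec 0 (- c 2) (c 1)) (vec 1 0 0)"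
        by (rule ind[of _ 0 _ 2]) (simp_all add: vec False)
      then show ?thesis
        using c0 by (intro exI[of _ "vec 1 0 0"] exI[of _ "vec 0 (- c 2) (c 1)"]) (simp add: vec sum_UNIV_3)
    next
      case True
      have "vec 1 0 0 \<noteq> (\<lambda>_. 0) \<and> \<not> proportional (vec 0 1 0) (vec 1 0 0)"
        by (rule ind[of _ 0 _ 1]) (simp_all add: vec)
      then show ?thesis
        using c0 True by (intro exI[of _ "vec 1 0 0"] exI[of _ "vec 0 1 0"]) (simp add: vec sum_UNIV_3)
    qed
  qed
qed

text \<open>Excludes a line in one ruling of P^2 x P^2; the primed version treats the other ruling
  by transposition.\<close>

lemma no_rank1_line:
  fixes a a' b :: "3 \<Rightarrow> 'k::alg_closed_field"
  assumes fin: "finite P" and cover: "\<And>t. \<exists>p\<in>P. proportional (\<lambda>(i, j). (a i + t * a' i) * b j) p"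
    and nz: "a \<noteq> (\<lambda>_. 0)" "b \<noteq> (\<lambda>_. 0)"
  shows "proportional a' a"
proof -
  let ?u = "\<lambda>(i, j). a i * b j" and ?w = "\<lambda>(i, j). a' i * b j"
  have "(\<lambda>n. ?u n + t * ?w n) = (\<lambda>(i, j). (a i + t * a' i) * b j)" for t
    by (auto simp: fun_eq_iff algebra_simps)
  then have "\<exists>p\<in>P. proportional (\<lambda>n. ?u n + t * ?w n) p" for t
    by (simp only: cover)
  moreover obtain i where i: "a i \<noteq> 0"
    using nz(1) by auto
  obtain j where j: "b j \<noteq> 0"
    using nz(2) by auto
  note ij = i j
  have "?u \<noteq> (\<lambda>_. 0)"
  proof
    assume u0: "?u = (\<lambda>_. 0)"
    from fun_cong[OF u0, of "(i, j)"] show False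
      using ij by simp
  qed
  ultimately have "proportional ?w ?u"
    by (rule no_line[OF fin])
  then obtain d where d: "?w = (\<lambda>n. d * ?u n)"
    unfolding proportional_def by (elim exE)
  have "a' i' = d * a i'" for i'
    using fun_cong[OF d, of "(i', j)"] ij by simp
  then have "a' = (\<lambda>i. d * a i)"
    by (rule ext)
  then show ?thesis
    unfolding proportional_def by (rule exI)
qed

lemma no_rank1_line':
  fixes a b b' :: "3 \<Rightarrow> 'k::alg_closed_field"
  assumes fin: "finite P" and cover: "\<And>t. \<exists>p\<in>P. proportional (\<lambda>(i, j). a i * (b j + t * b' j)) p"
    and nz: "b \<noteq> (\<lambda>_. 0)" "a \<noteq> (\<lambda>_. 0)"
  shows "proportional b' b"
proof (rule no_rank1_line[OF _ _ nz])
  show "finite ((\<lambda>p (i, j). p (j, i)) ` P)"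
    using fin by simp
  fix t
  obtain p d where p: "p \<in> P" "(\<lambda>(i, j). a i * (b j + t * b' j)) = (\<lambda>n. d * p n)"
    using cover[of t] unfolding proportional_def by (elim bexE exE)
  have "(\<lambda>(i, j). (b i + t * b' i) * a j) = (\<lambda>n. d * (case n of (i, j) \<Rightarrow> p (j, i)))"
    using fun_cong[OF p(2), of "(_, _)"] by (auto simp: fun_eq_iff mult.commute)
  then show "\<exists>p\<in>(\<lambda>p (i, j). p (j, i)) ` P. proportional (\<lambda>(i, j). (b i + t * b' i) * a j) p"
    using p(1) unfolding proportional_def by (intro bexI[of _ "\<lambda>(i, j). p (j, i)"] exI[of _ d]) auto
qed

text \<open>The cofactor matrix is the gradient of the determinant, so on a space of singular matrices it is
  orthogonal to the space: it yields points of the linear section of the Segre variety cut out by \<open>W\<close> and \<open>J\<close>.\<close>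

lemma singular_space_contradiction:
  fixes W :: "(3 \<times> 3 \<Rightarrow> 'k::alg_closed_field) set"
  assumes W: "lin_closed W" and fin: "finite P"
    and cover: "\<And>v. minors_in {0} (\<lambda>i j. v (i, j)) \<Longrightarrow> \<forall>A\<in>W. (\<Sum>n\<in>UNIV. A n * v n) = 0 \<Longrightarrow>
      (\<Sum>n\<in>UNIV. J n * v n) = 0 \<Longrightarrow> \<exists>p\<in>P. proportional v p"
    and sing: "\<And>A. A \<in> W \<Longrightarrow> det3 A = 0"
    and J: "\<And>A. A \<in> W \<Longrightarrow> (\<Sum>n\<in>UNIV. J n * cofactor3 A n) = 0"
    and two: "(2::'k) \<noteq> 0"
  shows False
proof -
  have line: "(\<lambda>n. A n + t * B n) \<in> W" if "A \<in> W" "B \<in> W" for A B t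
    using W that unfolding lin_closed_def by blast
  have pure: "minors_in {0} (\<lambda>i j. (case (i, j) of (i, j) \<Rightarrow> a i * (b j :: 'k)))" for a b :: "3 \<Rightarrow> 'k"
    by (auto simp: minors_in_def)
  have pair: "(\<Sum>n\<in>UNIV. A n * (case n of (i, j) \<Rightarrow> a i * b j))
      = (\<Sum>i\<in>UNIV. a i * (\<Sum>j\<in>UNIV. A (i, j) * b j))" for A :: "3 \<times> 3 \<Rightarrow> 'k" and a b
    unfolding sum_UNIV_prod sum_distrib_left prod.case by (simp only: ac_simps)
  have pair': "(\<Sum>n\<in>UNIV. A n * (case n of (i, j) \<Rightarrow> a i * b j))
      = (\<Sum>j\<in>UNIV. b j * (\<Sum>i\<in>UNIV. a i * A (i, j)))" for A :: "3 \<times> 3 \<Rightarrow> 'k" and a b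
    unfolding sum_UNIV_prod sum_UNIV_3 prod.case by (simp add: algebra_simps)
  have cofactor_cover: "\<exists>p\<in>P. proportional (cofactor3 A) p" if A: "A \<in> W" for A
  proof (rule cover[OF cofactor3_rank1[OF sing[OF A]] _ J[OF A]])
    show "\<forall>B\<in>W. (\<Sum>n\<in>UNIV. B n * cofactor3 A n) = 0"
      using cofactor3_orthogonal[OF sing[OF line[OF A]] sing two] by blast
  qed
  \<comment> \<open>If \<open>b\<close> is killed by all of \<open>W\<close>, every
    \<open>a b\<close> is orthogonal to \<open>W\<close>. The condition from \<open>J\<close> is one
    linear equation on \<open>a\<close>, which leaves two independent solutions and hence a
    line.\<close>
  have right_kernel: False if b: "b \<noteq> (\<lambda>_. 0)" and ker: "\<And>A i. A \<in> W \<Longrightarrow> (\<Sum>j\<in>UNIV. A (i, j) * b j) = 0" for b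
  proof -
    obtain a a' :: "3 \<Rightarrow> 'k" where a: "a \<noteq> (\<lambda>_. 0)" "\<not> proportional a' a"
      "(\<Sum>i\<in>UNIV. a i * (\<Sum>j\<in>UNIV. J (i, j) * b j)) = 0" "(\<Sum>i\<in>UNIV. a' i * (\<Sum>j\<in>UNIV. J (i, j) * b j)) = 0"
      using two_orthogonal_vectors3[of "\<lambda>i. \<Sum>j\<in>UNIV. J (i, j) * b j"] by (elim exE conjE)
    have "\<exists>p\<in>P. proportional (\<lambda>(i, j). (a i + t * a' i) * b j) p" for t
    proof (rule cover[OF pure])
      show "\<forall>A\<in>W. (\<Sum>n\<in>UNIV. A n * (case n of (i, j) \<Rightarrow> (a i + t * a' i) * b j)) = 0"
        unfolding pair by (simp add: ker)
      have "(\<Sum>n\<in>UNIV. J n * (case n of (i, j) \<Rightarrow> (a i + t * a' i) * b j))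
        = (\<Sum>i\<in>UNIV. a i * (\<Sum>j\<in>UNIV. J (i, j) * b j)) + t * (\<Sum>i\<in>UNIV. a' i * (\<Sum>j\<in>UNIV. J (i, j) * b j))"
        unfolding pair by (simp add: distrib_right sum.distrib sum_distrib_left mult.assoc)
      then show "(\<Sum>n\<in>UNIV. J n * (case n of (i, j) \<Rightarrow> (a i + t * a' i) * b j)) = 0"
        using a(3,4) by simp
    qed
    then show False
      using no_rank1_line[OF fin _ a(1) b] a(2) by blast
  qed
  have left_kernel: False if a: "a \<noteq> (\<lambda>_. 0)" and ker: "\<And>A j. A \<in> W \<Longrightarrow> (\<Sum>i\<in>UNIV. a i * A (i, j)) = 0" for a
  proof -
    obtain b b' :: "3 \<Rightarrow> 'k" where b: "b \<noteq> (\<lambda>_. 0)" "\<not> proportional b' b"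
      "(\<Sum>j\<in>UNIV. b j * (\<Sum>i\<in>UNIV. a i * J (i, j))) = 0" "(\<Sum>j\<in>UNIV. b' j * (\<Sum>i\<in>UNIV. a i * J (i, j))) = 0"
      using two_orthogonal_vectors3[of "\<lambda>j. \<Sum>i\<in>UNIV. a i * J (i, j)"] by (elim exE conjE)
    have "\<exists>p\<in>P. proportional (\<lambda>(i, j). a i * (b j + t * b' j)) p" for t
    proof (rule cover[OF pure])
      show "\<forall>A\<in>W. (\<Sum>n\<in>UNIV. A n * (case n of (i, j) \<Rightarrow> a i * (b j + t * b' j))) = 0"
        unfolding pair' by (simp add: ker)
      have "(\<Sum>n\<in>UNIV. J n * (case n of (i, j) \<Rightarrow> a i * (b j + t * b' j)))
        = (\<Sum>j\<in>UNIV. b j * (\<Sum>i\<in>UNIV. a i * J (i, j))) + t * (\<Sum>j\<in>UNIV. b' j * (\<Sum>i\<in>UNIV. a i * J (i, j)))"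
        unfolding pair' by (simp add: distrib_right sum.distrib sum_distrib_left mult.assoc)
      then show "(\<Sum>n\<in>UNIV. J n * (case n of (i, j) \<Rightarrow> a i * (b j + t * b' j))) = 0"
        using b(3,4) by simp
    qed
    then show False
      using no_rank1_line'[OF fin _ b(1) a] b(2) by blast
  qed
  show False
  proof (cases "\<exists>A\<in>W. cofactor3 A \<noteq> (\<lambda>_. 0)")
    case True
    then obtain A0 where A0: "A0 \<in> W" "cofactor3 A0 \<noteq> (\<lambda>_. 0)"
      by (elim bexE)
    define g where "g = cofactor3 A0"
    \<comment> \<open>The cofactors along the line have constant direction \<open>g\<close>. As rows
      of a singular matrix are orthogonal to cofactor rows, the rows of \<open>g\<close> are killed
      by all of \<open>W\<close>, which gives a common kernel vector.\<close>
    have "(\<Sum>j\<in>UNIV. A (i, j) * g (i', j)) = 0" if A: "A \<in> W" for A i i'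
    proof -
      define v where "v = (\<lambda>t. cofactor3 (\<lambda>n. A0 n + t * A n))"
      have v0: "v 0 = g"
        by (simp add: v_def g_def)
      have poly: "polyfun (\<lambda>t. v t n)" for n
        unfolding v_def by (rule polyfun_cofactor3)
      have nz: "v 0 \<noteq> (\<lambda>_. 0)"
        using A0(2) unfolding v0 g_def .
      obtain t where t: "t \<noteq> 0" "v t \<noteq> (\<lambda>_. 0)"
        using eventually_nonzero[of v, OF poly nz] by (elim exE conjE)
      have "\<exists>p\<in>P. proportional (v t) p" for t
        unfolding v_def by (rule cofactor_cover[OF line[OF A0(1) A]])
      then have "proportional (v t) (v 0)"
        by (rule constant_direction[of v, OF poly fin _ nz])
      then obtain c where c: "v t = (\<lambda>n. c * g n)"
        unfolding proportional_def v0 by (elim exE)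
      have "c \<noteq> 0"
        using t(2) unfolding c by auto
      define At where "At = (\<lambda>n. A0 n + t * A n)"
      have g: "cofactor3 At n = c * g n" for n
        using fun_cong[OF c] by (simp add: v_def At_def)
      have "det3 At = 0"
        unfolding At_def by (rule sing[OF line[OF A0(1) A]])
      then have "c * (\<Sum>j\<in>UNIV. At (i, j) * g (i', j)) = 0"
        using cofactor3_rows[of At i i'] unfolding g by (simp add: sum_distrib_left mult.left_commute)
      moreover have "(\<Sum>j\<in>UNIV. A0 (i, j) * g (i', j)) = 0"
        using cofactor3_rows[of A0 i i'] sing[OF A0(1)] unfolding g_def by simp
      moreover have "(\<Sum>j\<in>UNIV. At (i, j) * g (i', j))
          = (\<Sum>j\<in>UNIV. A0 (i, j) * g (i', j)) + t * (\<Sum>j\<in>UNIV. A (i, j) * g (i', j))"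
        by (simp add: At_def distrib_right sum.distrib sum_distrib_left mult.assoc)
      ultimately show ?thesis
        using t(1) \<open>c \<noteq> 0\<close> by simp
    qed
    moreover obtain i' j' where "g (i', j') \<noteq> 0"
      using A0(2) unfolding g_def by (metis surj_pair ext)
    then have "(\<lambda>j. g (i', j)) \<noteq> (\<lambda>_. 0)"
      by (metis (no_types))
    ultimately show False
      using right_kernel by blast
  next
    case False
    \<comment> \<open>Zero cofactors mean rank at most one. A vector orthogonal to the common column
      or row is then a common kernel vector on that side.\<close>
    have "(\<exists>u. \<forall>A\<in>W. \<exists>w. \<forall>i j. A (Pair i j) = u i * w j) \<or>
      (\<exists>w. \<forall>A\<in>W. \<exists>u. \<forall>i j. A (Pair i j) = u i * w j)"
    proof (rule rank1_space[OF W])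
      fix A assume "A \<in> W"
      then have "cofactor3 A (i, j) = 0" for i j
        using False by simp
      then have "\<forall>i j. A (i+1,j+1) * A (i+2,j+2) = A (i+1,j+2) * A (i+2,j+1)"
        by (simp add: cofactor3.simps)
      then show "minors_in {0} (\<lambda>i j. A (i, j))"
        unfolding minors_in_def all_3 add_0_left arith_3 by (simp add: mult.commute)
    qed
    then show False
    proof (elim disjE exE)
      fix u assume u: "\<forall>A\<in>W. \<exists>w. \<forall>i j. A (i, j) = u i * w j"
      obtain a :: "3 \<Rightarrow> 'k" where a: "a \<noteq> (\<lambda>_. 0)" "(\<Sum>i\<in>UNIV. a i * u i) = 0"
        using two_orthogonal_vectors3[of u] by (elim exE conjE)
      show False
      proof (rule left_kernel[OF a(1)])
        fix A j assume "A \<in> W"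
        then obtain w where "\<forall>i j. A (i, j) = u i * w j"
          using u by (elim ballE exE) auto
        then have "(\<Sum>i\<in>UNIV. a i * A (i, j)) = (\<Sum>i\<in>UNIV. a i * u i) * w j"
          by (simp add: sum_distrib_right mult.assoc)
        then show "(\<Sum>i\<in>UNIV. a i * A (i, j)) = 0"
          using a(2) by simp
      qed
    next
      fix w assume w: "\<forall>A\<in>W. \<exists>u. \<forall>i j. A (i, j) = u i * w j"
      obtain b :: "3 \<Rightarrow> 'k" where b: "b \<noteq> (\<lambda>_. 0)" "(\<Sum>j\<in>UNIV. b j * w j) = 0"
        using two_orthogonal_vectors3[of w] by (elim exE conjE)
      show False
      proof (rule right_kernel[OF b(1)])
        fix A i assume "A \<in> W"
        then obtain u where "\<forall>i j. A (i, j) = u i * w j"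
          using w by (elim ballE exE) auto
        then have "(\<Sum>j\<in>UNIV. A (i, j) * b j) = u i * (\<Sum>j\<in>UNIV. b j * w j)"
          by (simp add: sum_distrib_left ac_simps)
        then show "(\<Sum>j\<in>UNIV. A (i, j) * b j) = 0"
          using b(2) by simp
      qed
    qed
  qed
qed

section \<open>Matrices with simple spectrum\<close>

text \<open>One root \<open>r\<close> leaves a quadratic with discriminant
  \<open>- 3 * r^2 - 4 * p\<close>. The roots sum to zero, so a double root \<open>l\<close> comes
  with the root -2l, and (x - l)^2 (x + 2l) has the coefficients of the second case.\<close>

lemma depressed_cubic_roots:
  fixes p q :: "'k::alg_closed_field"
  assumes two: "(2::'k) \<noteq> 0"
  shows "(\<exists>r s t. r^3 + p * r + q = 0 \<and> s^3 + p * s + q = 0 \<and> t^3 + p * t + q = 0 \<and> r \<noteq> s \<and> r \<noteq> t \<and> s \<noteq> t) \<or>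
    (\<exists>l. p = - 3 * l^2 \<and> q = 2 * l^3)"
proof -
  have "\<exists>r. poly [:q, p, 0, 1:] r = 0"
    by (rule alg_closed_imp_poly_has_root) simp
  then obtain r where r: "r^3 + p * r + q = 0"
    by (auto simp: power3_eq_cube algebra_simps)
  obtain d where d: "d^2 = - 3 * r^2 - 4 * p"
    using nth_root_exists[of 2 "- 3 * r^2 - 4 * p"] by auto
  define s where "s = (- r + d) / 2"
  define t where "t = (- r - d) / 2"
  have st: "2 * s = - r + d" "2 * t = - r - d"
    using two by (simp_all add: s_def t_def)
  have q4: "2 * 2 * (s^2 + r * s + p + r^2) = 0" "2 * 2 * (t^2 + r * t + p + r^2) = 0"
    using st d by Groebner_Basis.algebra+
  have q: "s^2 + r * s + p + r^2 = 0" "t^2 + r * t + p + r^2 = 0"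
    using q4 two by (simp_all only: mult_eq_0_iff simp_thms)
  have roots: "s^3 + p * s + q = 0" "t^3 + p * t + q = 0"
    using q r by Groebner_Basis.algebra+
  show ?thesis
  proof (cases "r \<noteq> s \<and> r \<noteq> t \<and> s \<noteq> t")
    case True
    then show ?thesis
      using r roots by blast
  next
    case False
    then consider "r = s \<or> r = t" | "s = t"
      by blast
    then show ?thesis
    proof cases
      case 1
      then have "p = - 3 * r^2"
        using q by (elim disjE) (simp, Groebner_Basis.algebra)+
      moreover from this have "q = 2 * r^3"
        using r by Groebner_Basis.algebra
      ultimately show ?thesis by blast
    next
      case 2
      then have "- r + d = - r - d"
        using st by simp
      then have "2 * d = 0"
        by Groebner_Basis.algebra
      then have d0: "d = 0"
        using two by simp
      then have rs: "r = - 2 * s"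
        using st by Groebner_Basis.algebra
      have "p = - 3 * s^2"
        using q(1) rs by Groebner_Basis.algebra
      moreover from this have "q = 2 * s^3"
        using roots(1) by Groebner_Basis.algebra
      ultimately show ?thesis by blast
    qed
  qed
qed

text \<open>The cubic \<open>x\<^sup>3 + p(t) x + q(t)\<close> has zero discriminant for all \<open>t\<close>; its double root is then \<open>l + t m\<close>.\<close>

lemma double_root_affine:
  fixes l :: "'k::alg_closed_field"
  assumes disc: "\<And>t. 4 * (p0 + p1 * t + p2 * t^2)^3 + 27 * (q0 + q1 * t + q2 * t^2 + q3 * t^3)^2 = 0"
    and p0: "p0 = - 3 * l^2" and q0: "q0 = 2 * l^3" and p1: "p1 = - 6 * l * m" and l: "l \<noteq> 0"
    and two: "(2::'k) \<noteq> 0" and three: "(3::'k) \<noteq> 0"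
  shows "p2 = - 3 * m^2 \<and> q3 = 2 * m^3"
proof -
  \<comment> \<open>The discriminant as a polynomial in \<open>t\<close>. It has infinitely many
    zeros, so all its coefficients vanish.\<close>
  define P where "P = [:4 * p0^3 + 27 * q0^2, 12 * p0^2 * p1 + 54 * q0 * q1,
    12 * p0^2 * p2 + 12 * p0 * p1^2 + 27 * q1^2 + 54 * q0 * q2,
    24 * p0 * p1 * p2 + 4 * p1^3 + 54 * q0 * q3 + 54 * q1 * q2,
    12 * p0 * p2^2 + 12 * p1^2 * p2 + 27 * q2^2 + 54 * q1 * q3,
    12 * p1 * p2^2 + 54 * q2 * q3, 4 * p2^3 + 27 * q3^2:]"
  have "poly P t = 4 * (p0 + p1 * t + p2 * t^2)^3 + 27 * (q0 + q1 * t + q2 * t^2 + q3 * t^3)^2" for t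
    unfolding P_def poly_pCons poly_0 by Groebner_Basis.algebra
  then have "poly P t = 0" for t
    using disc by simp
  then have "P = 0"
    using poly_roots_finite[of P] infinite_UNIV_alg_closed[where 'k = 'k] by auto
  then have c1: "12 * p0^2 * p1 + 54 * q0 * q1 = 0"
    and c2: "12 * p0^2 * p2 + 12 * p0 * p1^2 + 27 * q1^2 + 54 * q0 * q2 = 0"
    and c3: "24 * p0 * p1 * p2 + 4 * p1^3 + 54 * q0 * q3 + 54 * q1 * q2 = 0"
    and c4: "12 * p0 * p2^2 + 12 * p1^2 * p2 + 27 * q2^2 + 54 * q1 * q3 = 0"
    unfolding P_def by simp_all
  have cancel: "x = 0" if "2 * 2 * 3 * 3 * 3 * l^n * x = 0" for n x
    using that l two three by (simp only: mult_eq_0_iff power_eq_0_iff simp_thms)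
  have q1: "q1 - 6 * l^2 * m = 0"
    using c1 unfolding p0 q0 p1 by (rule_tac cancel[of 3]) Groebner_Basis.algebra
  \<comment> \<open>\<open>x\<close> is the deviation of \<open>p2\<close> from the value that the
    double root \<open>l + t m\<close> predicts. The coefficients of \<open>t^2\<close> and
    \<open>t^3\<close> express \<open>q2\<close> and \<open>q3\<close> through \<open>x\<close>, and
    that of \<open>t^4\<close> becomes \<open>- 9 * l^2 * x^2\<close>.\<close>
  define x where "x = p2 + 3 * m^2"
  have p2: "p2 = x - 3 * m^2"
    by (simp add: x_def)
  have q2: "q2 - (6 * l * m^2 - l * x) = 0"
    using c2 q1 unfolding p0 q0 p1 p2 by (rule_tac cancel[of 3]) Groebner_Basis.algebra
  have q3: "q3 - (2 * m^3 - m * x) = 0"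
    using c3 q1 q2 unfolding p0 q0 p1 p2 by (rule_tac cancel[of 3]) Groebner_Basis.algebra
  have "x^2 = 0"
    using c4 q1 q2 q3 unfolding p0 p1 p2 by (rule_tac cancel[of 2]) Groebner_Basis.algebra
  then have "x = 0" by simp
  then show ?thesis
    using p2 q3 by simp
qed

definition trace3 :: "(3 \<times> 3 \<Rightarrow> 'k::field) \<Rightarrow> 'k" where
  "trace3 A = A (0,0) + A (1,1) + A (2,2)"

text \<open>The linear coefficient of the characteristic polynomial, written as a pairing with the
  cofactor matrix: its vanishing is the condition of \<open>singular_space_contradiction\<close> for
  \<open>J = ident3\<close>.\<close>

definition minor_sum :: "(3 \<times> 3 \<Rightarrow> 'k::field) \<Rightarrow> 'k" where
  "minor_sum A = (\<Sum>n\<in>UNIV. ident3 n * cofactor3 A n)"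

definition minor_polar :: "(3 \<times> 3 \<Rightarrow> 'k::field) \<Rightarrow> (3 \<times> 3 \<Rightarrow> 'k) \<Rightarrow> 'k" where
  "minor_polar A B = A (0,0) * (B (1,1) + B (2,2)) + A (1,1) * (B (0,0) + B (2,2)) + A (2,2) * (B (0,0) + B (1,1))
     - A (0,1) * B (1,0) - A (1,0) * B (0,1) - A (0,2) * B (2,0) - A (2,0) * B (0,2) - A (1,2) * B (2,1) - A (2,1) * B (1,2)"

lemma minor_sum_expand:
  "minor_sum A = A (0,0) * A (1,1) - A (0,1) * A (1,0) + A (0,0) * A (2,2) - A (0,2) * A (2,0) + A (1,1) * A (2,2) - A (1,2) * A (2,1)"
  unfolding minor_sum_def sum_UNIV_prod sum_UNIV_3 cofactor3.simps add_0_left arith_3 ident3_def by (simp add: algebra_simps)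

lemma minor_sum_line: "minor_sum (\<lambda>n. A n + t * B n) = minor_sum A + minor_polar A B * t + minor_sum B * t^2"
  unfolding minor_sum_expand minor_polar_def by Groebner_Basis.algebra

lemma det3_line: "det3 (\<lambda>n. A n + t * B n) = det3 A + (\<Sum>n\<in>UNIV. B n * cofactor3 A n) * t
      + (\<Sum>n\<in>UNIV. A n * cofactor3 B n) * t^2 + det3 B * t^3"
  unfolding sum_UNIV_prod sum_UNIV_3 cofactor3.simps add_0_left arith_3 det3_def by Groebner_Basis.algebra

lemma det3_shift: "det3 (\<lambda>n. A n - r * ident3 n) = - (r^3 - trace3 A * r^2 + minor_sum A * r - det3 A)"
  unfolding det3_def minor_sum_expand trace3_def ident3_def by (simp, Groebner_Basis.algebra)

lemma minor_sum_shift: "minor_sum (\<lambda>n. A n - r * ident3 n) = minor_sum A - 2 * r * trace3 A + 3 * r^2"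
  unfolding minor_sum_expand trace3_def ident3_def by (simp, Groebner_Basis.algebra)

lemma simple_spectrum_exists:
  fixes W :: "(3 \<times> 3 \<Rightarrow> 'k::alg_closed_field) set"
  assumes W: "lin_closed W" and fin: "finite P" and one: "ident3 \<in> W"
    and cover: "\<And>v. minors_in {0} (\<lambda>i j. v (i, j)) \<Longrightarrow> \<forall>A\<in>W. (\<Sum>n\<in>UNIV. A n * v n) = 0 \<Longrightarrow> \<exists>p\<in>P. proportional v p"
    and two: "(2::'k) \<noteq> 0" and three: "(3::'k) \<noteq> 0"
  shows "\<exists>A\<in>W. \<exists>r s t. det3 (\<lambda>n. A n - r * ident3 n) = 0 \<and> det3 (\<lambda>n. A n - s * ident3 n) = 0 \<and>
    det3 (\<lambda>n. A n - t * ident3 n) = 0 \<and> r \<noteq> s \<and> r \<noteq> t \<and> s \<noteq> t"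
proof (rule ccontr)
  assume neg: "\<not> ?thesis"
  have line: "(\<lambda>n. A n + t * B n) \<in> W" if "A \<in> W" "B \<in> W" for A B t
    using W that unfolding lin_closed_def by blast
  define W0 where "W0 = {A \<in> W. trace3 A = 0}"
  have line0: "(\<lambda>n. A n + t * B n) \<in> W0" if "A \<in> W0" "B \<in> W0" for A B t
  proof -
    have "trace3 (\<lambda>n. A n + t * B n) = trace3 A + t * trace3 B"
      by (simp add: trace3_def algebra_simps)
    then show ?thesis
      using that line by (simp add: W0_def)
  qed
  have ex_root: "\<exists>l. minor_sum A = - 3 * l^2 \<and> - det3 A = 2 * l^3" if A: "A \<in> W0" for A
  proof (rule ccontr)
    assume "\<not> ?thesis"
    then obtain r s t where "r^3 + minor_sum A * r + - det3 A = 0" "s^3 + minor_sum A * s + - det3 A = 0"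
      "t^3 + minor_sum A * t + - det3 A = 0" "r \<noteq> s" "r \<noteq> t" "s \<noteq> t"
      using depressed_cubic_roots[OF two, of "minor_sum A" "- det3 A"] by blast
    then have "det3 (\<lambda>n. A n - r * ident3 n) = 0" "det3 (\<lambda>n. A n - s * ident3 n) = 0"
      "det3 (\<lambda>n. A n - t * ident3 n) = 0" "r \<noteq> s" "r \<noteq> t" "s \<noteq> t"
      using A by (simp_all add: det3_shift W0_def)
    then show False
      using neg A unfolding W0_def by blast
  qed
  have disc: "4 * minor_sum A ^ 3 + 27 * (- det3 A)^2 = 0" if "A \<in> W0" for A
    using ex_root[OF that] by (elim exE conjE) Groebner_Basis.algebra
  have "\<exists>L. (\<forall>A\<in>W0. minor_sum A = - 3 * L A^2 \<and> - det3 A = 2 * L A^3) \<and>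
    (\<forall>A B t. L (\<lambda>n. A n + t * B n) = L A + t * L B)"
  proof (cases "\<exists>A\<in>W0. minor_sum A \<noteq> 0")
    case False
    have "minor_sum A = - 3 * 0^2" "- det3 A = 2 * 0^3" if "A \<in> W0" for A
    proof -
      obtain l where l: "minor_sum A = - 3 * l^2" "- det3 A = 2 * l^3"
        using ex_root[OF \<open>A \<in> W0\<close>] by blast
      have "l = 0"
        using l(1) False that three by simp
      then show "minor_sum A = - 3 * 0^2" "- det3 A = 2 * 0^3"
        using l by simp_all
    qed
    then show ?thesis
      by (intro exI[of _ "\<lambda>_. 0"]) auto
  next
    case True
    then obtain A0 where A0: "A0 \<in> W0" "minor_sum A0 \<noteq> 0"
      by blast
    obtain l where l: "minor_sum A0 = - 3 * l^2" "- det3 A0 = 2 * l^3"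
      using ex_root[OF A0(1)] by blast
    have l0: "l \<noteq> 0"
      using l(1) A0(2) by auto
    \<comment> \<open>If \<open>minor_sum\<close> of \<open>A0 + t B\<close> is to be
      \<open>- 3 * (l + t * L B)^2\<close>, its linear coefficient must be
      \<open>- 6 * l * L B\<close>. Defined this way \<open>L\<close> is linear by
      construction.\<close>
    define L where "L = (\<lambda>B. - minor_polar A0 B / (2 * 3 * l))"
    have pol: "minor_polar A0 B = - 6 * l * L B" for B
    proof -
      have "2 * 3 * l \<noteq> 0"
        using l0 two three by (simp only: mult_eq_0_iff simp_thms)
      then show ?thesis
        by (simp add: L_def)
    qed
    have main: "minor_sum B = - 3 * L B^2 \<and> - det3 B = 2 * L B^3" if B: "B \<in> W0" for B
    proof (rule double_root_affine[OF _ l pol l0 two three])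
      fix t
      show "4 * (minor_sum A0 + minor_polar A0 B * t + minor_sum B * t^2)^3
        + 27 * (- det3 A0 + (- (\<Sum>n\<in>UNIV. B n * cofactor3 A0 n)) * t + (- (\<Sum>n\<in>UNIV. A0 n * cofactor3 B n)) * t^2 + - det3 B * t^3)^2 = 0"
        using disc[OF line0[OF A0(1) B, of t]] unfolding minor_sum_line det3_line by (simp add: algebra_simps)
    qed
    have "minor_polar A0 (\<lambda>n. A n + t * B n) = minor_polar A0 A + t * minor_polar A0 B" for A B t
      unfolding minor_polar_def by Groebner_Basis.algebra
    then have "L (\<lambda>n. A n + t * B n) = L A + t * L B" for A B t
      by (simp add: L_def add_divide_distrib diff_divide_distrib)
    then show ?thesis
      using main by (intro exI[of _ L]) auto
  qed
  then obtain L where L': "\<forall>A\<in>W0. minor_sum A = - 3 * L A^2 \<and> - det3 A = 2 * L A^3"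
    and lin': "\<forall>A B t. L (\<lambda>n. A n + t * B n) = L A + t * L B"
    by (elim exE conjE)
  have L: "minor_sum A = - 3 * L A^2" "- det3 A = 2 * L A^3" if "A \<in> W0" for A
    using bspec[OF L' that] by simp_all
  have lin: "L (\<lambda>n. A n + t * B n) = L A + t * L B" for A B t
    by (rule spec[OF spec[OF spec[OF lin', of A], of B], of t])
  \<comment> \<open>After the shift zero is a double eigenvalue, so \<open>minor_sum\<close>
    vanishes along with the determinant. This makes the cofactors orthogonal to
    \<open>ident3\<close>, the direction lost in passing from \<open>W\<close> to
    \<open>W'\<close>.\<close>
  define W' where "W' = (\<lambda>A n. A n - L A * ident3 n) ` W0"
  show False
  proof (rule singular_space_contradiction[of W' P ident3])
    show "lin_closed W'"
      unfolding lin_closed_def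
    proof (intro ballI allI)
      fix U V t
      assume "U \<in> W'" "V \<in> W'"
      then obtain A B where AB: "A \<in> W0" "U = (\<lambda>n. A n - L A * ident3 n)" "B \<in> W0" "V = (\<lambda>n. B n - L B * ident3 n)"
        unfolding W'_def by (elim imageE)
      have "(\<lambda>n. U n + t * V n) = (\<lambda>n. (A n + t * B n) - L (\<lambda>n. A n + t * B n) * ident3 n)"
        unfolding lin AB by (simp add: algebra_simps)
      then show "(\<lambda>n. U n + t * V n) \<in> W'"
        unfolding W'_def using line0[OF AB(1,3)] by (rule image_eqI)
    qed
    show "det3 U = 0" if U: "U \<in> W'" for U
    proof -
      obtain A where A: "A \<in> W0" "U = (\<lambda>n. A n - L A * ident3 n)"
        using U unfolding W'_def by (elim imageE)
      have tr: "trace3 A = 0"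
        using A(1) by (simp add: W0_def)
      show ?thesis
        unfolding A(2) det3_shift using L[OF A(1)] tr by Groebner_Basis.algebra
    qed
    show "(\<Sum>n\<in>UNIV. ident3 n * cofactor3 U n) = 0" if U: "U \<in> W'" for U
    proof -
      obtain A where A: "A \<in> W0" "U = (\<lambda>n. A n - L A * ident3 n)"
        using U unfolding W'_def by (elim imageE)
      have tr: "trace3 A = 0"
        using A(1) by (simp add: W0_def)
      show ?thesis
        unfolding minor_sum_def[symmetric] A(2) minor_sum_shift using L[OF A(1)] tr by Groebner_Basis.algebra
    qed
    show "\<exists>p\<in>P. proportional v p"
      if v: "minors_in {0} (\<lambda>i j. v (i, j))" "\<forall>U\<in>W'. (\<Sum>n\<in>UNIV. U n * v n) = 0" "(\<Sum>n\<in>UNIV. ident3 n * v n) = 0" for v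
    proof (rule cover[OF v(1)], rule ballI)
      fix A assume A: "A \<in> W"
      \<comment> \<open>The traceless part of \<open>A\<close>: modulo multiples of
        \<open>ident3\<close>, to which \<open>v\<close> is orthogonal, every element of
        \<open>W\<close> comes from \<open>W'\<close>.\<close>
      define B where "B = (\<lambda>n. A n + (- trace3 A / 3) * ident3 n)"
      have "trace3 (\<lambda>n. A n + c * ident3 n) = trace3 A + c * 3" for c
        by (simp add: trace3_def ident3_def algebra_simps)
      then have "trace3 B = trace3 A + (- trace3 A / 3) * 3"
        unfolding B_def .
      then have "trace3 B = 0"
        using three by simp
      then have "B \<in> W0"
        using line[OF A one, of "- trace3 A / 3"] by (simp add: W0_def B_def)
      then have "(\<lambda>n. B n - L B * ident3 n) \<in> W'"
        unfolding W'_def by (rule imageI)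
      then have z: "(\<Sum>n\<in>UNIV. (B n - L B * ident3 n) * v n) = 0"
        by (rule bspec[OF v(2)])
      have "A n * v n = (B n - L B * ident3 n) * v n + (L B + trace3 A / 3) * (ident3 n * v n)" for n
        by (simp add: B_def algebra_simps)
      then have "(\<Sum>n\<in>UNIV. A n * v n) = (\<Sum>n\<in>UNIV. (B n - L B * ident3 n) * v n) + (L B + trace3 A / 3) * (\<Sum>n\<in>UNIV. ident3 n * v n)"
        by (simp only: sum.distrib sum_distrib_left)
      then show "(\<Sum>n\<in>UNIV. A n * v n) = 0"
        using z v(3) by simp
    qed
  qed (use fin two in auto)
qed

section \<open>Diagonalisation of a matrix with three distinct eigenvalues\<close>

lemma kernel_vector3:
  fixes B :: "3 \<times> 3 \<Rightarrow> 'k::field"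
  assumes "det3 B = 0"
  shows "\<exists>x :: 3 \<Rightarrow> 'k. x \<noteq> (\<lambda>_. 0) \<and> (\<forall>i. (\<Sum>j\<in>UNIV. B (i, j) * x j) = 0)"
proof (cases "\<exists>i j. cofactor3 B (i, j) \<noteq> 0")
  case True
  then obtain i' j where ij: "cofactor3 B (i', j) \<noteq> 0" by blast
  then have "(\<lambda>j. cofactor3 B (i', j)) \<noteq> (\<lambda>_. 0)"
    by (metis (no_types))
  then show ?thesis
    using cofactor3_rows[of B _ i'] assms by (intro exI[of _ "\<lambda>j. cofactor3 B (i', j)"]) simp
next
  case False
  then have "\<forall>i j. B (i+1,j+1) * B (i+2,j+2) = B (i+1,j+2) * B (i+2,j+1)"
    by (simp add: cofactor3.simps)
  then have "minors_in {0} (\<lambda>i j. B (i, j))"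
    unfolding minors_in_def all_3 add_0_left arith_3 by (simp add: mult.commute)
  then obtain u w where uw: "\<forall>i j. B (i, j) = u i * w j"
    using minors_in_0_factor by metis
  obtain b :: "3 \<Rightarrow> 'k" where b: "b \<noteq> (\<lambda>_. 0)" "(\<Sum>j\<in>UNIV. b j * w j) = 0"
    using two_orthogonal_vectors3[of w] by (elim exE conjE)
  have "(\<Sum>j\<in>UNIV. B (i, j) * b j) = u i * (\<Sum>j\<in>UNIV. b j * w j)" for i
    using uw by (simp add: sum_distrib_left ac_simps)
  then show ?thesis
    using b by (intro exI[of _ b]) simp
qed

lemma det3_mmult: "det3 (mmult A B) = det3 A * det3 B"
  unfolding det3_def mmult_def prod.case sum_UNIV_3 by Groebner_Basis.algebra

lemma det3_ident3: "det3 ident3 = 1"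
  by (simp add: det3_def ident3_def)

lemma mmult_assoc: "mmult (mmult A B) C = mmult A (mmult B C)"
  by (auto simp: mmult_def fun_eq_iff sum_UNIV_3 algebra_simps)

lemma mmult_ident3: "mmult ident3 A = A" "mmult A ident3 = A"
  by (auto simp: mmult_def ident3_def fun_eq_iff mult_delta_left mult_delta_right)

lemma eigenvector_matrix:
  fixes A :: "3 \<times> 3 \<Rightarrow> 'k::field"
  assumes root: "\<And>c. det3 (\<lambda>n. A n - r c * ident3 n) = 0"
    and dist: "r 0 \<noteq> r 1" "r 0 \<noteq> r 2" "r 1 \<noteq> r (2::3)"
  shows "\<exists>U. det3 U \<noteq> 0 \<and> (\<forall>i c. mmult A U (i, c) = r c * U (i, c))"
proof -
  have "\<exists>x. x \<noteq> (\<lambda>_. 0) \<and> (\<forall>i. (\<Sum>j\<in>UNIV. A (i, j) * x j) = r c * x i)" for c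
  proof -
    obtain x where x: "x \<noteq> (\<lambda>_. 0)" "\<forall>i. (\<Sum>j\<in>UNIV. (A (i, j) - r c * ident3 (i, j)) * x j) = 0"
      using kernel_vector3[OF root[of c]] by (elim exE conjE)
    have "(\<Sum>j\<in>UNIV. (A (i, j) - r c * ident3 (i, j)) * x j) = (\<Sum>j\<in>UNIV. A (i, j) * x j) - r c * x i" for i
      by (simp add: left_diff_distrib sum_subtractf ident3_def mult_delta_left mult_delta_right)
    then show ?thesis
      using x by (intro exI[of _ x]) simp
  qed
  then obtain x where x: "\<And>c. x c \<noteq> (\<lambda>_. 0)" "\<And>c i. (\<Sum>j\<in>UNIV. A (i, j) * x c j) = r c * x c i"
    by metis
  define U where "U = (\<lambda>(j, c). x c j)"
  have eig: "mmult A U (i, c) = r c * U (i, c)" for i c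
    using x(2) by (simp add: mmult_def U_def)
  have "det3 U \<noteq> 0"
  proof
    assume U0: "det3 U = 0"
    obtain y :: "3 \<Rightarrow> 'k" where y: "y \<noteq> (\<lambda>_. 0)" "\<forall>i. (\<Sum>c\<in>UNIV. U (i, c) * y c) = 0"
      using kernel_vector3[OF U0] by (elim exE conjE)
    have step: "(\<Sum>c\<in>UNIV. U (i, c) * (r c * z c)) = 0" if "\<forall>i. (\<Sum>c\<in>UNIV. U (i, c) * z c) = 0" for z i
    proof -
      have "(\<Sum>c\<in>UNIV. U (i, c) * (r c * z c)) = (\<Sum>c\<in>UNIV. mmult A U (i, c) * z c)"
        by (simp add: eig ac_simps)
      also have "\<dots> = (\<Sum>j\<in>UNIV. A (i, j) * (\<Sum>c\<in>UNIV. U (j, c) * z c))"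
        by (simp add: mmult_def sum_UNIV_3 algebra_simps)
      finally show ?thesis
        using that by simp
    qed
    have s0: "U (i, 0) * y 0 + U (i, 1) * y 1 + U (i, 2) * y 2 = 0" for i
      using y(2) by (simp add: sum_UNIV_3)
    have s1: "U (i, 0) * (r 0 * y 0) + U (i, 1) * (r 1 * y 1) + U (i, 2) * (r 2 * y 2) = 0" for i
      using step[OF y(2), of i] by (simp add: sum_UNIV_3)
    have s2: "U (i, 0) * (r 0 * (r 0 * y 0)) + U (i, 1) * (r 1 * (r 1 * y 1)) + U (i, 2) * (r 2 * (r 2 * y 2)) = 0" for i
      using step[of "\<lambda>c. r c * y c" i] step[OF y(2)] by (simp add: sum_UNIV_3)
    \<comment> \<open>Lagrange elimination: \<open>s2 - (r 1 + r 2) * s1 + r 1 * r 2 * s0\<close>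
      isolates the first eigenvector, and similarly for the others.\<close>
    have "(r 0 - r 1) * (r 0 - r 2) * y 0 * U (i, 0) = 0" "(r 1 - r 0) * (r 1 - r 2) * y 1 * U (i, 1) = 0"
      "(r 2 - r 0) * (r 2 - r 1) * y 2 * U (i, 2) = 0" for i
      using s0[of i] s1[of i] s2[of i] by Groebner_Basis.algebra+
    then have "\<forall>i. y 0 = 0 \<or> U (i, 0) = 0" "\<forall>i. y 1 = 0 \<or> U (i, 1) = 0" "\<forall>i. y 2 = 0 \<or> U (i, 2) = 0"
      using dist by simp_all
    then have "\<forall>c. y c = 0 \<or> (\<forall>i. x c i = 0)"
      unfolding all_3[of "\<lambda>c. y c = 0 \<or> (\<forall>i. x c i = 0)"] by (auto simp: U_def)
    then have "y c = 0 \<or> x c = (\<lambda>_. 0)" for c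
      unfolding fun_eq_iff by (rule spec)
    then have "y c = 0" for c
      using x(1) by simp
    then show False
      using y(1) by auto
  qed
  then show ?thesis
    using eig by blast
qed

text \<open>An invertible \<open>g\<close> in \<open>W\<close> is moved to the identity, and a
  matrix with simple spectrum in the moved space is diagonalised. Moving back, \<open>g\<close> and
  \<open>A\<close> become diagonal between the same \<open>V\<close> and \<open>R\<close>;
  combinations of them with one zero diagonal entry are the required relations.\<close>

lemma diagonal_pencil_exists:
  fixes W :: "(3 \<times> 3 \<Rightarrow> 'k::alg_closed_field) set"
  assumes W: "lin_closed W" and fin: "finite P"
    and cover: "\<And>v. minors_in {0} (\<lambda>i j. v (i, j)) \<Longrightarrow> \<forall>A\<in>W. (\<Sum>n\<in>UNIV. A n * v n) = 0 \<Longrightarrow> \<exists>p\<in>P. proportional v p"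
    and two: "(2::'k) \<noteq> 0" and three: "(3::'k) \<noteq> 0"
  shows "\<exists>L R. det3 L \<noteq> 0 \<and> det3 R \<noteq> 0 \<and> (\<lambda>(i, j). L (0, i) * R (0, j) - L (1, i) * R (1, j)) \<in> W \<and>
    (\<lambda>(i, j). L (0, i) * R (0, j) - L (2, i) * R (2, j)) \<in> W"
proof -
  have line: "(\<lambda>n. A n + t * B n) \<in> W" if "A \<in> W" "B \<in> W" for A B t
    using W that unfolding lin_closed_def by blast
  have "\<exists>g\<in>W. det3 g \<noteq> 0"
  proof (rule ccontr)
    assume neg: "\<not> ?thesis"
    \<comment> \<open>Taking \<open>J\<close> to be zero imposes no condition beyond orthogonality
      to \<open>W\<close>.\<close>
    show False
    proof (rule singular_space_contradiction[OF W fin _ _ _ two, of "\<lambda>_. 0"])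
      show "\<exists>p\<in>P. proportional v p"
        if "minors_in {0} (\<lambda>i j. v (i, j))" "\<forall>A\<in>W. (\<Sum>n\<in>UNIV. A n * v n) = 0" for v
        using cover that by blast
    qed (use neg in auto)
  qed
  then obtain g where g: "g \<in> W" "det3 g \<noteq> 0"
    by (elim bexE)
  obtain h where h: "mmult g h = ident3" "mmult h g = ident3"
    using inverse3_exists[OF g(2)] by (elim exE conjE)
  define W1 where "W1 = mmult h ` W"
  \<comment> \<open>Multiplying \<open>W\<close> by \<open>h\<close> acts on annihilators through
    the transpose, so points move by the transpose of \<open>g\<close>.\<close>
  define P1 where "P1 = (\<lambda>p (i, j). \<Sum>k\<in>UNIV. g (k, i) * p (k, j)) ` P"
  have "\<exists>A\<in>W1. \<exists>r s t. det3 (\<lambda>n. A n - r * ident3 n) = 0 \<and> det3 (\<lambda>n. A n - s * ident3 n) = 0 \<and>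
    det3 (\<lambda>n. A n - t * ident3 n) = 0 \<and> r \<noteq> s \<and> r \<noteq> t \<and> s \<noteq> t"
  proof (rule simple_spectrum_exists[OF _ _ _ _ two three])
    show "lin_closed W1"
      unfolding lin_closed_def W1_def
    proof (intro ballI allI)
      fix A B t assume "A \<in> mmult h ` W" "B \<in> mmult h ` W"
      then obtain A' B' where AB: "A' \<in> W" "A = mmult h A'" "B' \<in> W" "B = mmult h B'"
        by (elim imageE)
      have "(\<lambda>n. A n + t * B n) = mmult h (\<lambda>n. A' n + t * B' n)"
        unfolding AB by (auto simp: mmult_def fun_eq_iff distrib_left sum.distrib sum_distrib_left ac_simps)
      then show "(\<lambda>n. A n + t * B n) \<in> mmult h ` W"
        using line[OF AB(1,3)] by (rule image_eqI)
    qed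
    show "finite P1"
      using fin by (simp add: P1_def)
    show "ident3 \<in> W1"
      unfolding W1_def using h(2)[symmetric] g(1) by (rule image_eqI)
    show "\<exists>p\<in>P1. proportional v p"
      if v: "minors_in {0} (\<lambda>i j. v (i, j))" "\<forall>A\<in>W1. (\<Sum>n\<in>UNIV. A n * v n) = 0" for v
    proof -
      define w where "w = (\<lambda>(k, j). \<Sum>i\<in>UNIV. h (i, k) * v (i, j))"
      obtain a b where ab: "\<forall>i j. v (i, j) = a i * b j"
        using minors_in_0_factor[OF v(1)] by (elim exE)
      have "w (k, j) = (\<Sum>i\<in>UNIV. h (i, k) * a i) * b j" for k j
        by (simp add: w_def ab sum_distrib_right mult.assoc)
      then have "minors_in {0} (\<lambda>i j. w (i, j))"
        by (simp add: minors_in_def)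
      moreover have "(\<Sum>n\<in>UNIV. A n * w n) = (\<Sum>n\<in>UNIV. mmult h A n * v n)" for A
        unfolding sum_UNIV_prod sum_UNIV_3 w_def mmult_def prod.case by Groebner_Basis.algebra
      then have "\<forall>A\<in>W. (\<Sum>n\<in>UNIV. A n * w n) = 0"
        using v(2) by (simp add: W1_def)
      ultimately obtain p d where p: "p \<in> P" "w = (\<lambda>n. d * p n)"
        using cover unfolding proportional_def by meson
      have hg: "(\<Sum>k\<in>UNIV. h (i', k) * g (k, i)) = (if i' = i then 1 else 0)" for i i'
        using fun_cong[OF h(2), of "(i', i)"] by (simp add: mmult_def ident3_def)
      have "v (i, j) = (\<Sum>k\<in>UNIV. g (k, i) * w (k, j))" for i j
      proof -
        have "(\<Sum>k\<in>UNIV. g (k, i) * w (k, j)) = (\<Sum>i'\<in>UNIV. (\<Sum>k\<in>UNIV. h (i', k) * g (k, i)) * v (i', j))"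
          unfolding sum_UNIV_3 w_def prod.case by Groebner_Basis.algebra
        then show ?thesis
          unfolding hg by (simp add: mult_delta_left)
      qed
      then have "v = (\<lambda>n. d * (\<lambda>(i, j). \<Sum>k\<in>UNIV. g (k, i) * p (k, j)) n)"
        by (auto simp: fun_eq_iff p(2) sum_distrib_left ac_simps)
      then have "proportional v (\<lambda>(i, j). \<Sum>k\<in>UNIV. g (k, i) * p (k, j))"
        unfolding proportional_def by (rule exI)
      then show ?thesis
        unfolding P1_def using p(1)
        by (intro bexI[of _ "\<lambda>(i, j). \<Sum>k\<in>UNIV. g (k, i) * p (k, j)"] image_eqI[of _ _ p]) simp_all
    qed
  qed
  then obtain A' r s t where A': "A' \<in> W1" and roots: "det3 (\<lambda>n. A' n - r * ident3 n) = 0"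
    "det3 (\<lambda>n. A' n - s * ident3 n) = 0" "det3 (\<lambda>n. A' n - t * ident3 n) = 0" and ne: "r \<noteq> s" "r \<noteq> t" "s \<noteq> t"
    by (elim bexE exE conjE)
  define f where "f = (\<lambda>c::3. if c = 0 then r else if c = 1 then s else t)"
  have f: "f 0 = r" "f 1 = s" "f 2 = t"
    by (simp_all add: f_def)
  have "det3 (\<lambda>n. A' n - f c * ident3 n) = 0" for c
    using roots by (simp add: f_def)
  then obtain U where U: "det3 U \<noteq> 0" "\<forall>i c. mmult A' U (i, c) = f c * U (i, c)"
    using eigenvector_matrix[of A' f] ne f by auto
  obtain R where R: "mmult U R = ident3" "mmult R U = ident3"
    using inverse3_exists[OF U(1)] by (elim exE conjE)
  have detR: "det3 R \<noteq> 0"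
    using det3_mmult[of U R] R(1) by (auto simp: det3_ident3)
  obtain A where A: "A \<in> W" "A' = mmult h A"
    using A' unfolding W1_def by (elim imageE)
  define V where "V = mmult g U"
  have detV: "det3 V \<noteq> 0"
    using g(2) U(1) by (simp add: V_def det3_mmult)
  have gV: "g = mmult V R"
    unfolding V_def mmult_assoc R(1) mmult_ident3 ..
  have "A = mmult g A'"
    unfolding A(2) mmult_assoc[symmetric] h(1) mmult_ident3 ..
  also have "\<dots> = mmult (mmult g (mmult A' U)) R"
    unfolding mmult_assoc R(1) mmult_ident3 ..
  also have "mmult A' U = (\<lambda>(i, c). f c * U (i, c))"
    using U(2) by (auto simp: fun_eq_iff)
  finally have AV: "A (i, j) = (\<Sum>c\<in>UNIV. f c * V (i, c) * R (c, j))" for i j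
    by (simp add: V_def mmult_def sum_UNIV_3 algebra_simps)
  have gV': "g (i, j) = (\<Sum>c\<in>UNIV. V (i, c) * R (c, j))" for i j
    by (subst gV) (simp add: mmult_def)
  \<comment> \<open>Lagrange denominators. In \<open>(r - s) * (A - t * g)\<close> the first two
    diagonal entries are \<open>k 0\<close> and \<open>- k 1\<close>, in
    \<open>(r - t) * (A - s * g)\<close> the first and last are \<open>k 0\<close> and
    \<open>- k 2\<close>; \<open>L\<close> absorbs these factors.\<close>
  define k where "k = (\<lambda>c::3. if c = 0 then (r - s) * (r - t) else if c = 1 then (s - r) * (s - t) else (t - r) * (t - s))"
  have k: "k 0 = (r - s) * (r - t)" "k 1 = (s - r) * (s - t)" "k 2 = (t - r) * (t - s)"
    by (simp_all add: k_def)
  define L where "L = (\<lambda>(c, i). k c * V (i, c))"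
  have "det3 L = k 0 * k 1 * k 2 * det3 V"
    unfolding det3_def L_def prod.case by Groebner_Basis.algebra
  then have detL: "det3 L \<noteq> 0"
    using detV ne by (simp add: k)
  have comb: "(\<lambda>n. u * (A n - x * g n)) \<in> W" for u x
  proof -
    have B: "(\<lambda>n. A n + (- x) * g n) \<in> W"
      by (rule line[OF A(1) g(1)])
    have "(\<lambda>n. (A n + (- x) * g n) + (u - 1) * (A n + (- x) * g n)) \<in> W"
      by (rule line[OF B B])
    then show ?thesis
      by (simp add: algebra_simps)
  qed
  have "(\<lambda>(i, j). L (0, i) * R (0, j) - L (1, i) * R (1, j)) = (\<lambda>n. (r - s) * (A n - t * g n))"
    by (auto simp: fun_eq_iff L_def k AV gV' sum_UNIV_3 f algebra_simps)
  moreover have "(\<lambda>(i, j). L (0, i) * R (0, j) - L (2, i) * R (2, j)) = (\<lambda>n. (r - t) * (A n - s * g n))"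
    by (auto simp: fun_eq_iff L_def k AV gV' sum_UNIV_3 f algebra_simps)
  ultimately show ?thesis
    using detL detR comb by (intro exI[of _ L] exI[of _ R]) simp
qed

section \<open>Changes of coordinates\<close>

lemma minors_in_flip: "minors_in J F \<Longrightarrow> minors_in J (\<lambda>j i. F i j)"
  unfolding minors_in_def
proof (intro allI)
  fix i i' j j'
  assume "\<forall>i i' j j'. F i j * F i' j' - F i j' * F i' j \<in> J"
  then have "F i j * F i' j' - F i j' * F i' j \<in> J" by blast
  then show "F i j * F i' j' - F i' j * F i j' \<in> J"
    by (simp add: mult.commute)
qed

text \<open>Minors are bilinear in the columns. The map \<open>\<phi>\<close> lets the combined
  columns depend on \<open>p\<close>: a slice operation on a cube mixes, in another flattening, only
  columns with the same remaining index.\<close>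

lemma minors_in_columns:
  fixes F :: "'i \<Rightarrow> 'j \<Rightarrow> 'k::field poly5" and c :: "'p \<Rightarrow> 'l::finite \<Rightarrow> 'k poly5"
  assumes J: "ideal J S5" and F: "minors_in J F"
  shows "minors_in J (\<lambda>i p. \<Sum>l\<in>UNIV. c p l * F i (\<phi> p l))"
  unfolding minors_in_def
proof (intro allI)
  fix i i' p p'
  let ?a = "\<lambda>l. c p l * F i (\<phi> p l)" and ?b = "\<lambda>l. c p' l * F i' (\<phi> p' l)"
  let ?c = "\<lambda>l. c p' l * F i (\<phi> p' l)" and ?d = "\<lambda>l. c p l * F i' (\<phi> p l)"
  have "sum ?a UNIV * sum ?b UNIV - sum ?c UNIV * sum ?d UNIV = sum ?a UNIV * sum ?b UNIV - sum ?d UNIV * sum ?c UNIV"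
    by (simp only: mult.commute[of "sum ?c UNIV"])
  also have "\<dots> = (\<Sum>l\<in>UNIV. \<Sum>m\<in>UNIV. ?a l * ?b m - ?d l * ?c m)"
    by (simp only: sum_product sum_subtractf)
  also have "\<dots> = (\<Sum>l\<in>UNIV. \<Sum>m\<in>UNIV. (c p l * c p' m)
      * (F i (\<phi> p l) * F i' (\<phi> p' m) - F i (\<phi> p' m) * F i' (\<phi> p l)))"
    by (simp add: right_diff_distrib ac_simps)
  also have "\<dots> \<in> J"
    using F unfolding minors_in_def by (intro S5_ideal_sum[OF J] S5_ideal_mult[OF J]) blast
  finally show "(\<Sum>l\<in>UNIV. c p l * F i (\<phi> p l)) * (\<Sum>l\<in>UNIV. c p' l * F i' (\<phi> p' l))
      - (\<Sum>l\<in>UNIV. c p' l * F i (\<phi> p' l)) * (\<Sum>l\<in>UNIV. c p l * F i' (\<phi> p l)) \<in> J" .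
qed

lemma minors_in_rows:
  fixes F :: "'i \<Rightarrow> 'j \<Rightarrow> 'k::field poly5" and c :: "'p \<Rightarrow> 'l::finite \<Rightarrow> 'k poly5"
  assumes J: "ideal J S5" and F: "minors_in J F"
  shows "minors_in J (\<lambda>p j. \<Sum>l\<in>UNIV. c p l * F (\<phi> p l) j)"
  by (rule minors_in_flip[OF minors_in_columns[OF J minors_in_flip[OF F], of c \<phi>]])

lemma minors2_subset_iff:
  fixes J :: "'k::field poly5 set"
  assumes J: "ideal J S5"
  shows "minors2 M \<subseteq> J \<longleftrightarrow> minors_in J M"
proof
  assume sub: "minors2 M \<subseteq> J"
  have lt: "M i j * M i' j' - M i j' * M i' j \<in> J" if "i < i'" "j < j'" for i i' j j'
    using sub that unfolding minors2_def by blast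
  have lt': "M i j * M i' j' - M i j' * M i' j \<in> J" if "i < i'" for i i' j j'
  proof (cases j j' rule: linorder_cases)
    case less
    then show ?thesis by (rule lt[OF that])
  next
    case equal
    then show ?thesis by (simp add: S5_ideal_zero[OF J])
  next
    case greater
    from S5_ideal_minus[OF J lt[OF that this]] show ?thesis by simp
  qed
  show "minors_in J M"
    unfolding minors_in_def
  proof (intro allI)
    fix i i' j j'
    show "M i j * M i' j' - M i j' * M i' j \<in> J"
    proof (cases i i' rule: linorder_cases)
      case less
      then show ?thesis by (rule lt')
    next
      case equal
      then show ?thesis by (simp add: S5_ideal_zero[OF J] mult.commute)
    next
      case greater
      from S5_ideal_minus[OF J lt'[OF this, of j j']] show ?thesis by (simp add: mult.commute)
    qed
  qed
next
  assume "minors_in J M"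
  then show "minors2 M \<subseteq> J"
    unfolding minors_in_def minors2_def by blast
qed

lemma ideal_diff_commute:
  fixes J :: "'k::field poly5 set"
  assumes J: "ideal J S5"
  shows "a - b \<in> J \<Longrightarrow> b - a \<in> J"
  using S5_ideal_minus[OF J, of "a - b"] by simp

text \<open>A flattening has six minors up to sign: four ordinary faces and two diagonal ones. Each
  ordinary face occurs in two flattenings, so the three of them have exactly the twelve face
  determinants as minors.\<close>

lemma cube_faces_subset_iff:
  fixes J :: "'k::field poly5 set"
  assumes J: "ideal J S5"
  shows "det2 ` cube_faces M \<subseteq> J \<longleftrightarrow> cube_minors_in J (\<lambda>(i, j, h). M i j h)"
proof
  assume "det2 ` cube_faces M \<subseteq> J"
  then have e: "M 0 0 0 * M 0 1 1 - M 0 0 1 * M 0 1 0 \<in> J" "M 1 0 0 * M 1 1 1 - M 1 0 1 * M 1 1 0 \<in> J"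
    "M 0 0 0 * M 1 0 1 - M 0 0 1 * M 1 0 0 \<in> J" "M 0 1 0 * M 1 1 1 - M 0 1 1 * M 1 1 0 \<in> J"
    "M 0 0 0 * M 1 1 0 - M 0 1 0 * M 1 0 0 \<in> J" "M 0 0 1 * M 1 1 1 - M 0 1 1 * M 1 0 1 \<in> J"
    "M 0 0 0 * M 1 1 1 - M 0 0 1 * M 1 1 0 \<in> J" "M 0 1 0 * M 1 0 1 - M 0 1 1 * M 1 0 0 \<in> J"
    "M 0 0 0 * M 1 1 1 - M 0 1 0 * M 1 0 1 \<in> J" "M 0 0 1 * M 1 1 0 - M 0 1 1 * M 1 0 0 \<in> J"
    "M 0 0 0 * M 1 1 1 - M 0 1 1 * M 1 0 0 \<in> J" "M 0 0 1 * M 1 1 0 - M 0 1 0 * M 1 0 1 \<in> J"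
    by (simp_all add: cube_faces_def det2_def mult.commute)
  note e' = e[THEN ideal_diff_commute[OF J]]
  show "cube_minors_in J (\<lambda>(i, j, h). M i j h)"
    using e e' S5_ideal_zero[OF J] unfolding cube_minors_in_def minors_in_def all_prod all_2 by (simp add: mult.commute)
next
  assume "cube_minors_in J (\<lambda>(i, j, h). M i j h)"
  then have flats: "\<And>i i' j j' h h'. M i j h * M i' j' h' - M i j' h' * M i' j h \<in> J"
    "\<And>i i' j j' h h'. M i j h * M i' j' h' - M i' j h' * M i j' h \<in> J"
    "\<And>i i' j j' h h'. M i j h * M i' j' h' - M i' j' h * M i j h' \<in> J"
    unfolding cube_minors_in_def minors_in_def all_prod by auto
  have flats': "M i j h * M i' j' h' - M i j' h * M i' j h' \<in> J"
    "M i j h * M i' j' h' - M i j h' * M i' j' h \<in> J" for i i' j j' h h'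
    using flats(2,3) by (simp_all add: mult.commute)
  show "det2 ` cube_faces M \<subseteq> J"
    unfolding cube_faces_def det2_def using flats(1) flats' by (simp add: image_subset_iff)
qed

section \<open>Linear relations between the entries of an array\<close>

definition relations :: "('n::finite \<Rightarrow> 'k::field poly5) \<Rightarrow> ('n \<Rightarrow> 'k) set" where
  "relations M = {t. \<forall>l. (\<Sum>n\<in>UNIV. t n * coeff1 (M n) l) = 0}"

lemma lin_closed_relations: "lin_closed (relations M)"
  by (auto simp: lin_closed_def relations_def distrib_right sum.distrib mult.assoc simp flip: sum_distrib_left)

lemma sum_const5: "(\<Sum>n\<in>A. const5 (f n)) = const5 (sum f A)"
  by (induction A rule: infinite_finite_induct) (simp_all add: single_add)

lemma relations_sum:
  assumes t: "t \<in> relations M" and M: "\<And>n. linear_form (M n)"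
  shows "(\<Sum>n\<in>UNIV. const5 (t n) * M n) = 0"
proof -
  have "(\<Sum>n\<in>UNIV. const5 (t n) * M n)
      = (\<Sum>n\<in>UNIV. \<Sum>l\<in>UNIV. const5 (t n * coeff1 (M n) l) * variable l)"
    by (subst linear_form_expand[OF M]) (simp add: sum_distrib_left mult_single flip: mult.assoc)
  also have "\<dots> = (\<Sum>l\<in>UNIV. (\<Sum>n\<in>UNIV. const5 (t n * coeff1 (M n) l)) * variable l)"
    by (subst sum.swap) (simp add: sum_distrib_right)
  also have "\<dots> = (\<Sum>l\<in>UNIV. const5 (\<Sum>n\<in>UNIV. t n * coeff1 (M n) l) * variable l)"
    by (simp only: sum_const5)
  also have "\<dots> = 0"
    using t by (simp add: relations_def)
  finally show ?thesis .
qed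

text \<open>A vector orthogonal to all relations is the vector of values of the entries at some
  point, by the double annihilator. If it also satisfies the rank condition \<open>Q\<close>, this
  point lies on the scheme, which has finitely many points.\<close>

lemma section_cover:
  fixes M :: "'n::finite \<Rightarrow> 'k::field poly5"
  assumes M: "\<And>n. linear_form (M n)" and Z: "Z \<in> Hilb d" "Z = Idl\<^bsub>S5\<^esub> G"
    and G: "\<And>x. Q (\<lambda>n. eval5 x (M n)) \<Longrightarrow> G \<subseteq> {f. eval5 x f = 0}"
  shows "\<exists>P. finite P \<and> (\<forall>v. Q v \<longrightarrow> (\<forall>t\<in>relations M. (\<Sum>n\<in>UNIV. t n * v n) = 0) \<longrightarrow> (\<exists>p\<in>P. proportional v p))"
proof -
  obtain P where P: "finite P" "\<And>x. (\<forall>g\<in>Z. eval5 x g = 0) \<Longrightarrow> \<exists>p\<in>P. proportional x p"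
    using finitely_many_points[OF Z(1)] by blast
  have "\<exists>p\<in>(\<lambda>p n. eval5 p (M n)) ` P. proportional v p"
    if v: "Q v" "\<forall>t\<in>relations M. (\<Sum>n\<in>UNIV. t n * v n) = 0" for v
  proof -
    have "\<exists>x. \<forall>n. v n = (\<Sum>l\<in>UNIV. coeff1 (M n) l * x l)"
      using v(2) by (intro combination_if_vanishing_on_common_kernel) (auto simp: relations_def)
    then obtain x where "\<forall>n. v n = (\<Sum>l\<in>UNIV. coeff1 (M n) l * x l)"
      by (elim exE)
    then have x: "v = (\<lambda>n. eval5 x (M n))"
      by (simp add: fun_eq_iff eval5_linear_form[OF M])
    have "Z \<subseteq> {f. eval5 x f = 0}"
      unfolding Z(2) genideal_S5_subset_iff[OF ideal_vanishing] using G v(1) x by blast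
    then obtain p where p: "p \<in> P" "proportional x p"
      using P(2)[of x] by blast
    then obtain c where c: "x = (\<lambda>i. c * p i)"
      unfolding proportional_def by (elim exE)
    have "v = (\<lambda>n. c * eval5 p (M n))"
      unfolding x eval5_linear_form[OF M] c by (simp add: sum_distrib_left mult.left_commute)
    then have "proportional v (\<lambda>n. eval5 p (M n))"
      unfolding proportional_def by (rule exI)
    then show ?thesis
      by (rule bexI[of _ "\<lambda>n. eval5 p (M n)"]) (rule imageI[OF p(1)])
  qed
  then show ?thesis
    using P(1) by (intro exI[of _ "(\<lambda>p n. eval5 p (M n)) ` P"]) blast
qed

section \<open>Invertible operations on rows, columns and slices\<close>

definition row_transform :: "('p \<Rightarrow> 'l::finite \<Rightarrow> 'k::field) \<Rightarrow> ('l \<Rightarrow> 'j \<Rightarrow> 'k poly5) \<Rightarrow> 'p \<Rightarrow> 'j \<Rightarrow> 'k poly5" where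
  "row_transform a F = (\<lambda>p j. \<Sum>l\<in>UNIV. const5 (a p l) * F l j)"

lemma row_transform_inverse:
  fixes a b :: "'l::finite \<Rightarrow> 'l \<Rightarrow> 'k::field"
  assumes "\<And>p q. (\<Sum>l\<in>UNIV. b p l * a l q) = (if p = q then 1 else 0)"
  shows "row_transform b (row_transform a F) = F"
proof -
  have "row_transform b (row_transform a F) p j = (\<Sum>q\<in>UNIV. const5 (\<Sum>l\<in>UNIV. b p l * a l q) * F q j)" for p j
    unfolding row_transform_def sum_const5[symmetric] sum_distrib_left sum_distrib_right
    by (subst sum.swap) (simp add: mult_single flip: mult.assoc)
  then have "row_transform b (row_transform a F) p j = (\<Sum>q\<in>UNIV. (if p = q then F q j else 0))" for p j
    unfolding assms by (simp add: if_distrib[of "\<lambda>c. const5 c * _"] cong: if_cong)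
  then show ?thesis
    by (simp add: fun_eq_iff)
qed

lemma minors_in_row_transform_iff:
  fixes a b :: "'l::finite \<Rightarrow> 'l \<Rightarrow> 'k::field"
  assumes J: "ideal J S5" and "\<And>p q. (\<Sum>l\<in>UNIV. b p l * a l q) = (if p = q then 1 else 0)"
  shows "minors_in J (row_transform a F) \<longleftrightarrow> minors_in J F"
proof
  assume "minors_in J (row_transform a F)"
  from minors_in_rows[OF J this, of "\<lambda>p l. const5 (b p l)" "\<lambda>p l. l"]
  have "minors_in J (row_transform b (row_transform a F))"
    by (simp only: row_transform_def[of b])
  then show "minors_in J F"
    by (simp only: row_transform_inverse[OF assms(2)])
next
  assume "minors_in J F"
  from minors_in_rows[OF J this, of "\<lambda>p l. const5 (a p l)" "\<lambda>p l. l"]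
  show "minors_in J (row_transform a F)"
    by (simp only: row_transform_def)
qed

text \<open>Acts on the first index; the other two are reached by conjugation with
  \<open>swap12\<close> and \<open>swap13\<close>.\<close>

definition cube_transform :: "(2 \<Rightarrow> 2 \<Rightarrow> 'k::field) \<Rightarrow> (2 \<times> 2 \<times> 2 \<Rightarrow> 'k poly5) \<Rightarrow> 2 \<times> 2 \<times> 2 \<Rightarrow> 'k poly5" where
  "cube_transform a T = (\<lambda>(i, p). row_transform a (\<lambda>i p. T (i, p)) i p)"

lemma cube_transform_expand:
  "cube_transform a T (i, j, h) = const5 (a i 0) * T (0, j, h) + const5 (a i 1) * T (1, j, h)"
  by (simp add: cube_transform_def row_transform_def sum_UNIV_2)

text \<open>Acting on the first index is a row operation on the first flattening and a column
  operation on the other two.\<close>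

lemma cube_minors_in_transform:
  fixes T :: "2 \<times> 2 \<times> 2 \<Rightarrow> 'k::field poly5"
  assumes J: "ideal J S5" and T: "cube_minors_in J T"
  shows "cube_minors_in J (cube_transform a T)"
proof -
  have T': "minors_in J (\<lambda>i (j, h). T (i, j, h))" "minors_in J (\<lambda>j (i, h). T (i, j, h))"
    "minors_in J (\<lambda>h (i, j). T (i, j, h))"
    using T unfolding cube_minors_in_def by blast+
  have 1: "(\<lambda>i (j, h). cube_transform a T (i, j, h))
      = (\<lambda>i p. \<Sum>l\<in>UNIV. const5 (a i l) * (\<lambda>i (j, h). T (i, j, h)) l p)"
    by (auto simp: fun_eq_iff cube_transform_def row_transform_def)
  have 2: "(\<lambda>j (i, h). cube_transform a T (i, j, h))
      = (\<lambda>j p. \<Sum>l\<in>UNIV. const5 (a (fst p) l) * (\<lambda>j (i, h). T (i, j, h)) j (l, snd p))"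
    by (auto simp: fun_eq_iff cube_transform_def row_transform_def)
  have 3: "(\<lambda>h (i, j). cube_transform a T (i, j, h))
      = (\<lambda>h p. \<Sum>l\<in>UNIV. const5 (a (fst p) l) * (\<lambda>h (i, j). T (i, j, h)) h (l, snd p))"
    by (auto simp: fun_eq_iff cube_transform_def row_transform_def)
  show ?thesis
    unfolding cube_minors_in_def
  proof (intro conjI)
    show "minors_in J (\<lambda>i (j, h). cube_transform a T (i, j, h))"
      unfolding 1 by (rule minors_in_rows[OF J T'(1)])
    show "minors_in J (\<lambda>j (i, h). cube_transform a T (i, j, h))"
      unfolding 2 by (rule minors_in_columns[OF J T'(2)])
    show "minors_in J (\<lambda>h (i, j). cube_transform a T (i, j, h))"
      unfolding 3 by (rule minors_in_columns[OF J T'(3)])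
  qed
qed

lemma cube_minors_in_transform_iff:
  assumes J: "ideal J S5" and det: "a 0 0 * a 1 1 - a 0 1 * a 1 0 \<noteq> 0"
  shows "cube_minors_in J (cube_transform a T) \<longleftrightarrow> cube_minors_in J T"
proof
  assume "cube_minors_in J (cube_transform a T)"
  define e where "e = a 0 0 * a 1 1 - a 0 1 * a 1 0"
  define b where "b = (\<lambda>(i :: 2) (j :: 2). if i = 0 then if j = 0 then a 1 1 / e else - a 0 1 / e
    else if j = 0 then - a 1 0 / e else a 0 0 / e)"
  have "\<forall>p q. (\<Sum>l\<in>UNIV. b p l * a l q) = (if p = q then 1 else 0)"
    using det unfolding all_2 sum_UNIV_2 e_def[symmetric] by (simp add: b_def flip: add_divide_distrib diff_divide_distrib) (simp add: e_def mult.commute)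
  then have "cube_transform b (cube_transform a T) = T"
    using row_transform_inverse[of b a "\<lambda>i p. T (i, p)"] by (simp add: cube_transform_def fun_eq_iff)
  moreover have "cube_minors_in J (cube_transform b (cube_transform a T))"
    by (rule cube_minors_in_transform[OF J]) fact
  ultimately show "cube_minors_in J T" by simp
qed (rule cube_minors_in_transform[OF J])

lemma cube_minors_in_swap12: "cube_minors_in J (\<lambda>n. T (swap12 n)) \<longleftrightarrow> cube_minors_in J T"
  unfolding cube_minors_in_def minors_in_def all_prod swap_simps prod.case by auto

lemma cube_minors_in_swap13: "cube_minors_in J (\<lambda>n. T (swap13 n)) \<longleftrightarrow> cube_minors_in J T"
  unfolding cube_minors_in_def minors_in_def all_prod swap_simps prod.case by auto

text \<open>A hexagonal arrangement of six forms around one central form: on the torus where all of them are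
  invertible, both sides parametrise the entries as \<open>n x\<^sub>i / x\<^sub>j\<close>.\<close>

lemma cube_minors_in_iff_minors_in:
  fixes T :: "2 \<times> 2 \<times> 2 \<Rightarrow> 'k::field poly5" and S :: "3 \<Rightarrow> 3 \<Rightarrow> 'k poly5"
  assumes J: "ideal J S5" and diag: "T (1,1,1) = T (0,0,0)" "S 0 0 = T (0,0,0)" "S 1 1 = T (0,0,0)" "S 2 2 = T (0,0,0)"
    and S: "S 0 1 = T (1,0,0)" "S 1 2 = T (0,1,0)" "S 2 0 = T (0,0,1)" "S 0 2 = T (1,1,0)" "S 1 0 = T (0,1,1)" "S 2 1 = T (1,0,1)"
  shows "cube_minors_in J T \<longleftrightarrow> minors_in J S"
proof -
  define n a b c d e f where defs: "n = T (0,0,0)" "a = T (1,0,0)" "b = T (1,1,0)" "c = T (0,1,1)"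
    "d = T (0,1,0)" "e = T (0,0,1)" "f = T (1,0,1)"
  note entries = diag S defs[symmetric]
  \<comment> \<open>Nine of the twelve face determinants, which up to sign are the minors of
    \<open>S\<close>. The other three are differences of the products \<open>a * c\<close>,
    \<open>b * e\<close>, \<open>d * f\<close> of opposite entries, each congruent to
    \<open>n * n\<close>.\<close>
  let ?E = "n * n - a * c \<in> J \<and> n * n - b * e \<in> J \<and> n * n - d * f \<in> J \<and> n * d - b * c \<in> J \<and> a * d - n * b \<in> J \<and>
    n * f - a * e \<in> J \<and> n * a - b * f \<in> J \<and> c * f - n * e \<in> J \<and> n * c - d * e \<in> J"
  note zero = S5_ideal_zero[OF J]
  note sym = ideal_diff_commute[OF J]
  have trans: "x - z \<in> J" if "x - y \<in> J" "y - z \<in> J" for x y z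
    using S5_ideal_add[OF J that] by simp
  have "minors_in J S" if E: ?E
  proof -
    have "a * c - n * n \<in> J" "b * e - n * n \<in> J" "d * f - n * n \<in> J" "b * c - n * d \<in> J" "n * b - a * d \<in> J"
      "a * e - n * f \<in> J" "b * f - n * a \<in> J" "n * e - c * f \<in> J" "d * e - n * c \<in> J"
      using E sym by blast+
    then show ?thesis
      using E zero unfolding minors_in_def all_3 entries by (simp add: mult.commute)
  qed
  moreover have ?E if m: "minors_in J S"
  proof -
    have m: "S i j * S i' j' - S i j' * S i' j \<in> J" for i i' j j'
      using m unfolding minors_in_def by blast
    show ?thesis
      using m[of 0 0 1 1] m[of 0 0 2 2] m[of 1 1 2 2] m[of 0 0 1 2] m[of 0 1 1 2] m[of 0 0 2 1] m[of 0 1 2 2]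
        m[of 1 0 2 1] m[of 1 0 2 2] unfolding entries by (simp add: mult.commute)
  qed
  moreover have "cube_minors_in J T" if E: ?E
  proof -
    have E1: "a * c - n * n \<in> J" "b * e - n * n \<in> J" "d * f - n * n \<in> J" "b * c - n * d \<in> J" "n * b - a * d \<in> J"
      "a * e - n * f \<in> J" "b * f - n * a \<in> J" "n * e - c * f \<in> J" "d * e - n * c \<in> J"
      using E sym by blast+
    have "a * c - b * e \<in> J" "b * e - d * f \<in> J" "a * c - d * f \<in> J"
      using E E1 trans by blast+
    then have "a * c - b * e \<in> J" "b * e - d * f \<in> J" "a * c - d * f \<in> J"
      "b * e - a * c \<in> J" "d * f - b * e \<in> J" "d * f - a * c \<in> J"
      using sym by blast+
    then show ?thesis
      using E E1 zero unfolding cube_minors_in_def minors_in_def all_prod all_2 prod.case entries by (simp add: mult.commute)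
  qed
  moreover have ?E if m: "cube_minors_in J T"
  proof -
    have "n * c - e * d \<in> J" "a * n - f * b \<in> J" "n * f - e * a \<in> J" "d * n - c * b \<in> J" "n * b - d * a \<in> J" "e * n - c * f \<in> J"
      "n * n - c * a \<in> J" "n * n - f * d \<in> J" "n * n - b * e \<in> J"
      using m unfolding cube_minors_in_def minors_in_def all_prod all_2 prod.case entries by (simp_all add: mult.commute)
    moreover from this(5,6) have "d * a - n * b \<in> J" "c * f - e * n \<in> J"
      using sym by blast+
    ultimately show ?thesis by (simp add: mult.commute)
  qed
  ultimately show ?thesis by blast
qed

section \<open>The two constructions\<close>

lemma minors_in_vanishing:
  "minors_in {0} (\<lambda>i j. eval5 x (F i j)) \<Longrightarrow> minors_in {f. eval5 x f = 0} F"
  by (auto simp: minors_in_def eval5_diff eval5_mult)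

lemma cube_minors_in_vanishing:
  "cube_minors_in {0} (\<lambda>n. eval5 x (T n)) \<Longrightarrow> cube_minors_in {f. eval5 x f = 0} T"
  unfolding cube_minors_in_def minors_in_def all_prod by (auto simp: eval5_diff eval5_mult)

lemma const5_mult: "const5 (a * b) = const5 a * const5 b"
  by (simp add: mult_single)

lemma linear_form_row_transform:
  assumes "\<And>l. linear_form (F l j)"
  shows "linear_form (row_transform a F p j)"
  unfolding row_transform_def using assms by (intro sum_in_forms forms_const_mult)

lemma linear_form_cube_transform:
  assumes "\<And>n. linear_form (T n)"
  shows "linear_form (cube_transform a T n)"
  unfolding cube_transform_def case_prod_beta by (intro linear_form_row_transform assms)

text \<open>The off-diagonal entries of \<open>S\<close> are placed along the hexagon of edges that
  avoids the two equal corners, as \<open>cube_minors_in_iff_minors_in\<close> prescribes;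
  \<open>cube_matrix\<close> is the inverse placement.\<close>

definition symmetric_cube :: "(3 \<Rightarrow> 3 \<Rightarrow> 'k::field poly5) \<Rightarrow> 2 \<Rightarrow> 2 \<Rightarrow> 2 \<Rightarrow> 'k poly5" where
  "symmetric_cube S i j h =
     (if i = 0 then if j = 0 then if h = 0 then S 0 0 else S 2 0 else if h = 0 then S 1 2 else S 1 0
      else if j = 0 then if h = 0 then S 0 1 else S 2 1 else if h = 0 then S 0 2 else S 0 0)"

definition cube_matrix :: "(2 \<times> 2 \<times> 2 \<Rightarrow> 'k::field poly5) \<Rightarrow> 3 \<Rightarrow> 3 \<Rightarrow> 'k poly5" where
  "cube_matrix T i j =
     (if i = j then T (0,0,0)
      else if i = 0 then if j = 1 then T (1,0,0) else T (1,1,0)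
      else if i = 1 then if j = 0 then T (0,1,1) else T (0,1,0)
      else if j = 0 then T (0,0,1) else T (1,0,1))"

lemma anglo_american_imp_scandinavian:
  fixes Z :: "'k::alg_closed_field poly5 set"
  assumes two: "(2::'k) \<noteq> 0" and three: "(3::'k) \<noteq> 0" and Hilb: "Z \<in> Hilb d" and aa: "anglo_american Z"
  shows "scandinavian Z"
proof -
  obtain M where M: "\<And>i j h. linear_form (M i j h)" and depth: "ideal_depth S5 (Idl\<^bsub>S5\<^esub> (det2 ` cube_faces M)) = 4"
    and Z: "Z = Idl\<^bsub>S5\<^esub> (det2 ` cube_faces M)"
    using aa unfolding anglo_american_def by blast
  define N where "N = (\<lambda>(i, j, h). M i j h)"
  have N: "linear_form (N n)" for n
    by (cases n rule: prod_cases3) (simp only: N_def prod.case M)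
  have faces: "det2 ` cube_faces M \<subseteq> J \<longleftrightarrow> cube_minors_in J N" if "ideal J S5" for J
    unfolding N_def by (rule cube_faces_subset_iff[OF that])
  have "\<exists>P. finite P \<and> (\<forall>v. cube_minors_in {0} v \<longrightarrow>
      (\<forall>t\<in>relations N. (\<Sum>n\<in>UNIV. t n * v n) = 0) \<longrightarrow> (\<exists>p\<in>P. proportional v p))"
    by (rule section_cover[OF N Hilb Z]) (simp only: faces[OF ideal_vanishing] cube_minors_in_vanishing)
  then obtain P where P: "finite P" and "\<forall>v. cube_minors_in {0} v \<longrightarrow>
      (\<forall>t\<in>relations N. (\<Sum>n\<in>UNIV. t n * v n) = 0) \<longrightarrow> (\<exists>p\<in>P. proportional v p)"
    by (elim exE conjE)
  then have cover: "\<exists>p\<in>P. proportional v p"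
    if "cube_minors_in {0} v" "\<forall>t\<in>relations N. (\<Sum>n\<in>UNIV. t n * v n) = 0" for v
    using that by simp
  have "\<exists>T\<in>relations N. hyperdet T \<noteq> 0"
    by (rule exists_hyperdet_nonzero[OF lin_closed_relations P _ two three]) (rule cover)
  then obtain T where T: "T \<in> relations N" "hyperdet T \<noteq> 0"
    by (elim bexE)
  obtain \<alpha> \<beta> \<gamma> \<alpha>' \<beta>' \<gamma>' where dec: "\<forall>i j h. T (i, j, h) = \<alpha> i * \<beta> j * \<gamma> h + \<alpha>' i * \<beta>' j * \<gamma>' h"
    using tensor_rank2[OF T(2) two] by (elim exE)
  have dets: "\<alpha> 0 * \<alpha>' 1 - \<alpha> 1 * \<alpha>' 0 \<noteq> 0" "\<beta> 0 * \<beta>' 1 - \<beta> 1 * \<beta>' 0 \<noteq> 0" "\<gamma> 0 * \<gamma>' 1 - \<gamma> 1 * \<gamma>' 0 \<noteq> 0"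
    using T(2) hyperdet_rank2[of T \<alpha> \<beta> \<gamma> \<alpha>' \<beta>' \<gamma>'] dec by auto
  \<comment> \<open>The sign at \<open>\<alpha>'\<close> turns the sum of two pure tensors into the
    difference of the two corners.\<close>
  define A where "A = (\<lambda>i::2. if i = 0 then \<alpha> else (\<lambda>l. - \<alpha>' l))"
  define B where "B = (\<lambda>i::2. if i = 0 then \<beta> else \<beta>')"
  define C where "C = (\<lambda>i::2. if i = 0 then \<gamma> else \<gamma>')"
  have det: "A 0 0 * A 1 1 - A 0 1 * A 1 0 \<noteq> 0" "B 0 0 * B 1 1 - B 0 1 * B 1 0 \<noteq> 0" "C 0 0 * C 1 1 - C 0 1 * C 1 0 \<noteq> 0"
    using dets by (auto simp: A_def B_def C_def)
  define N1 where "N1 = cube_transform A N"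
  define N2 where "N2 = (\<lambda>n. cube_transform B (\<lambda>n. N1 (swap12 n)) (swap12 n))"
  define N3 where "N3 = (\<lambda>n. cube_transform C (\<lambda>n. N2 (swap13 n)) (swap13 n))"
  have N3: "linear_form (N3 n)" for n
    unfolding N3_def N2_def N1_def by (intro linear_form_cube_transform N)
  have iff: "cube_minors_in J N3 \<longleftrightarrow> cube_minors_in J N" if J: "ideal J S5" for J
  proof -
    note transform = cube_minors_in_transform_iff[OF J]
    have "cube_minors_in J N3 \<longleftrightarrow> cube_minors_in J (cube_transform C (\<lambda>n. N2 (swap13 n)))"
      unfolding N3_def by (rule cube_minors_in_swap13)
    also have "\<dots> \<longleftrightarrow> cube_minors_in J N2"
      unfolding transform[of C, OF det(3)] by (rule cube_minors_in_swap13)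
    also have "\<dots> \<longleftrightarrow> cube_minors_in J (cube_transform B (\<lambda>n. N1 (swap12 n)))"
      unfolding N2_def by (rule cube_minors_in_swap12)
    also have "\<dots> \<longleftrightarrow> cube_minors_in J N1"
      unfolding transform[of B, OF det(2)] by (rule cube_minors_in_swap12)
    also have "\<dots> \<longleftrightarrow> cube_minors_in J N"
      unfolding N1_def by (rule transform[of A, OF det(1)])
    finally show ?thesis .
  qed
  have "N3 (0,0,0) - N3 (1,1,1) = (\<Sum>n\<in>UNIV. const5 (T n) * N n)"
    unfolding sum_UNIV_prod sum_UNIV_2 N3_def N2_def N1_def cube_transform_expand swap_simps
    unfolding A_def B_def C_def dec[THEN spec, THEN spec, THEN spec]
    by (simp only: if_True if_False refl one_neq_zero single_add const5_mult single_uminus) (simp add: algebra_simps)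
  also have "\<dots> = 0"
    by (rule relations_sum[OF T(1) N])
  finally have diag: "N3 (1,1,1) = N3 (0,0,0)"
    by simp
  have eq: "minors2 (cube_matrix N3) \<subseteq> J \<longleftrightarrow> det2 ` cube_faces M \<subseteq> J" if J: "ideal J S5" for J
  proof -
    have "cube_minors_in J N3 \<longleftrightarrow> minors_in J (cube_matrix N3)"
      by (rule cube_minors_in_iff_minors_in[OF J diag]) (simp_all add: cube_matrix_def)
    then show ?thesis
      using minors2_subset_iff[OF J] faces[OF J] iff[OF J] by blast
  qed
  have "Z = Idl\<^bsub>S5\<^esub> (minors2 (cube_matrix N3))"
    unfolding Z by (rule genideal_S5_eqI) (use eq in blast)
  moreover have "linear_form (cube_matrix N3 i j)" for i j
    unfolding cube_matrix_def using N3 by (simp split: if_splits)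
  ultimately show ?thesis
    unfolding scandinavian_def using depth Z by metis
qed

lemma scandinavian_imp_anglo_american:
  fixes Z :: "'k::alg_closed_field poly5 set"
  assumes two: "(2::'k) \<noteq> 0" and three: "(3::'k) \<noteq> 0" and Hilb: "Z \<in> Hilb d" and sc: "scandinavian Z"
  shows "anglo_american Z"
proof -
  obtain M where M: "\<And>i j. linear_form (M i j)" and depth: "ideal_depth S5 (Idl\<^bsub>S5\<^esub> (minors2 M)) = 4"
    and Z: "Z = Idl\<^bsub>S5\<^esub> (minors2 M)"
    using sc unfolding scandinavian_def by blast
  define N where "N = (\<lambda>(i, j). M i j)"
  have N: "linear_form (N n)" for n
    by (cases n) (simp only: N_def prod.case M)
  have van: "minors2 M \<subseteq> {f. eval5 x f = 0}" if "minors_in {0} (\<lambda>i j. eval5 x (N (i, j)))" for x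
    unfolding minors2_subset_iff[OF ideal_vanishing] using minors_in_vanishing[OF that] by (simp only: N_def prod.case)
  have "\<exists>P. finite P \<and> (\<forall>v. minors_in {0} (\<lambda>i j. v (i, j)) \<longrightarrow>
      (\<forall>t\<in>relations N. (\<Sum>n\<in>UNIV. t n * v n) = 0) \<longrightarrow> (\<exists>p\<in>P. proportional v p))"
    by (rule section_cover[OF N Hilb Z]) (rule van)
  then obtain P where P: "finite P" and "\<forall>v. minors_in {0} (\<lambda>i j. v (i, j)) \<longrightarrow>
      (\<forall>t\<in>relations N. (\<Sum>n\<in>UNIV. t n * v n) = 0) \<longrightarrow> (\<exists>p\<in>P. proportional v p)"
    by (elim exE conjE)
  then have cover: "\<exists>p\<in>P. proportional v p"
    if "minors_in {0} (\<lambda>i j. v (i, j))" "\<forall>t\<in>relations N. (\<Sum>n\<in>UNIV. t n * v n) = 0" for v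
    using that by simp
  have "\<exists>L R. det3 L \<noteq> 0 \<and> det3 R \<noteq> 0 \<and>
      (\<lambda>(i, j). L (0, i) * R (0, j) - L (1, i) * R (1, j)) \<in> relations N \<and>
      (\<lambda>(i, j). L (0, i) * R (0, j) - L (2, i) * R (2, j)) \<in> relations N"
    by (rule diagonal_pencil_exists[OF lin_closed_relations P _ two three]) (rule cover)
  then obtain L R where det: "det3 L \<noteq> 0" "det3 R \<noteq> 0"
    and rel: "(\<lambda>(i, j). L (0, i) * R (0, j) - L (1, i) * R (1, j)) \<in> relations N"
      "(\<lambda>(i, j). L (0, i) * R (0, j) - L (2, i) * R (2, j)) \<in> relations N"
    by (elim exE conjE)
  obtain L' where L': "mmult L' L = ident3"
    using inverse3_exists[OF det(1)] by (elim exE conjE)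
  obtain R' where R': "mmult R' R = ident3"
    using inverse3_exists[OF det(2)] by (elim exE conjE)
  have inv: "(\<Sum>l\<in>UNIV. L' (p, l) * L (l, q)) = (if p = q then 1 else 0)"
    "(\<Sum>l\<in>UNIV. R' (p, l) * R (l, q)) = (if p = q then 1 else 0)" for p q
    using fun_cong[OF L', of "(p, q)"] fun_cong[OF R', of "(p, q)"] by (simp_all add: mmult_def ident3_def)
  define N1 where "N1 = row_transform (\<lambda>c i. L (c, i)) M"
  \<comment> \<open>Column operations are row operations on the transpose.\<close>
  define S where "S = (\<lambda>c d. row_transform (\<lambda>d j. R (d, j)) (\<lambda>j c. N1 c j) d c)"
  have S: "linear_form (S c d)" for c d
    unfolding S_def N1_def by (intro linear_form_row_transform M)
  have iff: "minors_in J S \<longleftrightarrow> minors_in J M" if J: "ideal J S5" for J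
  proof -
    have "minors_in J S \<longleftrightarrow> minors_in J (row_transform (\<lambda>d j. R (d, j)) (\<lambda>j c. N1 c j))"
      unfolding S_def using minors_in_flip by blast
    also have "\<dots> \<longleftrightarrow> minors_in J (\<lambda>j c. N1 c j)"
      by (rule minors_in_row_transform_iff[OF J, where b = "\<lambda>p l. R' (p, l)"]) (rule inv)
    also have "\<dots> \<longleftrightarrow> minors_in J N1"
      using minors_in_flip by blast
    also have "\<dots> \<longleftrightarrow> minors_in J M"
      unfolding N1_def by (rule minors_in_row_transform_iff[OF J, where b = "\<lambda>p l. L' (p, l)"]) (rule inv)
    finally show ?thesis .
  qed
  \<comment> \<open>Diagonal entry \<open>c\<close> of \<open>S\<close> pairs row \<open>c\<close>
    of \<open>L\<close> and row \<open>c\<close> of \<open>R\<close> with the entries of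
    \<open>M\<close>, so the two relations of the pencil are differences of diagonal
    entries.\<close>
  have diff: "S 0 0 - S c c = (\<Sum>n\<in>UNIV. const5 ((\<lambda>(i, j). L (0, i) * R (0, j) - L (c, i) * R (c, j)) n) * N n)" for c
    unfolding sum_UNIV_prod sum_UNIV_3 S_def N1_def row_transform_def
    by (simp add: N_def single_diff const5_mult algebra_simps)
  have "S 0 0 - S 1 1 = 0" "S 0 0 - S 2 2 = 0"
    unfolding diff by (rule relations_sum[OF rel(1) N], rule relations_sum[OF rel(2) N])
  then have diag: "S 1 1 = S 0 0" "S 2 2 = S 0 0"
    by simp_all
  have eq: "det2 ` cube_faces (symmetric_cube S) \<subseteq> J \<longleftrightarrow> minors2 M \<subseteq> J" if J: "ideal J S5" for J
  proof -
    have "cube_minors_in J (\<lambda>(i, j, h). symmetric_cube S i j h) \<longleftrightarrow> minors_in J S"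
      by (rule cube_minors_in_iff_minors_in[OF J]) (simp_all add: symmetric_cube_def diag)
    then show ?thesis
      using minors2_subset_iff[OF J] cube_faces_subset_iff[OF J] iff[OF J] by blast
  qed
  have "Z = Idl\<^bsub>S5\<^esub> (det2 ` cube_faces (symmetric_cube S))"
    unfolding Z by (rule genideal_S5_eqI) (use eq in blast)
  moreover have "linear_form (symmetric_cube S i j h)" for i j h
    unfolding symmetric_cube_def using S by (simp split: if_splits)
  ultimately show ?thesis
    unfolding anglo_american_def using depth Z by metis
qed

theorem proposition6p3p2:
  fixes Z :: "'k::alg_closed_field poly5 set"
  assumes "CHAR('k) \<noteq> 2" and "CHAR('k) \<noteq> 3"
    and "Z \<in> Hilb_aG_0 6"
  shows "anglo_american Z \<longleftrightarrow> scandinavian Z"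
proof -
  \<comment> \<open>A characteristic that divides the prime \<open>q\<close> is 1 or
    \<open>q\<close>, and 1 is impossible in a field.\<close>
  have "of_nat q \<noteq> (0::'k)" if "prime q" "CHAR('k) \<noteq> q" for q
    using that by (metis CHAR_not_1' One_nat_def of_nat_eq_0_iff_char_dvd prime_nat_iff)
  from this[of 2] this[of 3] have "(2::'k) \<noteq> 0" "(3::'k) \<noteq> 0"
    using assms(1,2) by simp_all
  then show ?thesis
    using assms(3) anglo_american_imp_scandinavian scandinavian_imp_anglo_american
    unfolding Hilb_aG_0_def by blast
qed

end
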